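(* Let $\mathfrak{A}$ be a $C^*$-algebra, $\mathcal{H}$ a Hilbert space and $\mathfrak{T}$ the trace class operators on $\mathcal{H}$. Let $C_{cp}=(\mathfrak{A}\otimes_\pi\mathfrak{T})_+$ be the positive cone of the Banach $*$-algebra $\mathfrak{A}\otimes_\pi\mathfrak{T}$. Then the set $$P_{cp}=\{T\in\mathcal{L}(\mathfrak{A},\mathcal{B}(\mathcal{H})) : \tilde T(z)\ge 0 \text{ for all } z\in C_{cp}\}$$ is exactly the set of completely positive maps $T:\mathfrak{A}\to\mathcal{B}(\mathcal{H})$.
   Context: $\mathcal{L}(\mathfrak{A},\mathcal{B}(\mathcal{H}))$ is the space of bounded linear maps $\mathfrak{A}\to\mathcal{B}(\mathcal{H})$. $x\mapsto x^t$ is the transpose map on $\mathcal{B}(\mathcal{H})$ with respect to a fixed orthonormal basis. $\mathfrak{A}\otimes_\pi\mathfrak{T}$ is the completion of the algebraic tensor product $\mathfrak{A}\odot\mathfrak{T}$ in the projective norm $\pi(x)=\inf\{\sum_{i=1}^n\|a_i\|\,\|b_i\|_1 : x=\sum_{i=1}^n a_i\otimes b_i\}$, where $\|\cdot\|_1$ is the trace norm; it is a Banach $*$-algebra with $(a\otimes b)(a'\otimes b')=aa'\otimes bb'$ and $(a\otimes b)^*=a^*\otimes b^*$. Its positive cone $(\mathfrak{A}\otimes_\pi\mathfrak{T})_+$ is the $\pi$-norm closure of the set of finite sums of elements $z^*z$, $z\in\mathfrak{A}\otimes_\pi\mathfrak{T}$. For $T\in\mathcal{L}(\mathfrak{A},\mathcal{B}(\mathcal{H}))$,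 $\tilde T$ is the bounded linear functional on $\mathfrak{A}\otimes_\pi\mathfrak{T}$ determined by $\tilde T(\sum_{i=1}^n a_i\otimes b_i)=\sum_{i=1}^n\mathrm{Tr}(T(a_i)b_i^t)$. *)

theory Defs
  imports "HOL-Analysis.Analysis"
begin

section \<open>Complex normed spaces, C*-algebras and Hilbert spaces\<close>

class scaleC =
  fixes scaleC :: "complex \<Rightarrow> 'a \<Rightarrow> 'a"  (infixr "*\<^sub>C" 75)

class complex_vector = real_vector + scaleC +
  assumes scaleC_add_right: "c *\<^sub>C (x + y) = c *\<^sub>C x + c *\<^sub>C y"
    and scaleC_add_left: "(c + d) *\<^sub>C x = c *\<^sub>C x + d *\<^sub>C x"
    and scaleC_scaleC: "c *\<^sub>C d *\<^sub>C x = (c * d) *\<^sub>C x"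
    and scaleC_one: "1 *\<^sub>C x = x"
    and scaleR_scaleC: "r *\<^sub>R x = complex_of_real r *\<^sub>C x"

class complex_normed_vector = complex_vector + real_normed_vector +
  assumes norm_scaleC: "norm (c *\<^sub>C x) = cmod c * norm x"

text \<open>The class \<^class>\<open>real_normed_algebra\<close> does not ask for a unit, so C*-algebras may be
  non-unital.\<close>

class cstar_algebra = complex_normed_vector + real_normed_algebra + banach +
  fixes star :: "'a \<Rightarrow> 'a"
  assumes mult_scaleC_left: "(c *\<^sub>C x) * y = c *\<^sub>C (x * y)"
    and mult_scaleC_right: "x * (c *\<^sub>C y) = c *\<^sub>C (x * y)"
    and star_add: "star (x + y) = star x + star y"
    and star_scaleC: "star (c *\<^sub>C x) = cnj c *\<^sub>C star x"
    and star_mult: "star (x * y) = star y * star x"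
    and star_star: "star (star x) = x"
    and norm_star_mult_self: "norm (star x * x) = (norm x)\<^sup>2"

text \<open>The inner product is linear in the second argument.\<close>

class complex_hilbert = complex_normed_vector + banach +
  fixes cinner :: "'a \<Rightarrow> 'a \<Rightarrow> complex"
  assumes cinner_add_right: "cinner x (y + z) = cinner x y + cinner x z"
    and cinner_scaleC_right: "cinner x (c *\<^sub>C y) = c * cinner x y"
    and cinner_commute: "cinner x y = cnj (cinner y x)"
    and cinner_self: "cinner x x = complex_of_real ((norm x)\<^sup>2)"

definition clinear :: "('a::complex_vector \<Rightarrow> 'b::complex_vector) \<Rightarrow> bool" where
  "clinear f \<longleftrightarrow> (\<forall>x y. f (x + y) = f x + f y) \<and> (\<forall>c x. f (c *\<^sub>C x) = c *\<^sub>C f x)"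

instantiation blinfun :: (real_normed_vector, complex_normed_vector) complex_normed_vector
begin

lift_definition scaleC_blinfun :: "complex \<Rightarrow> 'a \<Rightarrow>\<^sub>L 'b \<Rightarrow> 'a \<Rightarrow>\<^sub>L 'b"
  is "\<lambda>c f x. c *\<^sub>C f x"
proof -
  fix c :: complex and f :: "'a \<Rightarrow> 'b"
  assume f: "bounded_linear f"
  then interpret f: bounded_linear f .
  show "bounded_linear (\<lambda>x. c *\<^sub>C f x)"
  proof (rule bounded_linear_intro[where K = "cmod c * onorm f"])
    show "c *\<^sub>C f (x + y) = c *\<^sub>C f x + c *\<^sub>C f y" for x y
      by (simp add: f.add scaleC_add_right)
    show "c *\<^sub>C f (r *\<^sub>R x) = r *\<^sub>R c *\<^sub>C f x" for r x
      by (simp add: f.scaleR scaleR_scaleC scaleC_scaleC mult.commute)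
    show "norm (c *\<^sub>C f x) \<le> norm x * (cmod c * onorm f)" for x
      using mult_left_mono[OF onorm[OF f, of x], of "cmod c"]
      by (simp add: norm_scaleC algebra_simps)
  qed
qed

instance
proof
  fix c d :: complex and r :: real and f g :: "'a \<Rightarrow>\<^sub>L 'b"
  show "c *\<^sub>C (f + g) = c *\<^sub>C f + c *\<^sub>C g"
    by transfer (simp add: scaleC_add_right)
  show "(c + d) *\<^sub>C f = c *\<^sub>C f + d *\<^sub>C f"
    by transfer (simp add: scaleC_add_left)
  show "c *\<^sub>C d *\<^sub>C f = (c * d) *\<^sub>C f"
    by transfer (simp add: scaleC_scaleC)
  show "1 *\<^sub>C f = f"
    by transfer (simp add: scaleC_one)
  show "r *\<^sub>R f = complex_of_real r *\<^sub>C f"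
    by transfer (simp add: scaleR_scaleC)
  have le: "norm (c *\<^sub>C f) \<le> cmod c * norm f" for c and f :: "'a \<Rightarrow>\<^sub>L 'b"
  proof (rule norm_blinfun_bound)
    show "norm (blinfun_apply (c *\<^sub>C f) x) \<le> cmod c * norm f * norm x" for x
      using mult_left_mono[OF norm_blinfun[of f x], of "cmod c"]
      by (simp add: scaleC_blinfun.rep_eq norm_scaleC mult.assoc)
  qed simp
  show "norm (c *\<^sub>C f) = cmod c * norm f"
  proof (cases "c = 0")
    case True
    then show ?thesis using le[of c f] by simp
  next
    case False
    have "f = inverse c *\<^sub>C c *\<^sub>C f"
      using False by transfer (simp add: scaleC_scaleC scaleC_one)
    then have "norm f \<le> cmod (inverse c) * norm (c *\<^sub>C f)"
      using le[of "inverse c" "c *\<^sub>C f"] by simp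
    then have "cmod c * norm f \<le> cmod c * (cmod (inverse c) * norm (c *\<^sub>C f))"
      by (rule mult_left_mono) simp
    also have "\<dots> = norm (c *\<^sub>C f)"
      using False by (simp add: norm_inverse del: inverse_eq_divide)
    finally have "cmod c * norm f \<le> norm (c *\<^sub>C f)" .
    then show ?thesis using le[of c f] by simp
  qed
qed

end


section \<open>Operators on a Hilbert space\<close>

text \<open>\<open>bounded_ops\<close> is $B(H)$: the type \<^typ>\<open>'h \<Rightarrow>\<^sub>L 'h\<close> consists of the bounded real-linear
  maps, with the operator norm.\<close>

definition bounded_ops :: "('h::complex_hilbert \<Rightarrow>\<^sub>L 'h) set" where
  "bounded_ops = {x. clinear (blinfun_apply x)}"

definition op_adjoint :: "('h::complex_hilbert \<Rightarrow>\<^sub>L 'h) \<Rightarrow> ('h \<Rightarrow>\<^sub>L 'h)" where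
  "op_adjoint x = (THE y. y \<in> bounded_ops \<and>
     (\<forall>\<xi> \<eta>. cinner (blinfun_apply y \<xi>) \<eta> = cinner \<xi> (blinfun_apply x \<eta>)))"

definition positive_op :: "('h::complex_hilbert \<Rightarrow>\<^sub>L 'h) \<Rightarrow> bool" where
  "positive_op x \<longleftrightarrow> x \<in> bounded_ops \<and> (\<forall>\<xi>. cinner \<xi> (blinfun_apply x \<xi>) \<in> \<real>\<^sub>\<ge>\<^sub>0)"

definition op_abs :: "('h::complex_hilbert \<Rightarrow>\<^sub>L 'h) \<Rightarrow> ('h \<Rightarrow>\<^sub>L 'h)" where
  "op_abs x = (THE y. positive_op y \<and> y o\<^sub>L y = op_adjoint x o\<^sub>L x)"

definition orthonormal_basis :: "'h::complex_hilbert set \<Rightarrow> bool" where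
  "orthonormal_basis B \<longleftrightarrow>
     (\<forall>e\<in>B. \<forall>f\<in>B. cinner e f = (if e = f then 1 else 0)) \<and>
     closure (module.span scaleC B) = UNIV"

text \<open>The trace, the trace class operators and the trace norm do not depend on the orthonormal
  basis \<open>B\<close>; the transpose does.\<close>

definition trace_op :: "'h::complex_hilbert set \<Rightarrow> ('h \<Rightarrow>\<^sub>L 'h) \<Rightarrow> complex" where
  "trace_op B x = (\<Sum>\<^sub>\<infinity>e\<in>B. cinner e (blinfun_apply x e))"

definition trace_class :: "'h::complex_hilbert set \<Rightarrow> ('h \<Rightarrow>\<^sub>L 'h) set" where
  "trace_class B =
     {x \<in> bounded_ops. (\<lambda>e. cinner e (blinfun_apply (op_abs x) e)) summable_on B}"

definition trace_norm :: "'h::complex_hilbert set \<Rightarrow> ('h \<Rightarrow>\<^sub>L 'h) \<Rightarrow> real" where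
  "trace_norm B x = Re (trace_op B (op_abs x))"

definition transpose_op :: "'h::complex_hilbert set \<Rightarrow> ('h \<Rightarrow>\<^sub>L 'h) \<Rightarrow> ('h \<Rightarrow>\<^sub>L 'h)" where
  "transpose_op B x = (THE y. y \<in> bounded_ops \<and>
     (\<forall>e\<in>B. \<forall>f\<in>B. cinner e (blinfun_apply y f) = cinner f (blinfun_apply x e)))"


section \<open>The algebraic tensor product of a C*-algebra and the trace class operators\<close>

text \<open>A finite sum $\sum_i a_i \otimes b_i$ is represented by the list of the pairs $(a_i, b_i)$;
  \<open>tensor_eq\<close> says that two such sums are the same element of the algebraic tensor product.
  It is the congruence generated by the bilinear relations.  Scalar multiples need no separate
  constructor since $c\,(a \otimes b) = (c a) \otimes b$.\<close>

type_synonym ('a, 'h) formal_sum = "('a \<times> ('h \<Rightarrow>\<^sub>L 'h)) list"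

definition formal_sums :: "'h::complex_hilbert set \<Rightarrow> ('a::cstar_algebra, 'h) formal_sum set" where
  "formal_sums B = lists (UNIV \<times> trace_class B)"

inductive tensor_eq ::
  "'h::complex_hilbert set \<Rightarrow> ('a::cstar_algebra, 'h) formal_sum \<Rightarrow> ('a, 'h) formal_sum \<Rightarrow> bool"
  for B where
  refl: "u \<in> formal_sums B \<Longrightarrow> tensor_eq B u u"
| sym: "tensor_eq B u v \<Longrightarrow> tensor_eq B v u"
| trans: "tensor_eq B u v \<Longrightarrow> tensor_eq B v w \<Longrightarrow> tensor_eq B u w"
| append: "tensor_eq B u u' \<Longrightarrow> tensor_eq B v v' \<Longrightarrow> tensor_eq B (u @ v) (u' @ v')"
| commute: "u \<in> formal_sums B \<Longrightarrow> v \<in> formal_sums B \<Longrightarrow> tensor_eq B (u @ v) (v @ u)"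
| zero: "b \<in> trace_class B \<Longrightarrow> tensor_eq B [(0, b)] []"
| add_left: "b \<in> trace_class B \<Longrightarrow> tensor_eq B [(a + a', b)] [(a, b), (a', b)]"
| add_right: "b \<in> trace_class B \<Longrightarrow> b' \<in> trace_class B \<Longrightarrow>
    tensor_eq B [(a, b + b')] [(a, b), (a, b')]"
| scale: "b \<in> trace_class B \<Longrightarrow> tensor_eq B [(c *\<^sub>C a, b)] [(a, c *\<^sub>C b)]"

definition fs_diff ::
  "('a::cstar_algebra, 'h::complex_hilbert) formal_sum \<Rightarrow> ('a, 'h) formal_sum \<Rightarrow> ('a, 'h) formal_sum" where
  "fs_diff u v = u @ map (\<lambda>(a, b). (- a, b)) v"

definition fs_mult ::
  "('a::cstar_algebra, 'h::complex_hilbert) formal_sum \<Rightarrow> ('a, 'h) formal_sum \<Rightarrow> ('a, 'h) formal_sum" where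
  "fs_mult u v = [(a * a', b o\<^sub>L b'). (a, b) \<leftarrow> u, (a', b') \<leftarrow> v]"

definition fs_star ::
  "('a::cstar_algebra, 'h::complex_hilbert) formal_sum \<Rightarrow> ('a, 'h) formal_sum" where
  "fs_star u = map (\<lambda>(a, b). (star a, op_adjoint b)) u"

definition proj_norm ::
  "'h::complex_hilbert set \<Rightarrow> ('a::cstar_algebra, 'h) formal_sum \<Rightarrow> real" where
  "proj_norm B u = Inf {(\<Sum>(a, b)\<leftarrow>v. norm a * trace_norm B b) | v. tensor_eq B u v}"


section \<open>The projective tensor product\<close>

text \<open>The completion is the set of Cauchy sequences modulo null sequences.  Sequences of formal
  sums that agree termwise up to \<open>tensor_eq\<close> are identified as well, because their difference
  has projective norm zero.  The operations are the continuous extensions of those on formal sums;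
  they are computed on an arbitrary representative.\<close>

definition cauchy_seqs ::
  "'h::complex_hilbert set \<Rightarrow> (nat \<Rightarrow> ('a::cstar_algebra, 'h) formal_sum) set" where
  "cauchy_seqs B = {X. (\<forall>n. X n \<in> formal_sums B) \<and>
     (\<forall>\<epsilon>>0. \<exists>N. \<forall>m\<ge>N. \<forall>n\<ge>N. proj_norm B (fs_diff (X m) (X n)) < \<epsilon>)}"

definition null_rel ::
  "'h::complex_hilbert set \<Rightarrow>
    ((nat \<Rightarrow> ('a::cstar_algebra, 'h) formal_sum) \<times> (nat \<Rightarrow> ('a, 'h) formal_sum)) set" where
  "null_rel B = {(X, Y). X \<in> cauchy_seqs B \<and> Y \<in> cauchy_seqs B \<and>
     (\<lambda>n. proj_norm B (fs_diff (X n) (Y n))) \<longlonglongrightarrow> 0}"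

type_synonym ('a, 'h) tensor = "(nat \<Rightarrow> ('a, 'h) formal_sum) set"

definition proj_tensor :: "'h::complex_hilbert set \<Rightarrow> ('a::cstar_algebra, 'h) tensor set" where
  "proj_tensor B = cauchy_seqs B // null_rel B"

definition pt_class ::
  "'h::complex_hilbert set \<Rightarrow> (nat \<Rightarrow> ('a::cstar_algebra, 'h) formal_sum) \<Rightarrow> ('a, 'h) tensor" where
  "pt_class B X = null_rel B `` {X}"

definition pt_rep :: "('a::cstar_algebra, 'h::complex_hilbert) tensor \<Rightarrow> nat \<Rightarrow> ('a, 'h) formal_sum" where
  "pt_rep z = (SOME X. X \<in> z)"

definition pt_zero :: "'h::complex_hilbert set \<Rightarrow> ('a::cstar_algebra, 'h) tensor" where
  "pt_zero B = pt_class B (\<lambda>n. [])"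

definition pt_add ::
  "'h::complex_hilbert set \<Rightarrow> ('a::cstar_algebra, 'h) tensor \<Rightarrow> ('a, 'h) tensor \<Rightarrow> ('a, 'h) tensor" where
  "pt_add B z w = pt_class B (\<lambda>n. pt_rep z n @ pt_rep w n)"

definition pt_diff ::
  "'h::complex_hilbert set \<Rightarrow> ('a::cstar_algebra, 'h) tensor \<Rightarrow> ('a, 'h) tensor \<Rightarrow> ('a, 'h) tensor" where
  "pt_diff B z w = pt_class B (\<lambda>n. fs_diff (pt_rep z n) (pt_rep w n))"

definition pt_mult ::
  "'h::complex_hilbert set \<Rightarrow> ('a::cstar_algebra, 'h) tensor \<Rightarrow> ('a, 'h) tensor \<Rightarrow> ('a, 'h) tensor" where
  "pt_mult B z w = pt_class B (\<lambda>n. fs_mult (pt_rep z n) (pt_rep w n))"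

definition pt_star ::
  "'h::complex_hilbert set \<Rightarrow> ('a::cstar_algebra, 'h) tensor \<Rightarrow> ('a, 'h) tensor" where
  "pt_star B z = pt_class B (\<lambda>n. fs_star (pt_rep z n))"

definition pt_norm :: "'h::complex_hilbert set \<Rightarrow> ('a::cstar_algebra, 'h) tensor \<Rightarrow> real" where
  "pt_norm B z = lim (\<lambda>n. proj_norm B (pt_rep z n))"

definition sums_of_squares ::
  "'h::complex_hilbert set \<Rightarrow> ('a::cstar_algebra, 'h) tensor set" where
  "sums_of_squares B =
     {foldr (pt_add B) (map (\<lambda>z. pt_mult B (pt_star B z) z) zs) (pt_zero B) | zs.
        set zs \<subseteq> proj_tensor B}"

text \<open>The positive cone: the norm closure of \<open>sums_of_squares\<close> in the projective tensor
  product.\<close>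

definition C_cp :: "'h::complex_hilbert set \<Rightarrow> ('a::cstar_algebra, 'h) tensor set" where
  "C_cp B = {z \<in> proj_tensor B. \<forall>\<epsilon>>0. \<exists>s\<in>sums_of_squares B. pt_norm B (pt_diff B z s) < \<epsilon>}"


section \<open>The functional attached to a map, and complete positivity\<close>

definition bounded_maps ::
  "('a::cstar_algebra \<Rightarrow> ('h::complex_hilbert \<Rightarrow>\<^sub>L 'h)) set" where
  "bounded_maps = {T. clinear T \<and> bounded_linear T \<and> range T \<subseteq> bounded_ops}"

definition fs_functional ::
  "'h::complex_hilbert set \<Rightarrow> ('a::cstar_algebra \<Rightarrow> ('h \<Rightarrow>\<^sub>L 'h)) \<Rightarrow> ('a, 'h) formal_sum \<Rightarrow> complex" where
  "fs_functional B T u = (\<Sum>(a, b)\<leftarrow>u. trace_op B (T a o\<^sub>L transpose_op B b))"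

text \<open>The continuous extension of \<open>fs_functional\<close> to the projective tensor product.\<close>

definition tilde ::
  "'h::complex_hilbert set \<Rightarrow> ('a::cstar_algebra \<Rightarrow> ('h \<Rightarrow>\<^sub>L 'h)) \<Rightarrow> ('a, 'h) tensor \<Rightarrow> complex" where
  "tilde B T z = lim (\<lambda>n. fs_functional B T (pt_rep z n))"

definition P_cp ::
  "'h::complex_hilbert set \<Rightarrow> ('a::cstar_algebra \<Rightarrow> ('h \<Rightarrow>\<^sub>L 'h)) set" where
  "P_cp B = {T \<in> bounded_maps. \<forall>z\<in>C_cp B. tilde B T z \<in> \<real>\<^sub>\<ge>\<^sub>0}"

text \<open>Matrices are functions of two indices, read only at indices below \<open>n\<close>.  The positive
  elements of the C*-algebra $M_n(A)$ are the matrices $Z^* Z$; positivity in $M_n(B(H))$ is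
  positivity as an operator on $H^n$.\<close>

definition positive_matrix :: "nat \<Rightarrow> (nat \<Rightarrow> nat \<Rightarrow> 'a::cstar_algebra) \<Rightarrow> bool" where
  "positive_matrix n X \<longleftrightarrow>
     (\<exists>Z. \<forall>i<n. \<forall>j<n. X i j = (\<Sum>k<n. star (Z k i) * Z k j))"

definition positive_op_matrix ::
  "nat \<Rightarrow> (nat \<Rightarrow> nat \<Rightarrow> ('h::complex_hilbert \<Rightarrow>\<^sub>L 'h)) \<Rightarrow> bool" where
  "positive_op_matrix n Y \<longleftrightarrow>
     (\<forall>\<xi>. (\<Sum>i<n. \<Sum>j<n. cinner (\<xi> i) (blinfun_apply (Y i j) (\<xi> j))) \<in> \<real>\<^sub>\<ge>\<^sub>0)"

text \<open>Boundedness is not part of the definition of a completely positive map.\<close>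

definition completely_positive ::
  "('a::cstar_algebra \<Rightarrow> ('h::complex_hilbert \<Rightarrow>\<^sub>L 'h)) \<Rightarrow> bool" where
  "completely_positive T \<longleftrightarrow> clinear T \<and> range T \<subseteq> bounded_ops \<and>
     (\<forall>n X. positive_matrix n X \<longrightarrow> positive_op_matrix n (\<lambda>i j. T (X i j)))"

end

theory Submission
  imports Defs
begin

text \<open>
  Write $\tau_x(b) = \mathrm{Tr}(x b^t)$, so that $\tilde T(\sum_i a_i \otimes b_i) = \sum_i \tau_{T(a_i)}(b_i)$.
  The two positivity conditions are linked by one identity: for $u = \sum_i a_i \otimes b_i$,
  \[ \tilde T(u^* u) = \sum_{g \in B} \sum_{i,j} \langle b_i^t g, T(a_i^* a_j) b_j^t g \rangle. \]
  It is \<open>fs_functional_square_has_sum\<close>, and it rests on $(b_i^* b_j)^t = b_j^t (b_i^t)^*$ and the cyclicity of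
  the trace (\<open>trace_sandwich\<close>, \<open>trace_pair_square\<close>).  If $T$ is completely positive, every inner double
  sum is nonnegative because the matrix $(a_i^* a_j)$ is positive; the continuity of $\tilde T$ for the
  projective norm carries this over to the cone (\<open>tilde_C_cp_nonneg\<close>).  Conversely, given
  vectors $\xi_i$ and a basis vector $e$, choose $b_i$ of rank one with $b_i^t g = \langle e, g\rangle \xi_i$.
  Then the identity reads $\tilde T(u^* u) = \sum_{i,j} \langle \xi_i, T(a_i^* a_j) \xi_j\rangle$, and since every
  positive matrix is a sum of matrices $(a_i^* a_j)$, nonnegativity of $\tilde T$ on squares is complete
  positivity (\<open>form_nonneg_of_P_cp\<close>, \<open>completely_positive_of_P_cp\<close>).

  Three bodies of facts carry this argument.  The first is the trace class: it is a *-algebra with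
  submultiplicative trace norm, and $|\tau_x(b)| \leq \|x\| \|b\|_1$.  All of this follows from the duality
  $\|b\|_1 = \sup |\mathrm{Tr}(F b)|$ over the finite rank contractions $F$ (\<open>trace_class_if_trace_bound\<close>,
  \<open>trace_bound_trace_norm\<close>), which is proved with the contractions $b (|b| + \varepsilon)^{-1}$ instead
  of a polar decomposition (\<open>approximate_polar\<close>).  The second is the passage to the
  completion: addition, multiplication and involution of formal sums respect the tensor relations and are
  continuous for the projective norm, so they can be computed on any Cauchy sequence
  (\<open>pt_mult_class\<close>, \<open>tilde_class\<close>).

  The third is that a completely positive map is bounded (\<open>completely_positive_bounded\<close>).  It is
  bounded on positive elements of bounded norm by a gliding hump, as convergent series of positive
  elements are positive and positive elements are squares.  Every self-adjoint contraction $a$ is the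
  difference $|a| - (|a| - a)$ of such elements.  The work is to obtain roots and positivity in a
  C*-algebra that may have no unit; this uses the binomial series of $\sqrt{1 - t}$, which
  converges absolutely on the closed unit ball of a Banach algebra (\<open>sqrt_series_square\<close>,
  \<open>pos_unit_sqrt\<close>), and the fact that $q^2 = p q$ makes the powers of $1 - q$ grow at most linearly
  (\<open>norm_one_minus_le_of_square\<close>).
\<close>

section \<open>Square roots in unital Banach algebras\<close>

text \<open>The condition on the norm of \<open>1\<close> is an inequality because the operators on the zero space are to be an
  instance, and there \<open>1 = 0\<close>.\<close>

class unital_banach = real_normed_algebra + banach + monoid_mult +
  assumes norm_one_le: "norm 1 \<le> 1"

lemma norm_power_le_one:
  fixes k :: "'a::unital_banach"
  assumes "norm k \<le> 1"
  shows "norm (k ^ n) \<le> 1"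
proof (induction n)
  case (Suc n)
  have "norm (k * k ^ n) \<le> norm k * norm (k ^ n)" by (rule norm_mult_ineq)
  also have "\<dots> \<le> 1 * 1" using Suc assms by (intro mult_mono) auto
  finally show ?case by simp
qed (simp add: norm_one_le)

text \<open>The Taylor coefficients of $\sqrt{1 - t}$ at $t = 0$.\<close>

definition sqrt_coeff :: "nat \<Rightarrow> real" where
  "sqrt_coeff n = (- 1) ^ n * ((1/2) gchoose n)"

lemma sqrt_coeff_0: "sqrt_coeff 0 = 1"
  by (simp add: sqrt_coeff_def)

lemma sqrt_coeff_Suc: "sqrt_coeff (Suc n) * (real n + 1) = sqrt_coeff n * (real n - 1/2)"
proof -
  have "(1/2::real) * ((1/2) gchoose n) = real n * ((1/2) gchoose n) + real (Suc n) * ((1/2) gchoose Suc n)"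
    by (rule gbinomial_mult_1)
  then have *: "real (Suc n) * ((1/2) gchoose Suc n) = (1/2 - real n) * ((1/2::real) gchoose n)"
    by (simp add: algebra_simps)
  have "sqrt_coeff (Suc n) * (real n + 1) = - ((- 1) ^ n * (real (Suc n) * ((1/2) gchoose Suc n)))"
    by (simp add: sqrt_coeff_def algebra_simps)
  then show ?thesis unfolding * by (simp add: sqrt_coeff_def algebra_simps)
qed

lemma sqrt_coeff_Suc': "sqrt_coeff (Suc n) = sqrt_coeff n * (real n - 1/2) / (real n + 1)"
  using sqrt_coeff_Suc[of n] by (simp add: field_simps)

lemma sqrt_coeff_nonpos: "sqrt_coeff (Suc n) \<le> 0"
proof (induction n)
  case (Suc n)
  then show ?case unfolding sqrt_coeff_Suc'[of "Suc n"]
    by (auto intro!: divide_nonpos_nonneg mult_nonpos_nonneg)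
qed (simp add: sqrt_coeff_Suc' sqrt_coeff_0)

text \<open>With $\beta_n$ for the coefficients, the partial sums of $\sum_n \beta_n$ telescope.  They are nonnegative,
  which bounds $\sum_{n \geq 1} |\beta_n|$ by $1$, so that the binomial series of the square root converges
  absolutely on the closed unit disc.\<close>

lemma sum_sqrt_coeff: "(\<Sum>n\<le>N. sqrt_coeff n) = - 2 * (real N + 1) * sqrt_coeff (Suc N)"
proof (induction N)
  case 0
  then show ?case by (simp add: sqrt_coeff_Suc' sqrt_coeff_0)
next
  case (Suc N)
  have "sqrt_coeff (Suc (Suc N)) * (real N + 2) = sqrt_coeff (Suc N) * (real N + 1/2)"
    using sqrt_coeff_Suc[of "Suc N"] by (simp add: algebra_simps)
  then show ?case using Suc by (simp add: algebra_simps)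
qed

lemma sum_abs_sqrt_coeff: "(\<Sum>n<N. \<bar>sqrt_coeff (Suc n)\<bar>) \<le> 1"
proof -
  have "(\<Sum>n\<le>N. sqrt_coeff n) = 1 + (\<Sum>n<N. sqrt_coeff (Suc n))"
    by (subst sum.atMost_shift) (simp add: sqrt_coeff_0)
  moreover have "(\<Sum>n\<le>N. sqrt_coeff n) \<ge> 0"
    unfolding sum_sqrt_coeff using sqrt_coeff_nonpos[of N]
    by (intro mult_nonpos_nonpos) auto
  moreover have "(\<Sum>n<N. \<bar>sqrt_coeff (Suc n)\<bar>) = - (\<Sum>n<N. sqrt_coeff (Suc n))"
    unfolding sum_negf[symmetric] using sqrt_coeff_nonpos by (intro sum.cong) auto
  ultimately show ?thesis by linarith
qed

lemma summable_abs_sqrt_coeff_Suc: "summable (\<lambda>n. \<bar>sqrt_coeff (Suc n)\<bar>)"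
  by (rule summableI_nonneg_bounded[OF _ sum_abs_sqrt_coeff]) auto

lemma summable_abs_sqrt_coeff: "summable (\<lambda>n. \<bar>sqrt_coeff n\<bar>)"
  using summable_abs_sqrt_coeff_Suc by (rule summable_Suc_iff[THEN iffD1])

lemma sqrt_coeff_convolution:
  "(\<Sum>i\<le>n. sqrt_coeff i * sqrt_coeff (n - i)) = (if n = 0 then 1 else if n = 1 then - 1 else 0)"
proof -
  have "(\<Sum>i\<le>n. sqrt_coeff i * sqrt_coeff (n - i))
      = (\<Sum>i\<le>n. (- 1) ^ n * (((1/2) gchoose i) * ((1/2) gchoose (n - i))))"
  proof (rule sum.cong[OF HOL.refl])
    fix i assume "i \<in> {..n}"
    then have "(- 1::real) ^ n = (- 1) ^ i * (- 1) ^ (n - i)"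
      by (simp flip: power_add)
    then show "sqrt_coeff i * sqrt_coeff (n - i) = (- 1) ^ n * (((1/2) gchoose i) * ((1/2) gchoose (n - i)))"
      by (simp add: sqrt_coeff_def)
  qed
  also have "\<dots> = (- 1) ^ n * ((1/2 + 1/2) gchoose n)"
    unfolding gbinomial_Vandermonde[symmetric] sum_distrib_left atLeast0AtMost ..
  also have "\<dots> = (- 1) ^ n * real (1 choose n)"
    using binomial_gbinomial[of 1 n, where 'a = real] by simp
  also have "\<dots> = (if n = 0 then 1 else if n = 1 then - 1 else 0)"
    by (auto simp: binomial_eq_0)
  finally show ?thesis .
qed

definition sqrt_series :: "'a::unital_banach \<Rightarrow> 'a" where
  "sqrt_series k = (\<Sum>n. sqrt_coeff n *\<^sub>R k ^ n)"

lemma summable_norm_sqrt_series: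
  fixes k :: "'a::unital_banach"
  assumes "norm k \<le> 1"
  shows "summable (\<lambda>n. norm (sqrt_coeff n *\<^sub>R k ^ n))"
proof (rule summable_comparison_test[OF _ summable_abs_sqrt_coeff], intro exI allI impI)
  fix n show "norm (norm (sqrt_coeff n *\<^sub>R k ^ n)) \<le> \<bar>sqrt_coeff n\<bar>"
    using norm_power_le_one[OF assms, of n] by (simp add: mult_left_le)
qed

lemma sqrt_series_sums:
  fixes k :: "'a::unital_banach"
  assumes "norm k \<le> 1"
  shows "(\<lambda>n. sqrt_coeff n *\<^sub>R k ^ n) sums sqrt_series k"
  unfolding sqrt_series_def
  by (intro summable_sums summable_norm_cancel[OF summable_norm_sqrt_series] assms)

lemma sqrt_series_square:
  fixes k :: "'a::unital_banach"
  assumes "norm k \<le> 1"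
  shows "sqrt_series k * sqrt_series k = 1 - k"
proof -
  let ?a = "\<lambda>n. sqrt_coeff n *\<^sub>R k ^ n"
  have s: "(\<lambda>n. \<Sum>i\<le>n. ?a i * ?a (n - i)) sums (sqrt_series k * sqrt_series k)"
    unfolding sqrt_series_def
    by (intro Cauchy_product_sums summable_norm_sqrt_series assms)
  have conv: "(\<Sum>i\<le>n. ?a i * ?a (n - i)) = (if n = 0 then 1 else if n = 1 then - 1 else (0::real)) *\<^sub>R k ^ n" for n
  proof -
    have "(\<Sum>i\<le>n. ?a i * ?a (n - i)) = (\<Sum>i\<le>n. (sqrt_coeff i * sqrt_coeff (n - i)) *\<^sub>R k ^ n)"
      by (intro sum.cong) (auto simp flip: power_add)
    then show ?thesis
      unfolding scaleR_left.sum[symmetric] sqrt_coeff_convolution .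
  qed
  have "(\<lambda>n. (if n = 0 then 1 else if n = 1 then - 1 else (0::real)) *\<^sub>R k ^ n) sums
        (\<Sum>n\<in>{0,1::nat}. (if n = 0 then 1 else if n = 1 then - 1 else (0::real)) *\<^sub>R k ^ n)"
    by (rule sums_finite) auto
  then have "(\<lambda>n. \<Sum>i\<le>n. ?a i * ?a (n - i)) sums (1 - k)"
    unfolding conv by simp
  with s show ?thesis by (rule sums_unique2)
qed

lemma norm_one_minus_sqrt_series:
  fixes k :: "'a::unital_banach"
  assumes "norm k \<le> 1"
  shows "norm (1 - sqrt_series k) \<le> 1"
proof -
  have "(\<lambda>n. sqrt_coeff (Suc n) *\<^sub>R k ^ Suc n) sums (sqrt_series k - sqrt_coeff 0 *\<^sub>R k ^ 0)"
    using sqrt_series_sums[OF assms] by (subst sums_Suc_iff) simp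
  then have s: "(\<lambda>n. sqrt_coeff (Suc n) *\<^sub>R k ^ Suc n) sums (sqrt_series k - 1)"
    by (simp add: sqrt_coeff_0)
  have sn: "summable (\<lambda>n. norm (sqrt_coeff (Suc n) *\<^sub>R k ^ Suc n))"
    using summable_norm_sqrt_series[OF assms] by (rule summable_Suc_iff[THEN iffD2])
  have "norm (sqrt_series k - 1) \<le> (\<Sum>n. norm (sqrt_coeff (Suc n) *\<^sub>R k ^ Suc n))"
    using summable_norm[OF sn] s by (simp add: sums_iff)
  also have "\<dots> \<le> (\<Sum>n. \<bar>sqrt_coeff (Suc n)\<bar>)"
    using norm_power_le_one[OF assms] 
    by (intro suminf_le sn summable_abs_sqrt_coeff_Suc) (simp add: mult_left_le del: power_Suc)
  also have "\<dots> \<le> 1"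
    using summable_abs_sqrt_coeff_Suc sum_abs_sqrt_coeff by (rule suminf_le_const)
  finally show ?thesis by (simp add: norm_minus_commute)
qed

text \<open>This transfers commutation relations, complex linearity and self-adjointness from \<open>k\<close> to its square
  root.\<close>

lemma sqrt_series_mem:
  fixes k :: "'a::unital_banach"
  assumes "norm k \<le> 1" "closed W" "subspace W" "\<And>n. k ^ n \<in> W"
  shows "sqrt_series k \<in> W"
proof (rule closed_sequentially[OF assms(2)])
  show "(\<lambda>N. \<Sum>n<N. sqrt_coeff n *\<^sub>R k ^ n) \<longlonglongrightarrow> sqrt_series k"
    using sqrt_series_sums[OF assms(1)] by (simp add: sums_def)
  show "(\<Sum>n<N. sqrt_coeff n *\<^sub>R k ^ n) \<in> W" for N
    using assms(3,4) by (auto intro!: subspace_sum subspace_mul)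
qed

lemma power_commutes_of_commutes:
  fixes k c :: "'a::monoid_mult"
  assumes "k * c = c * k"
  shows "k ^ n * c = c * k ^ n"
  using assms by (induction n) (simp_all add: mult.assoc, simp flip: mult.assoc)

lemma closed_commutant: "closed {m::'a::real_normed_algebra. m * c = c * m}"
  by (intro closed_Collect_eq continuous_intros)

lemma subspace_commutant: "subspace {m::'a::real_normed_algebra. m * c = c * m}"
  by (auto simp: subspace_def algebra_simps)

lemma sqrt_series_commutes:
  fixes k c :: "'a::unital_banach"
  assumes "norm k \<le> 1" "k * c = c * k"
  shows "sqrt_series k * c = c * sqrt_series k"
  using sqrt_series_mem[OF assms(1) closed_commutant[of c] subspace_commutant[of c]]
    power_commutes_of_commutes[OF assms(2)] by auto

text \<open>For $0 \leq p \leq M$ in an algebra of operators, $p + \varepsilon$ is invertible by the Neumann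
  series for $M + \varepsilon - (M - p)$.\<close>

lemma neumann_inverse:
  fixes k :: "'a::unital_banach"
  assumes "norm k < 1" "closed W" "subspace W" "\<And>n. k ^ n \<in> W"
  shows "\<exists>r\<in>W. r * (1 - k) = 1 \<and> (1 - k) * r = 1"
proof -
  have le: "norm (k ^ Suc n) \<le> norm k ^ Suc n" for n
  proof (induction n)
    case (Suc n)
    have "norm (k * k ^ Suc n) \<le> norm k * norm (k ^ Suc n)" by (rule norm_mult_ineq)
    also have "\<dots> \<le> norm k * norm k ^ Suc n" using Suc by (intro mult_left_mono) auto
    finally show ?case by simp
  qed simp
  have "summable (\<lambda>n. k ^ n)"
  proof (rule summable_comparison_test')
    show "summable (\<lambda>n. norm k ^ n)" using assms(1) by (simp add: summable_geometric)
    show "norm (k ^ n) \<le> norm k ^ n" if "n \<ge> 0" for n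
      using le norm_one_le by (cases n) simp_all
  qed
  then obtain r where r: "(\<lambda>n. k ^ n) sums r" by (auto simp: summable_def)
  have "(\<lambda>n. k ^ Suc n) sums (r - 1)"
    using r by (subst sums_Suc_iff) simp
  moreover have "(\<lambda>n. k ^ Suc n) sums (k * r)" "(\<lambda>n. k ^ Suc n) sums (r * k)"
    using sums_mult[OF r, of k] sums_mult2[OF r, of k] by (simp_all add: power_commutes)
  ultimately have "k * r = r - 1" "r * k = r - 1" by (auto dest: sums_unique2)
  then have "r * (1 - k) = 1" "(1 - k) * r = 1" by (simp_all add: algebra_simps)
  moreover have "r \<in> W"
  proof (rule closed_sequentially[OF assms(2)])
    show "(\<lambda>N. \<Sum>n<N. k ^ n) \<longlonglongrightarrow> r" using r by (simp add: sums_def)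
    show "(\<Sum>n<N. k ^ n) \<in> W" for N using assms(3,4) by (auto intro!: subspace_sum)
  qed
  ultimately show ?thesis by blast
qed


section \<open>The algebra of bounded operators on a Banach space\<close>

text \<open>A copy of the type of bounded linear maps on which composition can be the multiplication of a
  type class.  It serves twice: for the operators on the Hilbert space, and for the left
  multiplications of a C*-algebra, where it takes the place of the unitization.\<close>

typedef (overloaded) ('a::real_normed_vector) endo = "UNIV :: ('a \<Rightarrow>\<^sub>L 'a) set"
  morphisms of_endo Endo ..

setup_lifting type_definition_endo

instantiation endo :: (real_normed_vector) real_normed_algebra
begin

lift_definition zero_endo :: "'a endo" is 0 .
lift_definition plus_endo :: "'a endo \<Rightarrow> 'a endo \<Rightarrow> 'a endo" is "(+)" .
lift_definition minus_endo :: "'a endo \<Rightarrow> 'a endo \<Rightarrow> 'a endo" is "(-)" .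
lift_definition uminus_endo :: "'a endo \<Rightarrow> 'a endo" is uminus .
lift_definition scaleR_endo :: "real \<Rightarrow> 'a endo \<Rightarrow> 'a endo" is scaleR .
lift_definition times_endo :: "'a endo \<Rightarrow> 'a endo \<Rightarrow> 'a endo" is "(o\<^sub>L)" .
lift_definition norm_endo :: "'a endo \<Rightarrow> real" is norm .
definition dist_endo :: "'a endo \<Rightarrow> 'a endo \<Rightarrow> real" where "dist_endo x y = norm (x - y)"
definition sgn_endo :: "'a endo \<Rightarrow> 'a endo" where "sgn_endo x = inverse (norm x) *\<^sub>R x"
definition uniformity_endo :: "('a endo \<times> 'a endo) filter" where
  "uniformity_endo = (INF e\<in>{0<..}. principal {(x, y). dist x y < e})"
definition open_endo :: "'a endo set \<Rightarrow> bool" where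
  "open_endo S = (\<forall>x\<in>S. \<forall>\<^sub>F (x', y) in uniformity. x' = x \<longrightarrow> y \<in> S)"

instance
proof
  fix a b c :: "'a endo" and r s :: real
  show "a + b + c = a + (b + c)" by transfer (rule add.assoc)
  show "a + b = b + a" by transfer (rule add.commute)
  show "0 + a = a" by transfer simp
  show "- a + a = 0" by transfer simp
  show "a - b = a + - b" by transfer simp
  show "r *\<^sub>R (a + b) = r *\<^sub>R a + r *\<^sub>R b" by transfer (rule scaleR_add_right)
  show "(r + s) *\<^sub>R a = r *\<^sub>R a + s *\<^sub>R a" by transfer (rule scaleR_add_left)
  show "r *\<^sub>R s *\<^sub>R a = (r * s) *\<^sub>R a" by transfer simp
  show "1 *\<^sub>R a = a" by transfer simp
  show "a * b * c = a * (b * c)" by transfer (rule blinfun_eqI, simp)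
  show "(a + b) * c = a * c + b * c" by transfer (rule blinfun_eqI, simp add: blinfun.bilinear_simps)
  show "a * (b + c) = a * b + a * c" by transfer (rule blinfun_eqI, simp add: blinfun.bilinear_simps)
  show "r *\<^sub>R a * b = r *\<^sub>R (a * b)" by transfer (rule blinfun_eqI, simp add: blinfun.bilinear_simps)
  show "a * r *\<^sub>R b = r *\<^sub>R (a * b)" by transfer (rule blinfun_eqI, simp add: blinfun.bilinear_simps)
  show "norm a = 0 \<longleftrightarrow> a = 0" by transfer simp
  show "norm (a + b) \<le> norm a + norm b" by transfer (rule norm_triangle_ineq)
  show "norm (r *\<^sub>R a) = \<bar>r\<bar> * norm a" by transfer simp
  show "norm (a * b) \<le> norm a * norm b" by transfer (rule norm_blinfun_compose)
  show "dist a b = norm (a - b)" by (rule dist_endo_def)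
  show "sgn a = inverse (norm a) *\<^sub>R a" by (rule sgn_endo_def)
  show "uniformity = (INF e\<in>{0<..}. principal {(x::'a endo, y). dist x y < e})"
    by (rule uniformity_endo_def)
  show "open S = (\<forall>x\<in>S. \<forall>\<^sub>F (x', y) in uniformity. x' = x \<longrightarrow> y \<in> S)" for S :: "'a endo set"
    by (rule open_endo_def)
qed

end

lemma norm_Endo: "norm (Endo f) = norm f" by transfer simp
instantiation endo :: (banach) unital_banach
begin

lift_definition one_endo :: "'a endo" is id_blinfun .

instance
proof
  fix a :: "'a endo" and X :: "nat \<Rightarrow> 'a endo"
  show "1 * a = a" by transfer (rule blinfun_eqI, simp)
  show "a * 1 = a" by transfer (rule blinfun_eqI, simp)
  show "norm (1 :: 'a endo) \<le> 1" by transfer (rule norm_blinfun_id_le)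
  assume X: "Cauchy X"
  have "Cauchy (\<lambda>n. of_endo (X n))"
    using X unfolding Cauchy_def dist_norm by transfer
  then obtain l where "(\<lambda>n. of_endo (X n)) \<longlonglongrightarrow> l"
    by (auto simp: Cauchy_convergent_iff convergent_def)
  then have "X \<longlonglongrightarrow> Endo l"
    unfolding lim_sequentially dist_norm by transfer
  then show "convergent X" by (auto simp: convergent_def)
qed

end

definition endo_apply :: "'a::real_normed_vector endo \<Rightarrow> 'a \<Rightarrow> 'a" where
  "endo_apply x = blinfun_apply (of_endo x)"

lemma endo_apply_simps [simp]:
  "endo_apply (x + y) \<xi> = endo_apply x \<xi> + endo_apply y \<xi>"
  "endo_apply (x - y) \<xi> = endo_apply x \<xi> - endo_apply y \<xi>"
  "endo_apply (- x) \<xi> = - endo_apply x \<xi>"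
  "endo_apply (r *\<^sub>R x) \<xi> = r *\<^sub>R endo_apply x \<xi>"
  "endo_apply (x * y) \<xi> = endo_apply x (endo_apply y \<xi>)"
  "endo_apply 0 \<xi> = 0"
  "endo_apply (Endo f) \<xi> = blinfun_apply f \<xi>"
  by (simp_all add: endo_apply_def plus_endo.rep_eq minus_endo.rep_eq uminus_endo.rep_eq
      scaleR_endo.rep_eq times_endo.rep_eq zero_endo.rep_eq Endo_inverse
      plus_blinfun.rep_eq minus_blinfun.rep_eq uminus_blinfun.rep_eq scaleR_blinfun.rep_eq)

lemma endo_apply_one [simp]: "endo_apply 1 \<xi> = \<xi>"
  by (simp add: endo_apply_def one_endo.rep_eq)

lemma endo_eqI: "(\<And>\<xi>. endo_apply x \<xi> = endo_apply y \<xi>) \<Longrightarrow> x = y"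
  by (metis blinfun_eqI endo_apply_def of_endo_inject)

lemma bounded_linear_endo_apply_left: "bounded_linear (\<lambda>x. endo_apply x \<xi>)"
proof (rule bounded_linear_intro[where K = "norm \<xi>"])
  show "norm (endo_apply x \<xi>) \<le> norm x * norm \<xi>" for x
    unfolding endo_apply_def norm_endo.rep_eq by (rule norm_blinfun)
qed auto

lemma continuous_endo_apply_left [continuous_intros]:
  "continuous_on S (\<lambda>x. endo_apply x \<xi>)"
  by (rule linear_continuous_on[OF bounded_linear_endo_apply_left])

lemma norm_endo_apply: "norm (endo_apply x \<xi>) \<le> norm x * norm \<xi>"
  unfolding endo_apply_def norm_endo.rep_eq by (rule norm_blinfun)

lemma norm_endo_bound:
  assumes "0 \<le> b" "\<And>\<xi>. norm (endo_apply x \<xi>) \<le> b * norm \<xi>"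
  shows "norm x \<le> b"
  using assms unfolding endo_apply_def norm_endo.rep_eq by (rule norm_blinfun_bound)

section \<open>Inner products and orthonormal bases\<close>

notation blinfun_apply (infixl "\<cdot>" 90)

global_interpretation cv: module "scaleC :: complex \<Rightarrow> 'a::complex_vector \<Rightarrow> 'a"
  by standard (simp_all add: scaleC_add_right scaleC_add_left scaleC_scaleC scaleC_one)

lemma bounded_linear_scaleC: "bounded_linear (\<lambda>x::'a::complex_normed_vector. c *\<^sub>C x)"
  by (rule bounded_linear_intro[where K = "cmod c"])
    (simp_all add: scaleC_add_right norm_scaleC scaleR_scaleC scaleC_scaleC mult.commute)

lemma clinearI:
  "(\<And>x y. f (x + y) = f x + f y) \<Longrightarrow> (\<And>c x. f (c *\<^sub>C x) = c *\<^sub>C f x) \<Longrightarrow> clinear f"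
  by (simp add: clinear_def)

lemma clinear_add: "clinear f \<Longrightarrow> f (x + y) = f x + f y"
  and clinear_scaleC: "clinear f \<Longrightarrow> f (c *\<^sub>C x) = c *\<^sub>C f x"
  by (simp_all add: clinear_def)

lemma clinear_0: "clinear f \<Longrightarrow> f 0 = 0"
  using clinear_scaleC[of f 0 0] by simp

lemma clinear_minus: "clinear f \<Longrightarrow> f (- x) = - f x"
  using clinear_scaleC[of f "- 1" x] by (simp add: scaleC_one)

lemma clinear_scaleR: "clinear f \<Longrightarrow> f (r *\<^sub>R x) = r *\<^sub>R f x"
  by (simp add: scaleR_scaleC clinear_scaleC)

lemma clinear_diff: "clinear f \<Longrightarrow> f (x - y) = f x - f y"
  unfolding diff_conv_add_uminus by (simp only: clinear_add clinear_minus)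

lemma clinear_sum: "clinear f \<Longrightarrow> f (sum g S) = (\<Sum>i\<in>S. f (g i))"
  by (induction S rule: infinite_finite_induct) (simp_all add: clinear_0 clinear_add)

lemma clinear_bounded_linear:
  fixes f :: "'a::complex_normed_vector \<Rightarrow> 'b::complex_normed_vector"
  assumes "clinear f" "\<And>x. norm (f x) \<le> K * norm x"
  shows "bounded_linear f"
  using assms by (intro bounded_linear_intro[where K = K])
    (simp_all add: clinear_add clinear_scaleR mult.commute)

lemma cinner_add_left: "cinner (x + y) z = cinner x z + cinner y (z::'h::complex_hilbert)"
  using cinner_commute[of "x + y" z] cinner_commute[of x z] cinner_commute[of y z]
  by (simp add: cinner_add_right)

lemma cinner_scaleC_left: "cinner (c *\<^sub>C x) y = cnj c * cinner x (y::'h::complex_hilbert)"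
  using cinner_commute[of "c *\<^sub>C x" y] cinner_commute[of x y] by (simp add: cinner_scaleC_right)

lemma cinner_zero_right [simp]: "cinner x 0 = (0::complex)"
  using cinner_scaleC_right[of x 0 0] by simp

lemma cinner_zero_left [simp]: "cinner 0 x = (0::complex)"
  using cinner_scaleC_left[of 0 0 x] by simp

lemma cinner_minus_right [simp]: "cinner x (- y) = - cinner x y"
  using cinner_scaleC_right[of x "- 1" y] by (simp add: scaleC_one)

lemma cinner_minus_left [simp]: "cinner (- x) y = - cinner x y"
  using cinner_scaleC_left[of "- 1" x y] by (simp add: scaleC_one)

lemma cinner_diff_right: "cinner x (y - z) = cinner x y - cinner x z"
  unfolding diff_conv_add_uminus cinner_add_right by simp

lemma cinner_diff_left: "cinner (x - y) z = cinner x z - cinner y z"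
  unfolding diff_conv_add_uminus cinner_add_left by simp

lemma cinner_scaleR_right [simp]: "cinner x (r *\<^sub>R y) = complex_of_real r * cinner x y"
  by (simp add: scaleR_scaleC cinner_scaleC_right)

lemma cinner_scaleR_left [simp]: "cinner (r *\<^sub>R x) y = complex_of_real r * cinner x y"
  by (simp add: scaleR_scaleC cinner_scaleC_left)

lemma cinner_sum_right: "cinner x (sum f S) = (\<Sum>i\<in>S. cinner x (f i))"
  by (induction S rule: infinite_finite_induct) (simp_all add: cinner_add_right)

lemma cinner_sum_left: "cinner (sum f S) x = (\<Sum>i\<in>S. cinner (f i) x)"
  by (induction S rule: infinite_finite_induct) (simp_all add: cinner_add_left)

lemma norm_sq_cinner: "(norm x)\<^sup>2 = Re (cinner x x)"
  by (simp add: cinner_self)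

text \<open>Stated for arbitrary positive forms because it is needed for \<open>cinner\<close> and also for the form
  $\langle \xi, x \eta \rangle$ of a positive operator.\<close>

lemma form_cauchy_schwarz:
  fixes q :: "'h::complex_vector \<Rightarrow> 'h \<Rightarrow> complex"
  assumes add: "\<And>x y z. q x (y + z) = q x y + q x z"
    and scale: "\<And>c x y. q x (c *\<^sub>C y) = c * q x y"
    and herm: "\<And>x y. q x y = cnj (q y x)"
    and pos: "\<And>x. 0 \<le> Re (q x x)"
  shows "(cmod (q x y))\<^sup>2 \<le> Re (q x x) * Re (q y y)"
proof -
  define N where "N = (cmod (q x y))\<^sup>2"
  have addl: "q (u + v) w = q u w + q v w" for u v w by (metis add herm complex_cnj_add)
  have scalel: "q (c *\<^sub>C u) w = cnj c * q u w" for c u w by (metis scale herm complex_cnj_mult)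
  have quad: "0 \<le> Re (q x x) - 2 * t * N + t\<^sup>2 * N * Re (q y y)" for t
  proof -
    let ?s = "- of_real t * cnj (q x y)"
    have yx: "q y x = cnj (q x y)" by (rule herm)
    have xy: "q x y * cnj (q x y) = of_real N" unfolding N_def complex_norm_square ..
    have "q (x + ?s *\<^sub>C y) (x + ?s *\<^sub>C y)
        = q x x - of_real (2 * t) * (q x y * cnj (q x y)) + of_real (t\<^sup>2) * (q x y * cnj (q x y)) * q y y"
      unfolding add addl scale scalel yx by (simp add: algebra_simps power2_eq_square)
    then have "q (x + ?s *\<^sub>C y) (x + ?s *\<^sub>C y) = q x x - of_real (2 * t * N) + of_real (t\<^sup>2 * N) * q y y"
      unfolding xy by simp
    then have "Re (q (x + ?s *\<^sub>C y) (x + ?s *\<^sub>C y)) = Re (q x x) - 2 * t * N + t\<^sup>2 * N * Re (q y y)"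
      by simp
    then show ?thesis using pos[of "x + ?s *\<^sub>C y"] by simp
  qed
  have "N \<ge> 0" by (simp add: N_def)
  show ?thesis
  proof (cases "Re (q y y) = 0")
    case True
    have "N \<le> 0"
    proof (rule ccontr)
      assume "\<not> N \<le> 0"
      then have "2 * ((Re (q x x) + 1) / N) * N = 2 * Re (q x x) + 2" by simp
      then show False
        using quad[of "(Re (q x x) + 1) / N"] True pos[of x] by simp
    qed
    then show ?thesis using True by (simp add: N_def)
  next
    case False
    then have "Re (q y y) > 0" using pos[of y] by linarith
    then show ?thesis
      using quad[of "1 / Re (q y y)"] unfolding N_def[symmetric]
      by (simp add: field_simps power2_eq_square)
  qed
qed

lemma norm_cinner_le: "cmod (cinner x y) \<le> norm x * norm (y::'h::complex_hilbert)"
proof -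
  have "(cmod (cinner x y))\<^sup>2 \<le> Re (cinner x x) * Re (cinner y y)"
    by (rule form_cauchy_schwarz[OF cinner_add_right cinner_scaleC_right cinner_commute])
      (simp add: cinner_self)
  then have "(cmod (cinner x y))\<^sup>2 \<le> (norm x * norm y)\<^sup>2"
    by (simp add: norm_sq_cinner[symmetric] power_mult_distrib)
  then show ?thesis by (rule power2_le_imp_le) simp
qed

lemma bounded_bilinear_cinner: "bounded_bilinear (cinner :: 'h::complex_hilbert \<Rightarrow> 'h \<Rightarrow> complex)"
proof
  show "\<exists>K. \<forall>(a::'h) b. norm (cinner a b) \<le> norm a * norm b * K"
    using norm_cinner_le by (intro exI[of _ 1]) auto
qed (simp_all add: cinner_add_right cinner_add_left scaleR_conv_of_real)

lemmas bounded_linear_cinner_right = bounded_bilinear.bounded_linear_right[OF bounded_bilinear_cinner]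
lemmas bounded_linear_cinner_left = bounded_bilinear.bounded_linear_left[OF bounded_bilinear_cinner]

lemma norm_le_if_cinner_le:
  assumes "0 \<le> K" "\<And>\<eta>. cmod (cinner \<eta> \<xi>) \<le> K * norm \<eta>"
  shows "norm (\<xi>::'h::complex_hilbert) \<le> K"
proof (cases "\<xi> = 0")
  case False
  have "norm \<xi> * norm \<xi> \<le> K * norm \<xi>"
    using assms(2)[of \<xi>] by (simp add: cinner_self power2_eq_square norm_mult)
  then show ?thesis using False by simp
qed (use assms(1) in simp)

lemma bounded_opsI:
  fixes f :: "'h::complex_hilbert \<Rightarrow> 'h"
  assumes "clinear f" "\<And>x. norm (f x) \<le> K * norm x"
  shows "Blinfun f \<in> bounded_ops" "blinfun_apply (Blinfun f) = f"
  using clinear_bounded_linear[OF assms] assms(1)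
  by (simp_all add: bounded_ops_def bounded_linear_Blinfun_apply)

lemma bounded_opsD: "x \<in> bounded_ops \<Longrightarrow> clinear (blinfun_apply x)"
  by (simp add: bounded_ops_def)

lemma bounded_ops_iff: "x \<in> bounded_ops \<longleftrightarrow> (\<forall>c \<xi>. x \<cdot> (c *\<^sub>C \<xi>) = c *\<^sub>C x \<cdot> \<xi>)"
  by (simp add: bounded_ops_def clinear_def blinfun.add_right)

lemma scaleC_blinfun_apply [simp]: "(c *\<^sub>C x) \<cdot> \<xi> = c *\<^sub>C x \<cdot> \<xi>"
  by (simp add: scaleC_blinfun.rep_eq)

lemma bounded_ops_add: "x \<in> bounded_ops \<Longrightarrow> y \<in> bounded_ops \<Longrightarrow> x + y \<in> bounded_ops"
  and bounded_ops_scaleC: "x \<in> bounded_ops \<Longrightarrow> c *\<^sub>C x \<in> bounded_ops"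
  and bounded_ops_compose: "x \<in> bounded_ops \<Longrightarrow> y \<in> bounded_ops \<Longrightarrow> x o\<^sub>L y \<in> bounded_ops"
  and bounded_ops_zero: "0 \<in> bounded_ops"
  by (simp_all add: bounded_ops_iff plus_blinfun.rep_eq scaleC_add_right scaleC_scaleC mult.commute[of c])

text \<open>The Cauchy criterion: the hypothesis controls the sums over finite sets disjoint from a large
  finite set.  It applies to orthogonal series, which need not converge absolutely.\<close>

lemma summable_on_norm_sq_dominated:
  fixes f :: "'i \<Rightarrow> 'b::banach"
  assumes g: "g summable_on A" and le: "\<And>G. finite G \<Longrightarrow> G \<subseteq> A \<Longrightarrow> (norm (sum f G))\<^sup>2 \<le> sum g G"
  shows "f summable_on A"
proof -
  have "\<exists>P. eventually P (finite_subsets_at_top A) \<and>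
          (\<forall>F F'. P F \<and> P F' \<longrightarrow> dist (sum f F) (sum f F') < e)" if "e > 0" for e :: real
  proof -
    define d where "d = (e/2)\<^sup>2 / 2"
    have "d > 0" using that by (simp add: d_def)
    obtain L where "(sum g \<longlongrightarrow> L) (finite_subsets_at_top A)"
      using g by (auto simp: summable_on_def has_sum_def)
    then have "eventually (\<lambda>F. dist (sum g F) L < d) (finite_subsets_at_top A)"
      using \<open>d > 0\<close> by (rule tendstoD)
    then obtain F0 where F0: "finite F0" "F0 \<subseteq> A"
      and close: "\<forall>F. finite F \<and> F0 \<subseteq> F \<and> F \<subseteq> A \<longrightarrow> dist (sum g F) L < d"
      unfolding eventually_finite_subsets_at_top by (elim exE conjE) (rule that)
    have small: "norm (sum f G) < e / 2" if G: "finite G" "G \<subseteq> A" "G \<inter> F0 = {}" for G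
    proof -
      have "sum g (F0 \<union> G) = sum g F0 + sum g G"
        using G F0 by (intro sum.union_disjoint) auto
      moreover have "dist (sum g (F0 \<union> G)) L < d" "dist (sum g F0) L < d"
        using G F0 close by auto
      ultimately have "sum g G < 2 * d" unfolding dist_real_def by linarith
      then have "(norm (sum f G))\<^sup>2 < (e / 2)\<^sup>2" using le[OF G(1,2)] by (simp add: d_def)
      then show ?thesis by (rule power2_less_imp_less) (use \<open>e > 0\<close> in simp)
    qed
    have "dist (sum f F) (sum f F') < e"
      if "finite F" "F0 \<subseteq> F" "F \<subseteq> A" "finite F'" "F0 \<subseteq> F'" "F' \<subseteq> A" for F F'
    proof -
      have "sum f F - sum f F' = sum f (F - F') - sum f (F' - F)"
        using that sum.Int_Diff[of F f F'] sum.Int_Diff[of F' f F] by (simp add: Int_commute)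
      then have "dist (sum f F) (sum f F') \<le> norm (sum f (F - F')) + norm (sum f (F' - F))"
        by (simp add: dist_norm norm_triangle_ineq4)
      also have "\<dots> < e / 2 + e / 2"
        using that by (intro add_strict_mono small) auto
      finally show ?thesis by simp
    qed
    moreover have "eventually (\<lambda>F. finite F \<and> F0 \<subseteq> F \<and> F \<subseteq> A) (finite_subsets_at_top A)"
      unfolding eventually_finite_subsets_at_top using F0 by (intro exI[of _ F0]) simp
    ultimately show ?thesis
      by (intro exI[of _ "\<lambda>F. finite F \<and> F0 \<subseteq> F \<and> F \<subseteq> A"]) auto
  qed
  then have "cauchy_filter (filtermap (sum f) (finite_subsets_at_top A))"
    by (simp add: cauchy_filter_metric_filtermap)
  moreover have "complete (UNIV::'b set)"
    by (meson Cauchy_convergent UNIV_I complete_def convergent_def)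
  ultimately obtain L where "(sum f \<longlongrightarrow> L) (finite_subsets_at_top A)"
    using cauchy_filter_complete_converges[of "filtermap (sum f) (finite_subsets_at_top A)" UNIV]
    by (auto simp: filterlim_def filtermap_bot_iff)
  then show ?thesis by (auto simp: summable_on_def has_sum_def)
qed

lemma summable_on_if_finite_sums_le:
  fixes g :: "'i \<Rightarrow> real"
  assumes "\<And>i. i \<in> A \<Longrightarrow> 0 \<le> g i" "\<And>F. finite F \<Longrightarrow> F \<subseteq> A \<Longrightarrow> sum g F \<le> K"
  shows "g summable_on A"
  using assms by (intro nonneg_bdd_above_summable_on) (auto intro!: bdd_aboveI2[where M = K])

locale hilbert_basis =
  fixes B :: "'h::complex_hilbert set"
  assumes basis: "orthonormal_basis B"
begin

lemma cinner_basis: "e \<in> B \<Longrightarrow> f \<in> B \<Longrightarrow> cinner e f = (if e = f then 1 else 0)"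
  using basis by (auto simp: orthonormal_basis_def)

lemma cinner_basis_sum:
  assumes "finite F" "F \<subseteq> B" "e \<in> F"
  shows "cinner e (\<Sum>f\<in>F. c f *\<^sub>C f) = c e"
proof -
  have "cinner e (\<Sum>f\<in>F. c f *\<^sub>C f) = (\<Sum>f\<in>F. if f = e then c e else 0)"
    unfolding cinner_sum_right cinner_scaleC_right
    using assms by (intro sum.cong) (auto simp: cinner_basis subset_iff)
  then show ?thesis using assms by simp
qed

lemma norm_sq_basis_sum:
  assumes "finite F" "F \<subseteq> B"
  shows "(norm (\<Sum>e\<in>F. c e *\<^sub>C e))\<^sup>2 = (\<Sum>e\<in>F. (cmod (c e))\<^sup>2)"
proof -
  have "cinner (\<Sum>e\<in>F. c e *\<^sub>C e) (\<Sum>e\<in>F. c e *\<^sub>C e) = (\<Sum>e\<in>F. cnj (c e) * c e)"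
    unfolding cinner_sum_left[of "\<lambda>e. c e *\<^sub>C e"] cinner_scaleC_left
    using cinner_basis_sum[OF assms] by (intro sum.cong) auto
  also have "\<dots> = of_real (\<Sum>e\<in>F. (cmod (c e))\<^sup>2)"
    unfolding of_real_sum complex_norm_square by (simp add: mult.commute)
  finally show ?thesis by (simp add: norm_sq_cinner)
qed

lemma norm_sq_diff_basis_sum:
  assumes "finite F" "F \<subseteq> B"
  shows "(norm (\<xi> - (\<Sum>e\<in>F. c e *\<^sub>C e)))\<^sup>2
    = (norm \<xi>)\<^sup>2 - (\<Sum>e\<in>F. (cmod (cinner e \<xi>))\<^sup>2) + (\<Sum>e\<in>F. (cmod (cinner e \<xi> - c e))\<^sup>2)"
proof -
  let ?P = "\<Sum>e\<in>F. cinner e \<xi> *\<^sub>C e" and ?s = "\<Sum>e\<in>F. c e *\<^sub>C e"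
  have orth: "cinner s (\<xi> - ?P) = 0" if "s = (\<Sum>e\<in>F. d e *\<^sub>C e)" for s d
    unfolding that cinner_sum_left[of "\<lambda>e. d e *\<^sub>C e"] cinner_scaleC_left
    using cinner_basis_sum[OF assms] by (intro sum.neutral) (auto simp: cinner_diff_right)
  have pyth: "(norm (u + v))\<^sup>2 = (norm u)\<^sup>2 + (norm v)\<^sup>2" if "cinner v u = 0" for u v :: 'h
  proof -
    have "cinner u v = 0" using that cinner_commute[of u v] by simp
    then show ?thesis using that by (simp add: norm_sq_cinner cinner_add_left cinner_add_right)
  qed
  have d: "?P - ?s = (\<Sum>e\<in>F. (cinner e \<xi> - c e) *\<^sub>C e)"
    by (simp add: cv.scale_left_diff_distrib sum_subtractf)
  have "(norm \<xi>)\<^sup>2 = (norm (\<xi> - ?P))\<^sup>2 + (norm ?P)\<^sup>2"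
    using pyth[OF orth[OF HOL.refl, of "\<lambda>e. cinner e \<xi>"]] by simp
  moreover have "(norm (\<xi> - ?s))\<^sup>2 = (norm (\<xi> - ?P))\<^sup>2 + (norm (?P - ?s))\<^sup>2"
    using pyth[OF orth[OF d]] by simp
  ultimately show ?thesis
    unfolding d norm_sq_basis_sum[OF assms] by simp
qed

lemma bessel:
  assumes "finite F" "F \<subseteq> B"
  shows "(\<Sum>e\<in>F. (cmod (cinner e \<xi>))\<^sup>2) \<le> (norm \<xi>)\<^sup>2"
proof -
  have "0 \<le> (norm (\<xi> - (\<Sum>e\<in>F. cinner e \<xi> *\<^sub>C e)))\<^sup>2" by simp
  then show ?thesis unfolding norm_sq_diff_basis_sum[OF assms] by simp
qed

text \<open>Among the combinations of a finite part of the basis, the one with the Fourier coefficients is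
  closest to \<open>\<xi>\<close>; hence the density of the span yields convergence.\<close>

lemma expansion: "((\<lambda>e. cinner e \<xi> *\<^sub>C e) has_sum \<xi>) B"
  unfolding has_sum_def
proof (rule tendstoI)
  fix \<epsilon> :: real assume "\<epsilon> > 0"
  have "\<xi> \<in> closure (cv.span B)"
    using basis by (simp add: orthonormal_basis_def)
  then obtain s where s: "s \<in> cv.span B" "dist s \<xi> < \<epsilon>"
    using \<open>\<epsilon> > 0\<close> closure_approachable by blast
  then obtain F0 c where F0: "finite F0" "F0 \<subseteq> B" "s = (\<Sum>e\<in>F0. c e *\<^sub>C e)"
    unfolding cv.span_explicit by blast
  show "\<forall>\<^sub>F F in finite_subsets_at_top B. dist (\<Sum>e\<in>F. cinner e \<xi> *\<^sub>C e) \<xi> < \<epsilon>"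
    unfolding eventually_finite_subsets_at_top
  proof (intro exI[of _ F0] conjI allI impI F0; elim conjE)
    fix F assume F: "finite F" "F0 \<subseteq> F" "F \<subseteq> B"
    let ?d = "\<lambda>e. if e \<in> F0 then c e else 0"
    have "s = (\<Sum>e\<in>F. ?d e *\<^sub>C e)"
      unfolding F0(3) using F by (intro sum.mono_neutral_cong_left) auto
    then have "(norm (\<xi> - (\<Sum>e\<in>F. cinner e \<xi> *\<^sub>C e)))\<^sup>2 \<le> (norm (\<xi> - s))\<^sup>2"
      using norm_sq_diff_basis_sum[OF F(1,3), of \<xi> ?d]
        norm_sq_diff_basis_sum[OF F(1,3), of \<xi> "\<lambda>e. cinner e \<xi>"]
        sum_nonneg[of F "\<lambda>e. (cmod (cinner e \<xi> - ?d e))\<^sup>2"]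
      by simp
    then have "norm (\<xi> - (\<Sum>e\<in>F. cinner e \<xi> *\<^sub>C e)) \<le> norm (\<xi> - s)"
      by (rule power2_le_imp_le) simp
    then show "dist (\<Sum>e\<in>F. cinner e \<xi> *\<^sub>C e) \<xi> < \<epsilon>"
      using s(2) by (simp add: dist_norm norm_minus_commute)
  qed
qed

lemma parseval: "((\<lambda>e. cinner \<zeta> e * cinner e \<xi>) has_sum cinner \<zeta> \<xi>) B"
  using has_sum_bounded_linear[OF bounded_linear_cinner_right[of \<zeta>] expansion[of \<xi>]]
  by (simp add: cinner_scaleC_right mult.commute)

lemma parseval_norm: "((\<lambda>e. (cmod (cinner e \<xi>))\<^sup>2) has_sum (norm \<xi>)\<^sup>2) B"
proof -
  have "Re (cinner \<xi> e * cinner e \<xi>) = (cmod (cinner e \<xi>))\<^sup>2" for e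
    unfolding cmod_power2 by (subst cinner_commute) (simp add: power2_eq_square)
  then show ?thesis
    using has_sum_bounded_linear[OF bounded_linear_Re parseval[of \<xi> \<xi>]]
    by (simp add: norm_sq_cinner)
qed

lemma vector_eqI:
  assumes "\<And>e. e \<in> B \<Longrightarrow> cinner e \<xi> = cinner e \<eta>"
  shows "\<xi> = \<eta>"
proof -
  have "((\<lambda>e. cinner e \<xi> *\<^sub>C e) has_sum \<eta>) B"
    using expansion[of \<eta>] by (subst has_sum_cong) (simp_all add: assms)
  with expansion show ?thesis by (rule has_sum_unique)
qed

lemma op_expansion:
  assumes "x \<in> bounded_ops"
  shows "((\<lambda>e. cinner e \<xi> *\<^sub>C x \<cdot> e) has_sum x \<cdot> \<xi>) B"
  using has_sum_bounded_linear[OF blinfun.bounded_linear_right[of x] expansion[of \<xi>]]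
  by (simp add: clinear_scaleC[OF bounded_opsD[OF assms]])

lemma op_eqI:
  assumes "x \<in> bounded_ops" "y \<in> bounded_ops"
    "\<And>e f. e \<in> B \<Longrightarrow> f \<in> B \<Longrightarrow> cinner e (x \<cdot> f) = cinner e (y \<cdot> f)"
  shows "x = y"
proof (rule blinfun_eqI)
  fix \<xi>
  have "x \<cdot> f = y \<cdot> f" if "f \<in> B" for f
    using assms(3) that by (intro vector_eqI) auto
  then show "x \<cdot> \<xi> = y \<cdot> \<xi>"
    using op_expansion[OF assms(1), of \<xi>] op_expansion[OF assms(2), of \<xi>] has_sum_unique
    by (metis (mono_tags, lifting) has_sum_cong)
qed

lemma basis_series:
  assumes "\<And>F. finite F \<Longrightarrow> F \<subseteq> B \<Longrightarrow> (\<Sum>e\<in>F. (cmod (c e))\<^sup>2) \<le> K"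
  obtains \<xi> where "\<And>e. e \<in> B \<Longrightarrow> cinner e \<xi> = c e"
proof -
  have "(\<lambda>e. (cmod (c e))\<^sup>2) summable_on B"
    using assms by (intro summable_on_if_finite_sums_le) auto
  then have "(\<lambda>e. c e *\<^sub>C e) summable_on B"
    by (rule summable_on_norm_sq_dominated) (simp add: norm_sq_basis_sum)
  then obtain \<xi> where \<xi>: "((\<lambda>e. c e *\<^sub>C e) has_sum \<xi>) B" by (auto simp: summable_on_def)
  show ?thesis
  proof (rule that)
    fix e assume "e \<in> B"
    have "((\<lambda>f. cinner e (c f *\<^sub>C f)) has_sum cinner e \<xi>) B"
      by (rule has_sum_bounded_linear[OF bounded_linear_cinner_right \<xi>])
    moreover have "((\<lambda>f. cinner e (c f *\<^sub>C f)) has_sum c e) B \<longleftrightarrow> ((\<lambda>f. c e) has_sum c e) {e}"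
      using \<open>e \<in> B\<close> by (intro has_sum_cong_neutral) (auto simp: cinner_scaleC_right cinner_basis)
    ultimately show "cinner e \<xi> = c e"
      by (metis (no_types, lifting) finite.emptyI finite.insertI has_sum_finiteI has_sum_unique
          empty_iff sum.empty sum.insert add.right_neutral)
  qed
qed


section \<open>Adjoints\<close>

text \<open>The adjoint is built from its coordinates.  They are square summable: evaluating \<open>x\<close> at the partial
  sum with these coordinates bounds the norm of that sum.\<close>

lemma adjoint_exists:
  fixes x :: "'h \<Rightarrow>\<^sub>L 'h"
  assumes x: "x \<in> bounded_ops"
  obtains y where "y \<in> bounded_ops"
    "\<And>\<xi> \<eta>. cinner (y \<cdot> \<xi>) \<eta> = cinner \<xi> (x \<cdot> \<eta>)"
proof -
  have "\<exists>\<zeta>. \<forall>e\<in>B. cinner e \<zeta> = cinner (x \<cdot> e) \<xi>" for \<xi>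
  proof -
    have "(\<Sum>e\<in>F. (cmod (cinner (x \<cdot> e) \<xi>))\<^sup>2) \<le> (norm x * norm \<xi>)\<^sup>2"
      if F: "finite F" "F \<subseteq> B" for F
    proof -
      let ?c = "\<lambda>e. cinner (x \<cdot> e) \<xi>"
      let ?S = "\<Sum>e\<in>F. (cmod (?c e))\<^sup>2" and ?\<eta> = "\<Sum>e\<in>F. ?c e *\<^sub>C e"
      have n: "(norm ?\<eta>)\<^sup>2 = ?S" by (rule norm_sq_basis_sum[OF F])
      have "cinner (x \<cdot> ?\<eta>) \<xi> = (\<Sum>e\<in>F. cnj (?c e) * ?c e)"
        by (simp add: clinear_sum[OF bounded_opsD[OF x]] clinear_scaleC[OF bounded_opsD[OF x]]
            cinner_sum_left cinner_scaleC_left)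
      also have "\<dots> = of_real ?S"
        unfolding of_real_sum complex_norm_square by (simp add: mult.commute)
      finally have "?S = cmod (cinner (x \<cdot> ?\<eta>) \<xi>)"
        by (metis (no_types, lifting) abs_of_nonneg norm_of_real sum_nonneg zero_le_power2)
      also have "\<dots> \<le> norm (x \<cdot> ?\<eta>) * norm \<xi>" by (rule norm_cinner_le)
      also have "\<dots> \<le> norm x * norm ?\<eta> * norm \<xi>" by (intro mult_right_mono norm_blinfun) simp
      finally have "norm ?\<eta> * norm ?\<eta> \<le> (norm x * norm \<xi>) * norm ?\<eta>"
        unfolding n[symmetric] by (simp add: power2_eq_square mult_ac)
      then have "norm ?\<eta> \<le> norm x * norm \<xi>" by (cases "norm ?\<eta> = 0") auto
      then show ?thesis unfolding n[symmetric] by (intro power_mono) auto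
    qed
    then show ?thesis using basis_series[of "\<lambda>e. cinner (x \<cdot> e) \<xi>"] by metis
  qed
  then obtain g where g: "\<And>\<xi> e. e \<in> B \<Longrightarrow> cinner e (g \<xi>) = cinner (x \<cdot> e) \<xi>" by metis
  have adj: "cinner \<eta> (g \<xi>) = cinner (x \<cdot> \<eta>) \<xi>" for \<xi> \<eta>
  proof -
    have "((\<lambda>e. cinner \<eta> e * cinner e (g \<xi>)) has_sum cinner \<eta> (g \<xi>)) B" by (rule parseval)
    moreover have "((\<lambda>e. cinner (cinner e \<eta> *\<^sub>C x \<cdot> e) \<xi>) has_sum cinner (x \<cdot> \<eta>) \<xi>) B"
      by (rule has_sum_bounded_linear[OF bounded_linear_cinner_left op_expansion[OF x]])
    moreover have "cinner (cinner e \<eta> *\<^sub>C x \<cdot> e) \<xi> = cinner \<eta> e * cinner e (g \<xi>)" if "e \<in> B" for e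
      using g[OF that] cinner_commute[of \<eta> e] by (simp add: cinner_scaleC_left)
    ultimately show ?thesis
      by (metis (mono_tags, lifting) has_sum_cong has_sum_unique)
  qed
  have clin: "clinear g"
    by (intro clinearI vector_eqI) (simp_all add: adj cinner_add_right cinner_scaleC_right)
  have bd: "norm (g \<xi>) \<le> norm x * norm \<xi>" for \<xi>
  proof (rule norm_le_if_cinner_le)
    show "0 \<le> norm x * norm \<xi>" by simp
    fix \<eta>
    have "cmod (cinner \<eta> (g \<xi>)) \<le> norm (x \<cdot> \<eta>) * norm \<xi>" unfolding adj by (rule norm_cinner_le)
    also have "\<dots> \<le> norm x * norm \<eta> * norm \<xi>" by (intro mult_right_mono norm_blinfun) simp
    finally show "cmod (cinner \<eta> (g \<xi>)) \<le> norm x * norm \<xi> * norm \<eta>" by (simp add: mult_ac)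
  qed
  note y = bounded_opsI[OF clin bd]
  show ?thesis
  proof (rule that[OF y(1)])
    show "cinner (Blinfun g \<cdot> \<xi>) \<eta> = cinner \<xi> (x \<cdot> \<eta>)" for \<xi> \<eta>
      unfolding y using adj[of \<eta> \<xi>] cinner_commute by metis
  qed
qed

lemma op_adjoint:
  fixes x :: "'h \<Rightarrow>\<^sub>L 'h"
  assumes x: "x \<in> bounded_ops"
  shows op_adjoint_bounded: "op_adjoint x \<in> bounded_ops"
    and cinner_adjoint_left: "cinner (op_adjoint x \<cdot> \<xi>) \<eta> = cinner \<xi> (x \<cdot> \<eta>)"
proof -
  let ?P = "\<lambda>y. y \<in> bounded_ops \<and> (\<forall>\<xi> \<eta>. cinner (y \<cdot> \<xi>) \<eta> = cinner \<xi> (x \<cdot> \<eta>))"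
  have "\<exists>!y. ?P y"
  proof (rule ex_ex1I)
    show "\<exists>y. ?P y" using adjoint_exists[OF x] by metis
    show "y = z" if "?P y" "?P z" for y z
      using that by (intro op_eqI[of y z]) (auto, metis cinner_commute)
  qed
  from theI'[OF this] show "op_adjoint x \<in> bounded_ops"
    "cinner (op_adjoint x \<cdot> \<xi>) \<eta> = cinner \<xi> (x \<cdot> \<eta>)"
    unfolding op_adjoint_def by blast+
qed

lemma cinner_adjoint_right:
  fixes x :: "'h \<Rightarrow>\<^sub>L 'h"
  assumes "x \<in> bounded_ops"
  shows "cinner \<xi> (op_adjoint x \<cdot> \<eta>) = cinner (x \<cdot> \<xi>) \<eta>"
  by (metis assms cinner_adjoint_left cinner_commute)

lemma op_adjoint_eqI:
  fixes x :: "'h \<Rightarrow>\<^sub>L 'h"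
  assumes "x \<in> bounded_ops" "y \<in> bounded_ops"
    and "\<And>\<xi> \<eta>. cinner (y \<cdot> \<xi>) \<eta> = cinner \<xi> (x \<cdot> \<eta>)"
  shows "op_adjoint x = y"
proof (rule op_eqI[OF op_adjoint_bounded[OF assms(1)] assms(2)])
  show "cinner e (op_adjoint x \<cdot> f) = cinner e (y \<cdot> f)" for e f
    using assms(3)[of f e] cinner_adjoint_left[OF assms(1), of f e] by (metis cinner_commute)
qed

lemma op_adjoint_add:
  "(x :: 'h \<Rightarrow>\<^sub>L 'h) \<in> bounded_ops \<Longrightarrow> y \<in> bounded_ops \<Longrightarrow> op_adjoint (x + y) = op_adjoint x + op_adjoint y"
  by (intro op_adjoint_eqI bounded_ops_add op_adjoint_bounded)
    (simp_all add: plus_blinfun.rep_eq cinner_add_left cinner_add_right cinner_adjoint_left)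

lemma op_adjoint_scaleC: "(x :: 'h \<Rightarrow>\<^sub>L 'h) \<in> bounded_ops \<Longrightarrow> op_adjoint (c *\<^sub>C x) = cnj c *\<^sub>C op_adjoint x"
  by (intro op_adjoint_eqI bounded_ops_scaleC op_adjoint_bounded)
    (simp_all add: cinner_scaleC_left cinner_scaleC_right cinner_adjoint_left)

lemma op_adjoint_compose:
  "(x :: 'h \<Rightarrow>\<^sub>L 'h) \<in> bounded_ops \<Longrightarrow> y \<in> bounded_ops \<Longrightarrow> op_adjoint (x o\<^sub>L y) = op_adjoint y o\<^sub>L op_adjoint x"
  by (intro op_adjoint_eqI bounded_ops_compose op_adjoint_bounded) (simp_all add: cinner_adjoint_left)

lemma op_adjoint_adjoint: "(x :: 'h \<Rightarrow>\<^sub>L 'h) \<in> bounded_ops \<Longrightarrow> op_adjoint (op_adjoint x) = x"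
  by (intro op_adjoint_eqI op_adjoint_bounded) (simp_all add: cinner_adjoint_right)


section \<open>Complex conjugation in the basis and the transpose\<close>

text \<open>The antiunitary involution $J$ that fixes the basis.\<close>

definition conj_vec :: "'h \<Rightarrow> 'h" where
  "conj_vec \<xi> = (SOME \<zeta>. \<forall>e\<in>B. cinner e \<zeta> = cnj (cinner e \<xi>))"

lemma cinner_basis_conj: 
  assumes "e \<in> B"
  shows "cinner e (conj_vec \<xi>) = cnj (cinner e \<xi>)"
proof -
  have "\<exists>\<zeta>. \<forall>e\<in>B. cinner e \<zeta> = cnj (cinner e \<xi>)"
    by (rule basis_series[of "\<lambda>e. cnj (cinner e \<xi>)" "(norm \<xi>)\<^sup>2"]) (auto simp: bessel)
  then have "\<forall>e\<in>B. cinner e (conj_vec \<xi>) = cnj (cinner e \<xi>)"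
    unfolding conj_vec_def by (rule someI_ex)
  then show ?thesis using assms by simp
qed

lemma conj_vec_conj [simp]: "conj_vec (conj_vec \<xi>) = \<xi>"
  by (rule vector_eqI) (simp add: cinner_basis_conj)

lemma conj_vec_add: "conj_vec (\<xi> + \<eta>) = conj_vec \<xi> + conj_vec \<eta>"
  by (rule vector_eqI) (simp add: cinner_basis_conj cinner_add_right)

lemma conj_vec_scaleC: "conj_vec (c *\<^sub>C \<xi>) = cnj c *\<^sub>C conj_vec \<xi>"
  by (rule vector_eqI) (simp add: cinner_basis_conj cinner_scaleC_right)

lemma conj_vec_0: "conj_vec 0 = 0"
  using conj_vec_scaleC[of 0 0] by simp

lemma conj_vec_sum: "conj_vec (sum f S) = (\<Sum>i\<in>S. conj_vec (f i))"
  by (induction S rule: infinite_finite_induct) (simp_all add: conj_vec_add conj_vec_0)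

lemma conj_vec_basis: "e \<in> B \<Longrightarrow> conj_vec e = e"
  by (rule vector_eqI) (simp add: cinner_basis_conj cinner_basis)

lemma cinner_conj_conj: "cinner (conj_vec \<xi>) (conj_vec \<eta>) = cinner \<eta> \<xi>"
proof -
  have "((\<lambda>e. cinner (conj_vec \<xi>) e * cinner e (conj_vec \<eta>)) has_sum cinner (conj_vec \<xi>) (conj_vec \<eta>)) B"
    by (rule parseval)
  moreover have "cinner (conj_vec \<xi>) e * cinner e (conj_vec \<eta>) = cinner \<eta> e * cinner e \<xi>" if "e \<in> B" for e
    using cinner_basis_conj[OF that] cinner_commute[of "conj_vec \<xi>" e] cinner_commute[of \<eta> e]
    by (simp add: mult.commute)
  ultimately show ?thesis
    using parseval[of \<eta> \<xi>] by (metis (mono_tags, lifting) has_sum_cong has_sum_unique)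
qed

lemma cinner_conj_left: "cinner (conj_vec \<xi>) \<eta> = cinner (conj_vec \<eta>) \<xi>"
  using cinner_conj_conj[of \<xi> "conj_vec \<eta>"] by simp

lemma cinner_conj_right: "cinner \<xi> (conj_vec \<eta>) = cinner \<eta> (conj_vec \<xi>)"
  using cinner_conj_conj[of "conj_vec \<xi>" \<eta>] by simp

lemma norm_conj_vec [simp]: "norm (conj_vec \<xi>) = norm \<xi>"
  using cinner_conj_conj[of \<xi> \<xi>] norm_sq_cinner[of \<xi>] norm_sq_cinner[of "conj_vec \<xi>"]
  by (metis norm_ge_zero power2_eq_iff_nonneg)

text \<open>The transpose is $J x^* J$, which reduces its properties to those of the adjoint.\<close>

lemma transpose_op:
  assumes x: "x \<in> bounded_ops"
  shows transpose_op_bounded: "transpose_op B x \<in> bounded_ops"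
    and transpose_op_apply:
      "transpose_op B x \<cdot> \<xi> = conj_vec (op_adjoint x \<cdot> (conj_vec \<xi>))"
proof -
  let ?f = "\<lambda>\<xi>. conj_vec (op_adjoint x \<cdot> (conj_vec \<xi>))"
  have "clinear (blinfun_apply (op_adjoint x))"
    by (intro bounded_opsD op_adjoint_bounded x)
  then have clin: "clinear ?f"
    by (intro clinearI) (simp_all add: conj_vec_add conj_vec_scaleC clinear_add clinear_scaleC)
  have bd: "norm (?f \<xi>) \<le> norm (op_adjoint x) * norm \<xi>" for \<xi>
    using norm_blinfun[of "op_adjoint x" "conj_vec \<xi>"] by simp
  note y = bounded_opsI[OF clin bd]
  let ?P = "\<lambda>y. y \<in> bounded_ops \<and>
     (\<forall>e\<in>B. \<forall>f\<in>B. cinner e (y \<cdot> f) = cinner f (x \<cdot> e))"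
  have P: "?P (Blinfun ?f)"
  proof (intro conjI y ballI)
    fix e f assume ef: "e \<in> B" "f \<in> B"
    show "cinner e (Blinfun ?f \<cdot> f) = cinner f (x \<cdot> e)"
      unfolding y cinner_conj_right[of e] conj_vec_basis[OF ef(1)] conj_vec_basis[OF ef(2)]
      by (rule cinner_adjoint_left[OF x])
  qed
  have "transpose_op B x = Blinfun ?f"
    unfolding transpose_op_def
  proof (rule the_equality[where P = ?P, OF P])
    show "z = Blinfun ?f" if "?P z" for z
      using that P by (intro op_eqI) auto
  qed
  then show "transpose_op B x \<in> bounded_ops" "transpose_op B x \<cdot> \<xi> = ?f \<xi>"
    using y by simp_all
qed

lemma transpose_op_add:
  "x \<in> bounded_ops \<Longrightarrow> y \<in> bounded_ops \<Longrightarrow> transpose_op B (x + y) = transpose_op B x + transpose_op B y"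
  by (rule blinfun_eqI)
    (simp add: transpose_op_apply bounded_ops_add op_adjoint_add plus_blinfun.rep_eq conj_vec_add)

lemma transpose_op_scaleC:
  "x \<in> bounded_ops \<Longrightarrow> transpose_op B (c *\<^sub>C x) = c *\<^sub>C transpose_op B x"
  by (rule blinfun_eqI)
    (simp add: transpose_op_apply bounded_ops_scaleC op_adjoint_scaleC conj_vec_scaleC)

lemma transpose_op_compose:
  "x \<in> bounded_ops \<Longrightarrow> y \<in> bounded_ops \<Longrightarrow> transpose_op B (x o\<^sub>L y) = transpose_op B y o\<^sub>L transpose_op B x"
  by (rule blinfun_eqI) (simp add: transpose_op_apply bounded_ops_compose op_adjoint_compose)

lemma transpose_op_adjoint:
  assumes x: "x \<in> bounded_ops"
  shows "transpose_op B (op_adjoint x) = op_adjoint (transpose_op B x)"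
proof -
  have "op_adjoint (transpose_op B x) = transpose_op B (op_adjoint x)"
  proof (rule op_adjoint_eqI)
    show "transpose_op B x \<in> bounded_ops" "transpose_op B (op_adjoint x) \<in> bounded_ops"
      using x by (simp_all add: transpose_op_bounded op_adjoint_bounded)
    show "cinner (transpose_op B (op_adjoint x) \<cdot> \<xi>) \<eta>
        = cinner \<xi> (transpose_op B x \<cdot> \<eta>)" for \<xi> \<eta>
      unfolding transpose_op_apply[OF x] transpose_op_apply[OF op_adjoint_bounded[OF x]]
        op_adjoint_adjoint[OF x]
        cinner_conj_left[of "x \<cdot> (conj_vec \<xi>)"]
        cinner_conj_right[of \<xi> "op_adjoint x \<cdot> (conj_vec \<eta>)"]
      by (metis cinner_adjoint_left[OF x] cinner_commute)
  qed
  then show ?thesis by simp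
qed

end

section \<open>Positive operators, square roots and approximate polar decomposition\<close>

lemma cinner_eqI: "(\<And>\<zeta>. cinner \<zeta> \<xi> = cinner \<zeta> \<eta>) \<Longrightarrow> \<xi> = (\<eta>::'h::complex_hilbert)"
proof -
  assume *: "\<And>\<zeta>. cinner \<zeta> \<xi> = cinner \<zeta> \<eta>"
  have "cinner (\<xi> - \<eta>) (\<xi> - \<eta>) = 0" using * by (simp add: cinner_diff_right)
  then show ?thesis by (simp add: cinner_self)
qed

lemma positive_opD:
  assumes "positive_op x"
  shows "x \<in> bounded_ops" "0 \<le> Re (cinner \<xi> (x \<cdot> \<xi>))"
    "Im (cinner \<xi> (x \<cdot> \<xi>)) = 0"
  using assms by (auto simp: positive_op_def complex_nonneg_Reals_iff)

lemma positive_opI: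
  assumes "x \<in> bounded_ops" "\<And>\<xi>. 0 \<le> Re (cinner \<xi> (x \<cdot> \<xi>))"
    "\<And>\<xi>. Im (cinner \<xi> (x \<cdot> \<xi>)) = 0"
  shows "positive_op x"
  using assms by (auto simp: positive_op_def complex_nonneg_Reals_iff)

lemma positive_op_hermitian:
  assumes x: "positive_op x"
  shows "cinner \<xi> (x \<cdot> \<eta>) = cinner (x \<cdot> \<xi>) \<eta>"
proof -
  note c = bounded_opsD[OF positive_opD(1)[OF x]]
  define g where "g = (\<lambda>\<xi> \<eta>. cinner \<xi> (x \<cdot> \<eta>))"
  have real: "Im (g u u) = 0" for u unfolding g_def using positive_opD(3)[OF x] .
  have "g (\<xi> + \<eta>) (\<xi> + \<eta>) = g \<xi> \<xi> + g \<eta> \<eta> + (g \<xi> \<eta> + g \<eta> \<xi>)"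
    by (simp add: g_def clinear_add[OF c] cinner_add_left cinner_add_right)
  then have im: "Im (g \<xi> \<eta>) = - Im (g \<eta> \<xi>)"
    using real[of "\<xi> + \<eta>"] real[of \<xi>] real[of \<eta>] by simp
  have "g (\<xi> + \<i> *\<^sub>C \<eta>) (\<xi> + \<i> *\<^sub>C \<eta>) = g \<xi> \<xi> + g \<eta> \<eta> + \<i> * (g \<xi> \<eta> - g \<eta> \<xi>)"
    by (simp add: g_def clinear_add[OF c] clinear_scaleC[OF c] cinner_add_left cinner_add_right
        cinner_scaleC_left cinner_scaleC_right algebra_simps)
  then have re: "Re (g \<xi> \<eta>) = Re (g \<eta> \<xi>)"
    using real[of "\<xi> + \<i> *\<^sub>C \<eta>"] real[of \<xi>] real[of \<eta>] by simp
  have "g \<xi> \<eta> = cnj (g \<eta> \<xi>)" using re im by (simp add: complex_eq_iff)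
  also have "\<dots> = cinner (x \<cdot> \<xi>) \<eta>" unfolding g_def by (rule cinner_commute[symmetric])
  finally show ?thesis by (simp add: g_def)
qed

lemma positive_op_cauchy_schwarz:
  assumes x: "positive_op x"
  shows "(cmod (cinner \<xi> (x \<cdot> \<eta>)))\<^sup>2
    \<le> Re (cinner \<xi> (x \<cdot> \<xi>)) * Re (cinner \<eta> (x \<cdot> \<eta>))"
proof (rule form_cauchy_schwarz[of "\<lambda>\<xi> \<eta>. cinner \<xi> (x \<cdot> \<eta>)"])
  note c = bounded_opsD[OF positive_opD(1)[OF x]]
  fix \<xi> \<eta> \<zeta> a
  show "cinner \<xi> (x \<cdot> (\<eta> + \<zeta>)) = cinner \<xi> (x \<cdot> \<eta>) + cinner \<xi> (x \<cdot> \<zeta>)"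
    by (simp add: clinear_add[OF c] cinner_add_right)
  show "cinner \<xi> (x \<cdot> (a *\<^sub>C \<eta>)) = a * cinner \<xi> (x \<cdot> \<eta>)"
    by (simp add: clinear_scaleC[OF c] cinner_scaleC_right)
  show "cinner \<xi> (x \<cdot> \<eta>) = cnj (cinner \<eta> (x \<cdot> \<xi>))"
    unfolding positive_op_hermitian[OF x, of \<xi>] by (rule cinner_commute)
  show "0 \<le> Re (cinner \<xi> (x \<cdot> \<xi>))" by (rule positive_opD[OF x])
qed

lemma positive_op_norm_le:
  assumes x: "positive_op x" and K: "0 \<le> K"
    and le: "\<And>\<xi>. Re (cinner \<xi> (x \<cdot> \<xi>)) \<le> K * (norm \<xi>)\<^sup>2"
  shows "norm x \<le> K"
proof (rule norm_blinfun_bound[OF K], rule norm_le_if_cinner_le)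
  fix \<xi> \<eta>
  have "(cmod (cinner \<eta> (x \<cdot> \<xi>)))\<^sup>2
      \<le> Re (cinner \<eta> (x \<cdot> \<eta>)) * Re (cinner \<xi> (x \<cdot> \<xi>))"
    by (rule positive_op_cauchy_schwarz[OF x])
  also have "\<dots> \<le> (K * (norm \<eta>)\<^sup>2) * (K * (norm \<xi>)\<^sup>2)"
    using K by (intro mult_mono le positive_opD[OF x]) auto
  also have "\<dots> = (K * norm \<xi> * norm \<eta>)\<^sup>2" by (simp add: power2_eq_square)
  finally show "cmod (cinner \<eta> (x \<cdot> \<xi>)) \<le> K * norm \<xi> * norm \<eta>"
    by (rule power2_le_imp_le) (use K in simp)
qed (use K in simp)

lemma positive_op_form_le: "Re (cinner \<xi> (x \<cdot> \<xi>)) \<le> norm x * (norm \<xi>)\<^sup>2"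
proof -
  have "Re (cinner \<xi> (x \<cdot> \<xi>)) \<le> norm \<xi> * norm (x \<cdot> \<xi>)"
    by (meson complex_Re_le_cmod norm_cinner_le order_trans)
  also have "\<dots> \<le> norm \<xi> * (norm x * norm \<xi>)" by (intro mult_left_mono norm_blinfun) simp
  finally show ?thesis by (simp add: power2_eq_square mult_ac)
qed

text \<open>Positivity becomes a norm estimate, which is what the power series for square roots and resolvents
  need.\<close>

lemma norm_scaled_one_minus_le:
  assumes x: "positive_op (x::'h::complex_hilbert \<Rightarrow>\<^sub>L 'h)" and M: "norm x \<le> M"
  shows "norm (M *\<^sub>R 1 - Endo x) \<le> M"
proof -
  have M0: "0 \<le> M" using M norm_ge_zero[of x] by linarith
  let ?y = "M *\<^sub>R id_blinfun - x"
  note c = bounded_opsD[OF positive_opD(1)[OF x]]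
  have ap: "?y \<cdot> \<xi> = M *\<^sub>R \<xi> - x \<cdot> \<xi>" for \<xi>
    by (simp add: minus_blinfun.rep_eq scaleR_blinfun.rep_eq)
  have form: "cinner \<xi> (?y \<cdot> \<xi>) = of_real (M * (norm \<xi>)\<^sup>2) - cinner \<xi> (x \<cdot> \<xi>)" for \<xi>
    by (simp add: ap cinner_diff_right cinner_self)
  have "positive_op ?y"
  proof (rule positive_opI)
    show "?y \<in> bounded_ops"
      unfolding bounded_ops_iff ap
      by (simp add: clinear_scaleC[OF c] cv.scale_right_diff_distrib scaleR_scaleC scaleC_scaleC mult.commute)
    fix \<xi>
    have "Re (cinner \<xi> (x \<cdot> \<xi>)) \<le> M * (norm \<xi>)\<^sup>2"
      using positive_op_form_le[of \<xi> x] mult_right_mono[OF M, of "(norm \<xi>)\<^sup>2"] by simp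
    then show "0 \<le> Re (cinner \<xi> (?y \<cdot> \<xi>))" unfolding form by simp
    show "Im (cinner \<xi> (?y \<cdot> \<xi>)) = 0" unfolding form using positive_opD(3)[OF x] by simp
  qed
  then have "norm ?y \<le> M"
  proof (rule positive_op_norm_le[OF _ M0])
    show "Re (cinner \<xi> (?y \<cdot> \<xi>)) \<le> M * (norm \<xi>)\<^sup>2" for \<xi>
      unfolding form using positive_opD(2)[OF x, of \<xi>] by simp
  qed
  moreover have "M *\<^sub>R 1 - Endo x = Endo ?y"
    by (rule endo_eqI) (simp add: minus_blinfun.rep_eq scaleR_blinfun.rep_eq)
  ultimately show ?thesis by (simp add: norm_Endo)
qed

definition clinear_endos :: "'h::complex_hilbert endo set" where
  "clinear_endos = {w. \<forall>c \<xi>. endo_apply w (c *\<^sub>C \<xi>) = c *\<^sub>C endo_apply w \<xi>}"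

definition hermitian_endos :: "'h::complex_hilbert endo set" where
  "hermitian_endos = {w. \<forall>\<xi> \<eta>. cinner \<xi> (endo_apply w \<eta>) = cinner (endo_apply w \<xi>) \<eta>}"

lemma closed_clinear_endos: "closed clinear_endos"
  unfolding clinear_endos_def
  by (intro closed_Collect_all closed_Collect_eq continuous_intros
      bounded_linear.continuous_on[OF bounded_linear_scaleC])

lemma subspace_clinear_endos: "subspace clinear_endos"
  by (auto simp: subspace_def clinear_endos_def scaleC_add_right scaleR_scaleC scaleC_scaleC mult.commute)

lemma closed_hermitian_endos: "closed hermitian_endos"
  unfolding hermitian_endos_def
  by (intro closed_Collect_all closed_Collect_eq continuous_intros
      bounded_linear.continuous_on[OF bounded_linear_cinner_right]
      bounded_linear.continuous_on[OF bounded_linear_cinner_left])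

lemma subspace_hermitian_endos: "subspace hermitian_endos"
  by (auto simp: subspace_def hermitian_endos_def cinner_add_left cinner_add_right)

lemma power_clinear_endos: "w \<in> clinear_endos \<Longrightarrow> w ^ n \<in> clinear_endos"
  by (induction n) (auto simp: clinear_endos_def)

lemma power_hermitian_endos:
  assumes "w \<in> hermitian_endos"
  shows "w ^ n \<in> hermitian_endos"
proof (induction n)
  case (Suc n)
  have "endo_apply w (endo_apply (w ^ n) \<xi>) = endo_apply (w ^ n) (endo_apply w \<xi>)" for \<xi>
    by (metis endo_apply_simps(5) power_commutes)
  then show ?case using Suc assms by (simp add: hermitian_endos_def)
qed (simp add: hermitian_endos_def)

lemma of_endo_bounded_ops: "w \<in> clinear_endos \<Longrightarrow> of_endo w \<in> bounded_ops"
  by (simp add: clinear_endos_def bounded_ops_iff endo_apply_def)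

lemma Endo_clinear_endos: "x \<in> bounded_ops \<Longrightarrow> Endo x \<in> clinear_endos"
  by (simp add: clinear_endos_def bounded_ops_iff)

lemma Endo_hermitian_endos: "positive_op x \<Longrightarrow> Endo x \<in> hermitian_endos"
  by (simp add: hermitian_endos_def positive_op_hermitian)

lemma one_clinear_endos: "1 \<in> clinear_endos" and one_hermitian_endos: "1 \<in> hermitian_endos"
  by (simp_all add: clinear_endos_def hermitian_endos_def)

text \<open>The root is $\sqrt M$ times the binomial series at $1 - x / M$.  That it commutes with everything
  commuting with \<open>x\<close> is kept for the proof of uniqueness.\<close>

lemma positive_sqrt_exists:
  assumes x: "positive_op (x::'h::complex_hilbert \<Rightarrow>\<^sub>L 'h)"
  obtains s where "positive_op s" "s o\<^sub>L s = x" "\<And>y. x o\<^sub>L y = y o\<^sub>L x \<Longrightarrow> s o\<^sub>L y = y o\<^sub>L s"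
proof -
  define M where "M = norm x + 1"
  have M: "M > 0" "norm x \<le> M" by (auto simp: M_def add_pos_nonneg add.commute)
  define k where "k = (1::'h endo) - (1 / M) *\<^sub>R Endo x"
  have "k = (1 / M) *\<^sub>R (M *\<^sub>R 1 - Endo x)" using M by (simp add: k_def scaleR_diff_right)
  then have "norm k = norm (M *\<^sub>R 1 - Endo x) / M" using M by simp
  then have k: "norm k \<le> 1" using norm_scaled_one_minus_le[OF x M(2)] M by simp
  define s where "s = sqrt M *\<^sub>R of_endo (sqrt_series k)"
  have kc: "k \<in> clinear_endos" unfolding k_def
    by (intro subspace_diff subspace_mul subspace_clinear_endos one_clinear_endos
        Endo_clinear_endos positive_opD[OF x])
  have kh: "k \<in> hermitian_endos" unfolding k_def
    by (intro subspace_diff subspace_mul subspace_hermitian_endos one_hermitian_endos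
        Endo_hermitian_endos x)
  have c: "sqrt_series k \<in> clinear_endos"
    by (intro sqrt_series_mem k closed_clinear_endos subspace_clinear_endos power_clinear_endos kc)
  have h: "sqrt_series k \<in> hermitian_endos"
    by (intro sqrt_series_mem k closed_hermitian_endos subspace_hermitian_endos power_hermitian_endos kh)
  have sap: "s \<cdot> \<xi> = sqrt M *\<^sub>R endo_apply (sqrt_series k) \<xi>" for \<xi>
    by (simp add: s_def scaleR_blinfun.rep_eq endo_apply_def)
  show ?thesis
  proof (rule that)
    show "positive_op s"
    proof (rule positive_opI)
      have "s = complex_of_real (sqrt M) *\<^sub>C of_endo (sqrt_series k)"
        by (simp add: s_def scaleR_scaleC)
      then show "s \<in> bounded_ops"
        using c by (simp add: bounded_ops_scaleC of_endo_bounded_ops)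
      fix \<xi>
      let ?r = "cinner \<xi> (endo_apply (sqrt_series k) \<xi>)"
      have "cnj ?r = ?r" using h cinner_commute unfolding hermitian_endos_def
        by (metis (mono_tags, lifting) mem_Collect_eq)
      then have im: "Im ?r = 0" by (simp add: complex_eq_iff)
      have "Re (cinner \<xi> (endo_apply (1 - sqrt_series k) \<xi>)) \<le> norm \<xi> * norm (endo_apply (1 - sqrt_series k) \<xi>)"
        by (meson complex_Re_le_cmod norm_cinner_le order_trans)
      also have "\<dots> \<le> norm \<xi> * (norm (1 - sqrt_series k) * norm \<xi>)"
        by (intro mult_left_mono norm_endo_apply) simp
      also have "\<dots> \<le> norm \<xi> * (1 * norm \<xi>)"
        by (intro mult_left_mono mult_right_mono norm_one_minus_sqrt_series k) auto
      finally have re: "0 \<le> Re ?r"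
        by (simp add: cinner_diff_right cinner_self power2_eq_square)
      show "0 \<le> Re (cinner \<xi> (s \<cdot> \<xi>))" "Im (cinner \<xi> (s \<cdot> \<xi>)) = 0"
        using re im M by (simp_all add: sap)
    qed
    have sq: "sqrt_series k * sqrt_series k = (1 / M) *\<^sub>R Endo x"
      unfolding sqrt_series_square[OF k] by (simp add: k_def)
    show "s o\<^sub>L s = x"
    proof (rule blinfun_eqI)
      fix \<xi>
      have "(s o\<^sub>L s) \<cdot> \<xi> = M *\<^sub>R endo_apply (sqrt_series k * sqrt_series k) \<xi>"
        using M by (simp add: sap endo_apply_def[of "sqrt_series k"] blinfun.scaleR_right)
      then show "(s o\<^sub>L s) \<cdot> \<xi> = x \<cdot> \<xi>" unfolding sq using M by simp
    qed
    fix y assume y: "x o\<^sub>L y = y o\<^sub>L x"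
    have "Endo x * Endo y = Endo y * Endo x"
      using y by (metis Endo_inverse UNIV_I of_endo_inject times_endo.rep_eq)
    then have "k * Endo y = Endo y * k" by (simp add: k_def algebra_simps)
    then have comm: "sqrt_series k * Endo y = Endo y * sqrt_series k"
      by (rule sqrt_series_commutes[OF k])
    show "s o\<^sub>L y = y o\<^sub>L s"
    proof (rule blinfun_eqI)
      fix \<xi>
      show "(s o\<^sub>L y) \<cdot> \<xi> = (y o\<^sub>L s) \<cdot> \<xi>"
        using arg_cong[OF comm, of "\<lambda>w. endo_apply w \<xi>"] by (simp add: sap blinfun.scaleR_right)
    qed
  qed
qed

lemma positive_sqrt_unique:
  assumes s: "positive_op s" and t: "positive_op t" and eq: "s o\<^sub>L s = t o\<^sub>L t"
  shows "s = t"
proof -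
  have "positive_op (t o\<^sub>L t)"
  proof (rule positive_opI)
    show "t o\<^sub>L t \<in> bounded_ops" by (intro bounded_ops_compose positive_opD[OF t])
    show "0 \<le> Re (cinner \<xi> ((t o\<^sub>L t) \<cdot> \<xi>))" "Im (cinner \<xi> ((t o\<^sub>L t) \<cdot> \<xi>)) = 0" for \<xi>
      by (simp_all add: positive_op_hermitian[OF t, of \<xi>] cinner_self)
  qed
  then obtain r where r: "positive_op r" "r o\<^sub>L r = t o\<^sub>L t"
    and comm: "\<And>y. (t o\<^sub>L t) o\<^sub>L y = y o\<^sub>L (t o\<^sub>L t) \<Longrightarrow> r o\<^sub>L y = y o\<^sub>L r"
    using positive_sqrt_exists by metis
  \<comment> \<open>Every positive root \<open>u\<close> commutes with \<open>u\<^sup>2\<close>, hence with the root \<open>r\<close> given by the series.\<close>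
  have *: "u = r" if u: "positive_op u" and uu: "u o\<^sub>L u = t o\<^sub>L t" for u
  proof (rule blinfun_eqI)
    fix \<xi>
    have "(t o\<^sub>L t) o\<^sub>L u = u o\<^sub>L (t o\<^sub>L t)"
      unfolding uu[symmetric] by (rule blinfun_eqI) simp
    from comm[OF this] have ru: "r \<cdot> (u \<cdot> \<zeta>) = u \<cdot> (r \<cdot> \<zeta>)" for \<zeta>
      by (metis blinfun_apply_blinfun_compose)
    have rr: "r \<cdot> (r \<cdot> \<zeta>) = u \<cdot> (u \<cdot> \<zeta>)" for \<zeta>
      using r(2) uu by (metis blinfun_apply_blinfun_compose)
    let ?d = "\<lambda>\<zeta>. u \<cdot> \<zeta> - r \<cdot> \<zeta>"
    let ?\<eta> = "?d \<xi>"
    have "u \<cdot> ?\<eta> + r \<cdot> ?\<eta> = 0"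
      by (simp add: blinfun.diff_right ru rr)
    then have "cinner ?\<eta> (u \<cdot> ?\<eta>) + cinner ?\<eta> (r \<cdot> ?\<eta>) = 0"
      by (metis cinner_add_right cinner_zero_right)
    then have "Re (cinner ?\<eta> (u \<cdot> ?\<eta>)) + Re (cinner ?\<eta> (r \<cdot> ?\<eta>)) = 0"
      by (metis plus_complex.sel(1) zero_complex.sel(1))
    then have z: "Re (cinner ?\<eta> (u \<cdot> ?\<eta>)) = 0" "Re (cinner ?\<eta> (r \<cdot> ?\<eta>)) = 0"
      using positive_opD(2)[OF u, of ?\<eta>] positive_opD(2)[OF r(1), of ?\<eta>] by linarith+
    have zero: "w \<cdot> ?\<eta> = 0" if w: "positive_op w" "Re (cinner ?\<eta> (w \<cdot> ?\<eta>)) = 0" for w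
    proof (rule cinner_eqI)
      fix \<zeta>
      show "cinner \<zeta> (w \<cdot> ?\<eta>) = cinner \<zeta> 0"
        using positive_op_cauchy_schwarz[OF w(1), of \<zeta> ?\<eta>] unfolding w(2) by simp
    qed
    have "cinner ?\<eta> ?\<eta> = cinner (u \<cdot> \<xi>) ?\<eta> - cinner (r \<cdot> \<xi>) ?\<eta>"
      by (rule cinner_diff_left)
    also have "\<dots> = cinner \<xi> (u \<cdot> ?\<eta>) - cinner \<xi> (r \<cdot> ?\<eta>)"
      unfolding positive_op_hermitian[OF u, of \<xi> ?\<eta>] positive_op_hermitian[OF r(1), of \<xi> ?\<eta>] ..
    also have "\<dots> = 0" unfolding zero[OF u z(1)] zero[OF r(1) z(2)] by simp
    finally show "u \<cdot> \<xi> = r \<cdot> \<xi>" by (simp add: cinner_self)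
  qed
  show ?thesis using *[OF s eq] *[OF t HOL.refl] by simp
qed

context hilbert_basis
begin

lemma op_abs:
  fixes x :: "'h \<Rightarrow>\<^sub>L 'h"
  assumes x: "x \<in> bounded_ops"
  shows op_abs_positive: "positive_op (op_abs x)"
    and op_abs_square: "op_abs x o\<^sub>L op_abs x = op_adjoint x o\<^sub>L x"
proof -
  have "positive_op (op_adjoint x o\<^sub>L x)"
  proof (rule positive_opI)
    show "op_adjoint x o\<^sub>L x \<in> bounded_ops" by (intro bounded_ops_compose op_adjoint_bounded x)
    show "0 \<le> Re (cinner \<xi> ((op_adjoint x o\<^sub>L x) \<cdot> \<xi>))"
      "Im (cinner \<xi> ((op_adjoint x o\<^sub>L x) \<cdot> \<xi>)) = 0" for \<xi>
      by (simp_all add: cinner_adjoint_right[OF x] cinner_self)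
  qed
  then obtain s where s: "positive_op s" "s o\<^sub>L s = op_adjoint x o\<^sub>L x"
    by (rule positive_sqrt_exists)
  have "op_abs x = s"
    unfolding op_abs_def using s by (intro the_equality) (auto intro: positive_sqrt_unique)
  then show "positive_op (op_abs x)" "op_abs x o\<^sub>L op_abs x = op_adjoint x o\<^sub>L x" using s by simp_all
qed

lemma cinner_op_abs:
  fixes x :: "'h \<Rightarrow>\<^sub>L 'h"
  assumes x: "x \<in> bounded_ops"
  shows "cinner (op_abs x \<cdot> \<xi>) (op_abs x \<cdot> \<eta>)
    = cinner (x \<cdot> \<xi>) (x \<cdot> \<eta>)"
proof -
  have "op_abs x \<cdot> (op_abs x \<cdot> \<eta>) = op_adjoint x \<cdot> (x \<cdot> \<eta>)"
    using op_abs_square[OF x] by (metis blinfun_apply_blinfun_compose)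
  then show ?thesis
    by (simp flip: positive_op_hermitian[OF op_abs_positive[OF x]] add: cinner_adjoint_right[OF x])
qed

lemma norm_op_abs:
  fixes x :: "'h \<Rightarrow>\<^sub>L 'h"
  assumes x: "x \<in> bounded_ops"
  shows "norm (op_abs x \<cdot> \<xi>) = norm (x \<cdot> \<xi>)"
proof -
  have "(norm (op_abs x \<cdot> \<xi>))\<^sup>2 = (norm (x \<cdot> \<xi>))\<^sup>2"
    unfolding norm_sq_cinner cinner_op_abs[OF x] ..
  then show ?thesis by (simp add: power2_eq_iff_nonneg)
qed

lemma positive_resolvent:
  fixes p :: "'h \<Rightarrow>\<^sub>L 'h"
  assumes p: "positive_op p" and e: "e > 0"
  obtains r where "r \<in> bounded_ops"
    "\<And>\<xi>. r \<cdot> (p \<cdot> \<xi>) = \<xi> - e *\<^sub>R r \<cdot> \<xi>"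
    "\<And>\<xi>. p \<cdot> (r \<cdot> \<xi>) = \<xi> - e *\<^sub>R r \<cdot> \<xi>"
proof -
  define M where "M = norm p"
  have M: "0 \<le> M" by (simp add: M_def)
  define k where "k = (1 / (M + e)) *\<^sub>R (M *\<^sub>R 1 - Endo p)"
  have "norm k = norm (M *\<^sub>R 1 - Endo p) / (M + e)" using M e by (simp add: k_def)
  also have "\<dots> \<le> M / (M + e)"
    using M e norm_scaled_one_minus_le[OF p, of M] by (intro divide_right_mono) (auto simp: M_def)
  also have "\<dots> < 1" using M e by simp
  finally have nk: "norm k < 1" .
  have kc: "k \<in> clinear_endos" unfolding k_def
    by (intro subspace_diff subspace_mul subspace_clinear_endos one_clinear_endos
        Endo_clinear_endos positive_opD[OF p])
  obtain w where w: "w \<in> clinear_endos" "w * (1 - k) = 1" "(1 - k) * w = 1"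
    using neumann_inverse[OF nk closed_clinear_endos subspace_clinear_endos power_clinear_endos[OF kc]]
    by blast
  have k1: "1 - k = (1 / (M + e)) *\<^sub>R (Endo p + e *\<^sub>R 1)"
  proof -
    have "(1::'h endo) = (1 / (M + e)) *\<^sub>R ((M + e) *\<^sub>R 1)" using M e by simp
    then have "1 - k = (1 / (M + e)) *\<^sub>R ((M + e) *\<^sub>R 1 - (M *\<^sub>R 1 - Endo p))"
      unfolding k_def by (metis scaleR_diff_right)
    then show ?thesis by (simp add: algebra_simps)
  qed
  define r where "r = of_endo ((1 / (M + e)) *\<^sub>R w)"
  have Er: "Endo r = (1 / (M + e)) *\<^sub>R w" by (simp add: r_def of_endo_inverse)
  have "Endo r * (Endo p + e *\<^sub>R 1) = 1" "(Endo p + e *\<^sub>R 1) * Endo r = 1"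
    using w(2,3) unfolding k1 Er by simp_all
  then have "endo_apply (Endo r * (Endo p + e *\<^sub>R 1)) \<xi> = \<xi>" "endo_apply ((Endo p + e *\<^sub>R 1) * Endo r) \<xi> = \<xi>" for \<xi>
    by simp_all
  then have "r \<cdot> (p \<cdot> \<xi>) = \<xi> - e *\<^sub>R r \<cdot> \<xi>"
    "p \<cdot> (r \<cdot> \<xi>) = \<xi> - e *\<^sub>R r \<cdot> \<xi>" for \<xi>
    by (simp_all add: blinfun.add_right blinfun.scaleR_right eq_diff_eq)
  moreover have "r \<in> bounded_ops"
    unfolding r_def using w(1) by (intro of_endo_bounded_ops subspace_mul subspace_clinear_endos)
  ultimately show ?thesis using that by blast
qed

text \<open>The contraction $v = x (|x| + \varepsilon)^{-1}$ replaces the partial isometry of the polar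
  decomposition: $v |x|$ is close to $x$ and $v^* x$ is close to $|x|$.\<close>

lemma approximate_polar:
  fixes x :: "'h \<Rightarrow>\<^sub>L 'h"
  assumes x: "x \<in> bounded_ops" and e: "e > 0"
  obtains v where "v \<in> bounded_ops" "\<And>\<xi>. norm (v \<cdot> \<xi>) \<le> norm \<xi>"
    "\<And>\<xi>. norm (v \<cdot> (op_abs x \<cdot> \<xi>) - x \<cdot> \<xi>) \<le> e * norm \<xi>"
    "\<And>\<xi>. norm (op_adjoint v \<cdot> (x \<cdot> \<xi>) - op_abs x \<cdot> \<xi>) \<le> e * norm \<xi>"
proof -
  define p where "p = op_abs x"
  have p: "positive_op p" unfolding p_def by (rule op_abs_positive[OF x])
  obtain r where r: "r \<in> bounded_ops"
    and rp: "\<And>\<xi>. r \<cdot> (p \<cdot> \<xi>) = \<xi> - e *\<^sub>R r \<cdot> \<xi>"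
    and pr: "\<And>\<xi>. p \<cdot> (r \<cdot> \<xi>) = \<xi> - e *\<^sub>R r \<cdot> \<xi>"
    using positive_resolvent[OF p e] by metis
  have contr: "norm (p \<cdot> (r \<cdot> \<xi>)) \<le> norm \<xi>" for \<xi>
  proof -
    let ?\<eta> = "r \<cdot> \<xi>"
    have \<xi>: "\<xi> = p \<cdot> ?\<eta> + e *\<^sub>R ?\<eta>" using pr[of \<xi>] by simp
    have "(norm (p \<cdot> ?\<eta> + e *\<^sub>R ?\<eta>))\<^sup>2
        = (norm (p \<cdot> ?\<eta>))\<^sup>2 + 2 * e * Re (cinner ?\<eta> (p \<cdot> ?\<eta>)) + e\<^sup>2 * (norm ?\<eta>)\<^sup>2"
      unfolding norm_sq_cinner
      by (simp add: cinner_add_left cinner_add_right positive_op_hermitian[OF p, of ?\<eta> ?\<eta>]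
          power2_eq_square algebra_simps)
    then have "(norm (p \<cdot> ?\<eta>))\<^sup>2 \<le> (norm \<xi>)\<^sup>2"
      using positive_opD(2)[OF p, of ?\<eta>] e \<xi> by simp
    then show ?thesis by (rule power2_le_imp_le) simp
  qed
  have vle: "norm (x \<cdot> (r \<cdot> \<xi>)) \<le> norm \<xi>" for \<xi>
    using contr[of \<xi>] norm_op_abs[OF x] by (simp add: p_def)
  have rh: "cinner (r \<cdot> \<xi>) \<eta> = cinner \<xi> (r \<cdot> \<eta>)" for \<xi> \<eta>
  proof -
    have "cinner (r \<cdot> \<xi>) \<eta> = cinner (r \<cdot> \<xi>) (p \<cdot> (r \<cdot> \<eta>) + e *\<^sub>R r \<cdot> \<eta>)"
      using pr[of \<eta>] by simp
    also have "\<dots> = cinner (p \<cdot> (r \<cdot> \<xi>) + e *\<^sub>R r \<cdot> \<xi>) (r \<cdot> \<eta>)"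
      by (simp add: cinner_add_left cinner_add_right positive_op_hermitian[OF p])
    finally show ?thesis using pr[of \<xi>] by simp
  qed
  define v where "v = x o\<^sub>L r"
  have v: "v \<in> bounded_ops" unfolding v_def by (intro bounded_ops_compose x r)
  show ?thesis
  proof (rule that[OF v])
    fix \<xi>
    show "norm (v \<cdot> \<xi>) \<le> norm \<xi>" by (simp add: v_def vle)
    have "v \<cdot> (p \<cdot> \<xi>) - x \<cdot> \<xi> = - (e *\<^sub>R x \<cdot> (r \<cdot> \<xi>))"
      by (simp add: v_def rp blinfun.diff_right blinfun.scaleR_right)
    then show "norm (v \<cdot> (op_abs x \<cdot> \<xi>) - x \<cdot> \<xi>) \<le> e * norm \<xi>"
      using vle[of \<xi>] e by (simp add: p_def)
    have "op_adjoint v \<cdot> (x \<cdot> \<xi>) = r \<cdot> (p \<cdot> (p \<cdot> \<xi>))"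
    proof (rule cinner_eqI)
      fix \<zeta>
      have "cinner \<zeta> (op_adjoint v \<cdot> (x \<cdot> \<xi>))
          = cinner (x \<cdot> (r \<cdot> \<zeta>)) (x \<cdot> \<xi>)"
        by (simp add: cinner_adjoint_right[OF v]) (simp add: v_def)
      also have "\<dots> = cinner (r \<cdot> \<zeta>) (p \<cdot> (p \<cdot> \<xi>))"
        by (simp add: p_def flip: cinner_op_abs[OF x]) (simp add: positive_op_hermitian[OF op_abs_positive[OF x]])
      finally show "cinner \<zeta> (op_adjoint v \<cdot> (x \<cdot> \<xi>))
          = cinner \<zeta> (r \<cdot> (p \<cdot> (p \<cdot> \<xi>)))"
        by (simp add: rh)
    qed
    then have "op_adjoint v \<cdot> (x \<cdot> \<xi>) - p \<cdot> \<xi>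
        = - (e *\<^sub>R p \<cdot> (r \<cdot> \<xi>))"
      by (simp add: rp pr)
    then show "norm (op_adjoint v \<cdot> (x \<cdot> \<xi>) - op_abs x \<cdot> \<xi>) \<le> e * norm \<xi>"
      using contr[of \<xi>] e by (simp add: p_def)
  qed
qed

end

section \<open>The trace class\<close>

lemma has_sum_finite_sum:
  fixes f :: "'i \<Rightarrow> 'b \<Rightarrow> 'c::topological_comm_monoid_add"
  assumes "finite I" "\<And>i. i \<in> I \<Longrightarrow> (f i has_sum s i) A"
  shows "((\<lambda>x. \<Sum>i\<in>I. f i x) has_sum (\<Sum>i\<in>I. s i)) A"
  using assms by (induction I rule: finite_induct) (auto intro: has_sum_add)

text \<open>Two families of vectors present the finite rank operator
  $F = \sum_i f_i \langle g_i, \cdot\rangle$.\<close>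

definition contractive :: "'i set \<Rightarrow> ('i \<Rightarrow> 'h::complex_hilbert) \<Rightarrow> ('i \<Rightarrow> 'h) \<Rightarrow> bool" where
  "contractive I f g \<longleftrightarrow> finite I \<and> (\<forall>\<xi>. norm (\<Sum>i\<in>I. cinner (g i) \<xi> *\<^sub>C f i) \<le> norm \<xi>)"

text \<open>The sum is $\mathrm{Tr}(F b)$ for a finite rank contraction $F$, so the least such \<open>K\<close> is the trace norm
  of \<open>b\<close>, by duality.  Unlike the definition through $|b|$, this condition is visibly stable under
  sums, products, adjoints and transposes.  Finite subsets of the Hilbert space, such as sets of
  basis vectors, suffice as index sets.\<close>

definition trace_bound :: "('h::complex_hilbert \<Rightarrow>\<^sub>L 'h) \<Rightarrow> real \<Rightarrow> bool" where
  "trace_bound b K \<longleftrightarrow> (\<forall>(I::'h set) f g. contractive I f g \<longrightarrow>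
     cmod (\<Sum>i\<in>I. cinner (g i) (b \<cdot> (f i))) \<le> K)"

lemma trace_boundD:
  fixes I :: "'h::complex_hilbert set" and b :: "'h \<Rightarrow>\<^sub>L 'h"
  shows "trace_bound b K \<Longrightarrow> contractive I f g \<Longrightarrow> cmod (\<Sum>i\<in>I. cinner (g i) (b \<cdot> (f i))) \<le> K"
  by (simp add: trace_bound_def)

lemma trace_bound_nonneg: "trace_bound b K \<Longrightarrow> 0 \<le> K"
  using trace_boundD[of b K "{}"] by (simp add: contractive_def)

lemma trace_bound_scaled:
  fixes I :: "'h::complex_hilbert set" and b :: "'h \<Rightarrow>\<^sub>L 'h"
  assumes b: "trace_bound b K" and I: "finite I" and M: "0 \<le> M"
    and c: "\<And>\<xi>. norm (\<Sum>i\<in>I. cinner (g i) \<xi> *\<^sub>C f i) \<le> M * norm \<xi>"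
  shows "cmod (\<Sum>i\<in>I. cinner (g i) (b \<cdot> (f i))) \<le> M * K"
proof -
  let ?S = "\<Sum>i\<in>I. cinner (g i) (b \<cdot> (f i))"
  have *: "t * cmod ?S \<le> K" if t: "0 \<le> t" "t * M \<le> 1" for t
  proof -
    have "contractive I f (\<lambda>i. t *\<^sub>R g i)"
      unfolding contractive_def
    proof (intro conjI I allI)
      fix \<xi>
      have "(\<Sum>i\<in>I. cinner (t *\<^sub>R g i) \<xi> *\<^sub>C f i) = t *\<^sub>R (\<Sum>i\<in>I. cinner (g i) \<xi> *\<^sub>C f i)"
        by (simp add: scaleR_scaleC scaleC_scaleC cinner_scaleC_left cv.scale_sum_right)
      then have "norm (\<Sum>i\<in>I. cinner (t *\<^sub>R g i) \<xi> *\<^sub>C f i) \<le> t * (M * norm \<xi>)"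
        using c[of \<xi>] t by (simp add: mult_left_mono)
      also have "\<dots> \<le> 1 * norm \<xi>"
        unfolding mult.assoc[symmetric] using t by (intro mult_right_mono) auto
      finally show "norm (\<Sum>i\<in>I. cinner (t *\<^sub>R g i) \<xi> *\<^sub>C f i) \<le> norm \<xi>" by simp
    qed
    from trace_boundD[OF b this] have "cmod (of_real t * ?S) \<le> K"
      by (simp add: sum_distrib_left)
    then show ?thesis using t by (simp add: norm_mult)
  qed
  show ?thesis
  proof (cases "M = 0")
    case True
    have "cmod ?S = 0"
    proof (rule ccontr)
      assume "cmod ?S \<noteq> 0"
      then show False
        using *[of "(K + 1) / cmod ?S"] True trace_bound_nonneg[OF b] by simp
    qed
    then show ?thesis using True by simp
  next
    case False
    then show ?thesis using *[of "1 / M"] M by (simp add: field_simps)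
  qed
qed

lemma contractive_swap:
  assumes "contractive I f g"
  shows "contractive I g f"
  unfolding contractive_def
proof (intro conjI allI)
  show "finite I" using assms by (simp add: contractive_def)
  fix \<xi>
  show "norm (\<Sum>i\<in>I. cinner (f i) \<xi> *\<^sub>C g i) \<le> norm \<xi>"
  proof (rule norm_le_if_cinner_le)
    fix \<eta>
    have "cinner \<eta> (\<Sum>i\<in>I. cinner (f i) \<xi> *\<^sub>C g i) = cinner (\<Sum>i\<in>I. cinner (g i) \<eta> *\<^sub>C f i) \<xi>"
      unfolding cinner_sum_left cinner_sum_right cinner_scaleC_left cinner_scaleC_right
      by (intro sum.cong HOL.refl) (simp add: mult.commute cinner_commute[of \<eta>])
    also have "cmod \<dots> \<le> norm (\<Sum>i\<in>I. cinner (g i) \<eta> *\<^sub>C f i) * norm \<xi>" by (rule norm_cinner_le)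
    also have "\<dots> \<le> norm \<eta> * norm \<xi>"
      using assms by (intro mult_right_mono) (auto simp: contractive_def)
    finally show "cmod (cinner \<eta> (\<Sum>i\<in>I. cinner (f i) \<xi> *\<^sub>C g i)) \<le> norm \<xi> * norm \<eta>"
      by (simp add: mult.commute)
  qed simp
qed

lemma trace_bound_add:
  fixes b :: "'h::complex_hilbert \<Rightarrow>\<^sub>L 'h"
  assumes "trace_bound b K" "trace_bound b' K'"
  shows "trace_bound (b + b') (K + K')"
  unfolding trace_bound_def
proof (intro allI impI)
  fix I :: "'h set" and f g :: "'h \<Rightarrow> 'h" assume c: "contractive I f g"
  have "(\<Sum>i\<in>I. cinner (g i) ((b + b') \<cdot> (f i)))
      = (\<Sum>i\<in>I. cinner (g i) (b \<cdot> (f i))) + (\<Sum>i\<in>I. cinner (g i) (b' \<cdot> (f i)))"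
    by (simp add: plus_blinfun.rep_eq cinner_add_right sum.distrib)
  then show "cmod (\<Sum>i\<in>I. cinner (g i) ((b + b') \<cdot> (f i))) \<le> K + K'"
    using assms[THEN trace_boundD, OF c] norm_triangle_ineq order_trans add_mono by (smt (verit))
qed

lemma trace_bound_scaleC:
  fixes b :: "'h::complex_hilbert \<Rightarrow>\<^sub>L 'h"
  assumes "trace_bound b K"
  shows "trace_bound (c *\<^sub>C b) (cmod c * K)"
  unfolding trace_bound_def
proof (intro allI impI)
  fix I :: "'h set" and f g :: "'h \<Rightarrow> 'h" assume "contractive I f g"
  from trace_boundD[OF assms this] show "cmod (\<Sum>i\<in>I. cinner (g i) ((c *\<^sub>C b) \<cdot> (f i))) \<le> cmod c * K"
    by (simp add: cinner_scaleC_right norm_mult mult_left_mono flip: sum_distrib_left)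
qed

lemma trace_bound_norm_le:
  assumes b: "trace_bound (b::'h::complex_hilbert \<Rightarrow>\<^sub>L 'h) K"
  shows "norm b \<le> K"
proof (rule norm_blinfun_bound[OF trace_bound_nonneg[OF b]])
  fix \<xi>
  let ?g = "b \<cdot> \<xi>"
  have "cmod (\<Sum>i\<in>{0::'h}. cinner ?g (b \<cdot> \<xi>)) \<le> (norm ?g * norm \<xi>) * K"
  proof (rule trace_bound_scaled[OF b])
    fix \<zeta>
    have "cmod (cinner ?g \<zeta>) * norm \<xi> \<le> norm ?g * norm \<zeta> * norm \<xi>"
      by (intro mult_right_mono norm_cinner_le) simp
    then show "norm (\<Sum>i\<in>{0::'h}. cinner ?g \<zeta> *\<^sub>C \<xi>) \<le> norm ?g * norm \<xi> * norm \<zeta>"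
      by (simp add: norm_scaleC mult_ac)
  qed simp_all
  then have "norm ?g * norm ?g \<le> norm ?g * (K * norm \<xi>)"
    by (simp add: cinner_self power2_eq_square norm_mult mult_ac)
  then show "norm ?g \<le> K * norm \<xi>"
    using trace_bound_nonneg[OF b] by (cases "norm ?g = 0") auto
qed

context hilbert_basis
begin

lemma trace_bound_compose_left:
  assumes b: "trace_bound (b::'h \<Rightarrow>\<^sub>L 'h) K" and x: "x \<in> bounded_ops"
  shows "trace_bound (x o\<^sub>L b) (norm x * K)"
  unfolding trace_bound_def
proof (intro allI impI)
  fix I :: "'h set" and f g :: "'h \<Rightarrow> 'h" assume c: "contractive I f g"
  have "norm (\<Sum>i\<in>I. cinner (op_adjoint x \<cdot> (g i)) \<xi> *\<^sub>C f i) \<le> norm x * norm \<xi>" for \<xi>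
  proof -
    have "norm (\<Sum>i\<in>I. cinner (op_adjoint x \<cdot> (g i)) \<xi> *\<^sub>C f i) \<le> norm (x \<cdot> \<xi>)"
      using c by (simp add: contractive_def cinner_adjoint_left[OF x])
    also have "\<dots> \<le> norm x * norm \<xi>" by (rule norm_blinfun)
    finally show ?thesis .
  qed
  from trace_bound_scaled[OF b _ _ this] c
  show "cmod (\<Sum>i\<in>I. cinner (g i) ((x o\<^sub>L b) \<cdot> (f i))) \<le> norm x * K"
    by (simp add: contractive_def cinner_adjoint_left[OF x])
qed

lemma trace_bound_adjoint:
  assumes b: "trace_bound (b::'h \<Rightarrow>\<^sub>L 'h) K" and bo: "b \<in> bounded_ops"
  shows "trace_bound (op_adjoint b) K"
  unfolding trace_bound_def
proof (intro allI impI)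
  fix I :: "'h set" and f g :: "'h \<Rightarrow> 'h" assume "contractive I f g"
  from trace_boundD[OF b contractive_swap[OF this]]
  have "cmod (cnj (\<Sum>i\<in>I. cinner (f i) (b \<cdot> (g i)))) \<le> K" by (simp only: complex_mod_cnj)
  also have "cnj (\<Sum>i\<in>I. cinner (f i) (b \<cdot> (g i))) = (\<Sum>i\<in>I. cinner (g i) (op_adjoint b \<cdot> (f i)))"
    unfolding cinner_adjoint_right[OF bo] cnj_sum by (intro sum.cong HOL.refl) (rule cinner_commute[symmetric])
  finally show "cmod (\<Sum>i\<in>I. cinner (g i) (op_adjoint b \<cdot> (f i))) \<le> K" .
qed

lemma trace_bound_transpose:
  assumes b: "trace_bound b K" and bo: "b \<in> bounded_ops"
  shows "trace_bound (transpose_op B b) K"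
  unfolding trace_bound_def
proof (intro allI impI)
  fix I :: "'h set" and f g :: "'h \<Rightarrow> 'h" assume c: "contractive I f g"
  have "contractive I (\<lambda>i. conj_vec (g i)) (\<lambda>i. conj_vec (f i))"
    unfolding contractive_def
  proof (intro conjI allI)
    show "finite I" using c by (simp add: contractive_def)
    fix \<xi>
    have "(\<Sum>i\<in>I. cinner (conj_vec (f i)) \<xi> *\<^sub>C conj_vec (g i))
        = conj_vec (\<Sum>i\<in>I. cinner (f i) (conj_vec \<xi>) *\<^sub>C g i)"
      unfolding conj_vec_sum conj_vec_scaleC cinner_conj_left[of _ \<xi>]
      by (intro sum.cong HOL.refl arg_cong2[where f = scaleC]) (rule cinner_commute)
    then show "norm (\<Sum>i\<in>I. cinner (conj_vec (f i)) \<xi> *\<^sub>C conj_vec (g i)) \<le> norm \<xi>"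
      using contractive_swap[OF c] norm_conj_vec[of \<xi>] unfolding contractive_def
      by (metis norm_conj_vec)
  qed
  from trace_boundD[OF b this]
  show "cmod (\<Sum>i\<in>I. cinner (g i) (transpose_op B b \<cdot> (f i))) \<le> K"
    unfolding transpose_op_apply[OF bo] cinner_conj_right[of "g _"] cinner_adjoint_left[OF bo] .
qed

lemma trace_bound_basis_sum:
  assumes b: "trace_bound b K" and F: "finite F" "F \<subseteq> B"
  shows "(\<Sum>e\<in>F. cmod (cinner e (b \<cdot> e))) \<le> K"
proof -
  define u where "u = (\<lambda>e. sgn (cinner e (b \<cdot> e)))"
  have u: "cnj (u e) * cinner e (b \<cdot> e) = of_real (cmod (cinner e (b \<cdot> e)))" for e
  proof (cases "cinner e (b \<cdot> e) = 0")
    case False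
    let ?z = "cinner e (b \<cdot> e)"
    have "cnj ?z * ?z = of_real (cmod ?z) * of_real (cmod ?z)"
      using complex_norm_square[of ?z] by (simp add: mult.commute power2_eq_square)
    then show ?thesis using False
      by (simp add: u_def sgn_eq)
  qed (simp add: u_def)
  have "contractive F (\<lambda>e. e) (\<lambda>e. u e *\<^sub>C e)"
    unfolding contractive_def
  proof (intro conjI F allI)
    fix \<xi>
    have "(norm (\<Sum>e\<in>F. cinner (u e *\<^sub>C e) \<xi> *\<^sub>C e))\<^sup>2 = (\<Sum>e\<in>F. (cmod (u e))\<^sup>2 * (cmod (cinner e \<xi>))\<^sup>2)"
      unfolding norm_sq_basis_sum[OF F] by (simp add: cinner_scaleC_left norm_mult power_mult_distrib)
    also have "\<dots> \<le> (\<Sum>e\<in>F. 1 * (cmod (cinner e \<xi>))\<^sup>2)"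
      by (intro sum_mono mult_right_mono) (auto simp: u_def norm_sgn)
    also have "\<dots> \<le> (norm \<xi>)\<^sup>2" using bessel[OF F] by simp
    finally show "norm (\<Sum>e\<in>F. cinner (u e *\<^sub>C e) \<xi> *\<^sub>C e) \<le> norm \<xi>"
      by (rule power2_le_imp_le) simp
  qed
  from trace_boundD[OF b this] have "cmod (\<Sum>e\<in>F. of_real (cmod (cinner e (b \<cdot> e)))) \<le> K"
    by (simp add: cinner_scaleC_left u)
  then have "cmod (of_real (\<Sum>e\<in>F. cmod (cinner e (b \<cdot> e)))) \<le> K" by simp
  then show ?thesis unfolding norm_of_real by linarith
qed

lemma norm_adjoint_contraction:
  fixes v :: "'h \<Rightarrow>\<^sub>L 'h"
  assumes v: "v \<in> bounded_ops" "\<And>\<xi>. norm (v \<cdot> \<xi>) \<le> norm \<xi>"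
  shows "norm (op_adjoint v \<cdot> \<xi>) \<le> norm \<xi>"
proof (rule norm_le_if_cinner_le)
  fix \<eta>
  have "cmod (cinner \<eta> (op_adjoint v \<cdot> \<xi>)) \<le> norm (v \<cdot> \<eta>) * norm \<xi>"
    unfolding cinner_adjoint_right[OF v(1)] by (rule norm_cinner_le)
  also have "\<dots> \<le> norm \<xi> * norm \<eta>"
    unfolding mult.commute[of "norm \<xi>"] by (intro mult_right_mono v) simp
  finally show "cmod (cinner \<eta> (op_adjoint v \<cdot> \<xi>)) \<le> norm \<xi> * norm \<eta>" .
qed simp

text \<open>A contraction $v$ with $v^* b$ close to $|b|$ turns $\sum_{e \in F} \langle e, |b| e\rangle$ into
  $\sum_{e \in F} \langle v e, b e\rangle$ up to a small error, and the families $e$ and $v e$ are contractive.\<close>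

lemma trace_class_if_trace_bound:
  assumes bo: "b \<in> bounded_ops" and b: "trace_bound b K"
  shows "b \<in> trace_class B" "trace_norm B b \<le> K"
proof -
  define t where "t = (\<lambda>e. Re (cinner e (op_abs b \<cdot> e)))"
  have t: "cinner e (op_abs b \<cdot> e) = of_real (t e)" for e
    using positive_opD(3)[OF op_abs_positive[OF bo]] by (simp add: t_def complex_eq_iff)
  have t0: "0 \<le> t e" for e
    unfolding t_def by (rule positive_opD(2)[OF op_abs_positive[OF bo]])
  have fin: "sum t F \<le> K" if F: "finite F" "F \<subseteq> B" for F
  proof (rule field_le_epsilon)
    fix \<epsilon> :: real assume \<epsilon>: "0 < \<epsilon>"
    define d where "d = \<epsilon> / (real (card F) + 1)"
    have d: "0 < d" "real (card F) * d \<le> \<epsilon>" using \<epsilon> by (auto simp: d_def field_simps)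
    obtain v where v: "v \<in> bounded_ops" "\<And>\<xi>. norm (v \<cdot> \<xi>) \<le> norm \<xi>"
      and vb: "\<And>\<xi>. norm (op_adjoint v \<cdot> (b \<cdot> \<xi>) - op_abs b \<cdot> \<xi>) \<le> d * norm \<xi>"
      using approximate_polar[OF bo d(1)] by metis
    have "t e \<le> Re (cinner (v \<cdot> e) (b \<cdot> e)) + d" if "e \<in> F" for e
    proof -
      let ?w = "op_adjoint v \<cdot> (b \<cdot> e)"
      have n: "norm e = 1"
        using cinner_basis[of e e] that F(2) norm_sq_cinner[of e] by (auto simp: subset_iff power2_eq_1_iff)
          (use norm_ge_zero[of e] in linarith)
      have "t e = Re (cinner e ?w) - Re (cinner e (?w - op_abs b \<cdot> e))"
        by (simp add: t_def cinner_diff_right)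
      also have "\<dots> \<le> Re (cinner e ?w) + cmod (cinner e (?w - op_abs b \<cdot> e))"
        using abs_Re_le_cmod[of "cinner e (?w - op_abs b \<cdot> e)"] by linarith
      also have "\<dots> \<le> Re (cinner e ?w) + norm e * norm (?w - op_abs b \<cdot> e)"
        using norm_cinner_le by simp
      also have "\<dots> \<le> Re (cinner e ?w) + d" using vb[of e] n by simp
      finally show ?thesis by (simp add: cinner_adjoint_right[OF v(1)])
    qed
    then have "sum t F \<le> (\<Sum>e\<in>F. Re (cinner (v \<cdot> e) (b \<cdot> e)) + d)"
      by (rule sum_mono)
    also have "\<dots> = Re (\<Sum>e\<in>F. cinner (v \<cdot> e) (b \<cdot> e)) + real (card F) * d"
      by (simp add: sum.distrib)
    also have "\<dots> \<le> K + \<epsilon>"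
    proof (intro add_mono d)
      have "contractive F (\<lambda>e. e) (\<lambda>e. v \<cdot> e)"
        unfolding contractive_def
      proof (intro conjI F allI)
        fix \<xi>
        have "(norm (\<Sum>e\<in>F. cinner (v \<cdot> e) \<xi> *\<^sub>C e))\<^sup>2
            = (\<Sum>e\<in>F. (cmod (cinner e (op_adjoint v \<cdot> \<xi>)))\<^sup>2)"
          unfolding norm_sq_basis_sum[OF F] by (simp add: cinner_adjoint_right[OF v(1)])
        also have "\<dots> \<le> (norm (op_adjoint v \<cdot> \<xi>))\<^sup>2" by (rule bessel[OF F])
        also have "\<dots> \<le> (norm \<xi>)\<^sup>2" by (intro power_mono norm_adjoint_contraction v) simp
        finally show "norm (\<Sum>e\<in>F. cinner (v \<cdot> e) \<xi> *\<^sub>C e) \<le> norm \<xi>"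
          by (rule power2_le_imp_le) simp
      qed
      from trace_boundD[OF b this]
      show "Re (\<Sum>e\<in>F. cinner (v \<cdot> e) (b \<cdot> e)) \<le> K"
        using complex_Re_le_cmod order_trans by blast
    qed
    finally show "sum t F \<le> K + \<epsilon>" .
  qed
  have s: "t summable_on B" using t0 fin by (intro summable_on_if_finite_sums_le) auto
  then have "(\<lambda>e. complex_of_real (t e)) summable_on B" by (rule summable_on_of_real)
  then show "b \<in> trace_class B" by (simp add: trace_class_def bo t)
  have "((\<lambda>e. complex_of_real (t e)) has_sum of_real (infsum t B)) B"
    using has_sum_bounded_linear[OF bounded_linear_of_real has_sum_infsum[OF s]] .
  then have "trace_norm B b = infsum t B" by (simp add: trace_norm_def trace_op_def t infsumI)
  then show "trace_norm B b \<le> K" using infsum_le_finite_sums[OF s fin] by simp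
qed

text \<open>Write $|b| = s^2$ and replace $b$ by $v s^2$ with a contraction $v$.  Expanding each
  $\langle s v^* g_i, s f_i\rangle$ in the basis and summing over $i$ first, the basis vector $e$
  contributes at most $\|s e\|^2$, and these numbers add up to the trace norm.\<close>

lemma trace_bound_trace_norm:
  assumes b: "b \<in> trace_class B"
  shows "trace_bound b (trace_norm B b)"
  unfolding trace_bound_def
proof (intro allI impI)
  have bo: "b \<in> bounded_ops" using b by (simp add: trace_class_def)
  obtain s where s: "positive_op s" "s o\<^sub>L s = op_abs b"
    using positive_sqrt_exists[OF op_abs_positive[OF bo]] by metis
  have ss: "op_abs b \<cdot> \<xi> = s \<cdot> (s \<cdot> \<xi>)" for \<xi>
    unfolding s(2)[symmetric] by simp
  note sh = positive_op_hermitian[OF s(1)]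
  have N: "((\<lambda>e. (norm (s \<cdot> e))\<^sup>2) has_sum trace_norm B b) B"
  proof -
    have "((\<lambda>e. Re (cinner e (op_abs b \<cdot> e))) has_sum trace_norm B b) B"
      using b unfolding trace_norm_def trace_op_def
      by (intro has_sum_Re has_sum_infsum) (simp add: trace_class_def)
    then show ?thesis by (simp add: ss sh norm_sq_cinner)
  qed
  fix I :: "'h set" and f g :: "'h \<Rightarrow> 'h" assume c: "contractive I f g"
  then have I: "finite I" by (simp add: contractive_def)
  define C where "C = (\<Sum>i\<in>I. norm (g i) * norm (f i))"
  have C: "0 \<le> C" unfolding C_def by (intro sum_nonneg) simp
  show "cmod (\<Sum>i\<in>I. cinner (g i) (b \<cdot> (f i))) \<le> trace_norm B b"
  proof (rule field_le_epsilon)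
    fix \<epsilon> :: real assume \<epsilon>: "0 < \<epsilon>"
    define d where "d = \<epsilon> / (C + 1)"
    have d: "0 < d" "d * C \<le> \<epsilon>" using \<epsilon> C by (auto simp: d_def field_simps)
    obtain v where v: "v \<in> bounded_ops" "\<And>\<xi>. norm (v \<cdot> \<xi>) \<le> norm \<xi>"
      and vb: "\<And>\<xi>. norm (v \<cdot> (op_abs b \<cdot> \<xi>) - b \<cdot> \<xi>) \<le> d * norm \<xi>"
      using approximate_polar[OF bo d(1)] by metis
    let ?S = "\<Sum>i\<in>I. cinner (g i) (v \<cdot> (op_abs b \<cdot> (f i)))"
    have "cmod (?S - (\<Sum>i\<in>I. cinner (g i) (b \<cdot> (f i))))
        = cmod (\<Sum>i\<in>I. cinner (g i) (v \<cdot> (op_abs b \<cdot> (f i)) - b \<cdot> (f i)))"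
      by (simp add: sum_subtractf cinner_diff_right)
    also have "\<dots> \<le> (\<Sum>i\<in>I. d * (norm (g i) * norm (f i)))"
    proof (rule sum_norm_le)
      fix i
      have "cmod (cinner (g i) (v \<cdot> (op_abs b \<cdot> (f i)) - b \<cdot> (f i)))
          \<le> norm (g i) * norm (v \<cdot> (op_abs b \<cdot> (f i)) - b \<cdot> (f i))"
        by (rule norm_cinner_le)
      also have "\<dots> \<le> norm (g i) * (d * norm (f i))" by (intro mult_left_mono vb) simp
      finally show "cmod (cinner (g i) (v \<cdot> (op_abs b \<cdot> (f i)) - b \<cdot> (f i)))
          \<le> d * (norm (g i) * norm (f i))" by (simp add: mult_ac)
    qed
    also have "\<dots> \<le> \<epsilon>" using d(2) by (simp add: C_def sum_distrib_left)
    finally have diff: "cmod (?S - (\<Sum>i\<in>I. cinner (g i) (b \<cdot> (f i)))) \<le> \<epsilon>" .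
    have "((\<lambda>e. \<Sum>i\<in>I. cinner (s \<cdot> (op_adjoint v \<cdot> (g i))) e * cinner e (s \<cdot> (f i)))
        has_sum (\<Sum>i\<in>I. cinner (s \<cdot> (op_adjoint v \<cdot> (g i))) (s \<cdot> (f i)))) B"
      by (intro has_sum_finite_sum I parseval)
    also have "(\<Sum>i\<in>I. cinner (s \<cdot> (op_adjoint v \<cdot> (g i))) (s \<cdot> (f i))) = ?S"
      by (simp add: ss cinner_adjoint_left[OF v(1)] flip: sh)
    finally have "cmod ?S \<le> trace_norm B b"
    proof (rule norm_infsum_le[OF _ N])
      fix e
      let ?\<zeta> = "v \<cdot> (s \<cdot> e)"
      have "(\<Sum>i\<in>I. cinner (s \<cdot> (op_adjoint v \<cdot> (g i))) e * cinner e (s \<cdot> (f i)))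
          = cinner (s \<cdot> e) (\<Sum>i\<in>I. cinner (g i) ?\<zeta> *\<^sub>C f i)"
        by (simp add: cinner_sum_right cinner_scaleC_right cinner_adjoint_left[OF v(1)] flip: sh)
      also have "cmod \<dots> \<le> norm (s \<cdot> e) * norm (\<Sum>i\<in>I. cinner (g i) ?\<zeta> *\<^sub>C f i)"
        by (rule norm_cinner_le)
      also have "\<dots> \<le> norm (s \<cdot> e) * norm (s \<cdot> e)"
        using c v(2)[of "s \<cdot> e"] unfolding contractive_def
        by (intro mult_left_mono) (auto intro: order_trans)
      finally show "cmod (\<Sum>i\<in>I. cinner (s \<cdot> (op_adjoint v \<cdot> (g i))) e * cinner e (s \<cdot> (f i)))
          \<le> (norm (s \<cdot> e))\<^sup>2" by (simp add: power2_eq_square)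
    qed
    moreover have "cmod (\<Sum>i\<in>I. cinner (g i) (b \<cdot> (f i))) - cmod ?S
        \<le> cmod (?S - (\<Sum>i\<in>I. cinner (g i) (b \<cdot> (f i))))"
      unfolding norm_minus_commute[of ?S] by (rule norm_triangle_ineq2)
    ultimately show "cmod (\<Sum>i\<in>I. cinner (g i) (b \<cdot> (f i))) \<le> trace_norm B b + \<epsilon>"
      using diff by linarith
  qed
qed

lemma trace_class_bounded: "b \<in> trace_class B \<Longrightarrow> b \<in> bounded_ops"
  by (simp add: trace_class_def)

lemma trace_norm_nonneg: "b \<in> trace_class B \<Longrightarrow> 0 \<le> trace_norm B b"
  by (rule trace_bound_nonneg[OF trace_bound_trace_norm])

lemma norm_le_trace_norm: "b \<in> trace_class B \<Longrightarrow> norm b \<le> trace_norm B b"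
  by (rule trace_bound_norm_le[OF trace_bound_trace_norm])

lemma trace_class_add:
  assumes "b \<in> trace_class B" "b' \<in> trace_class B"
  shows "b + b' \<in> trace_class B"
  by (rule trace_class_if_trace_bound(1)[OF bounded_ops_add trace_bound_add[OF assms[THEN trace_bound_trace_norm]]])
    (simp_all add: assms trace_class_bounded)

lemma trace_class_scaleC:
  assumes "b \<in> trace_class B"
  shows "c *\<^sub>C b \<in> trace_class B"
  by (rule trace_class_if_trace_bound(1)[OF bounded_ops_scaleC trace_bound_scaleC[OF assms[THEN trace_bound_trace_norm]]])
    (simp add: assms trace_class_bounded)

lemma trace_class_compose:
  assumes "b \<in> trace_class B" "b' \<in> trace_class B"
  shows "b o\<^sub>L b' \<in> trace_class B" "trace_norm B (b o\<^sub>L b') \<le> trace_norm B b * trace_norm B b'"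
proof -
  note tb = trace_bound_compose_left[OF trace_bound_trace_norm[OF assms(2)] trace_class_bounded[OF assms(1)]]
  note bo = bounded_ops_compose[OF assms[THEN trace_class_bounded]]
  show "b o\<^sub>L b' \<in> trace_class B" by (rule trace_class_if_trace_bound[OF bo tb])
  have "trace_norm B (b o\<^sub>L b') \<le> norm b * trace_norm B b'" by (rule trace_class_if_trace_bound[OF bo tb])
  also have "\<dots> \<le> trace_norm B b * trace_norm B b'"
    by (intro mult_right_mono norm_le_trace_norm trace_norm_nonneg assms)
  finally show "trace_norm B (b o\<^sub>L b') \<le> trace_norm B b * trace_norm B b'" .
qed

lemma trace_class_adjoint:
  assumes "b \<in> trace_class B"
  shows "op_adjoint b \<in> trace_class B" "trace_norm B (op_adjoint b) \<le> trace_norm B b"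
  using trace_class_if_trace_bound[OF op_adjoint_bounded trace_bound_adjoint[OF trace_bound_trace_norm]]
    assms trace_class_bounded by blast+

lemma trace_op_summable:
  assumes "trace_bound b K"
  shows "(\<lambda>e. cmod (cinner e (b \<cdot> e))) summable_on B"
  using trace_bound_basis_sum[OF assms] by (intro summable_on_if_finite_sums_le) auto

lemma norm_trace_op_le:
  assumes "trace_bound b K"
  shows "cmod (trace_op B b) \<le> K"
  unfolding trace_op_def
  using norm_infsum_bound[OF trace_op_summable[OF assms]]
    infsum_le_finite_sums[OF trace_op_summable[OF assms] trace_bound_basis_sum[OF assms]] by linarith

text \<open>The value of \<open>tilde B T\<close> at $a \otimes b$ is \<open>trace_pair (T a) b\<close>.\<close>

definition trace_pair :: "('h \<Rightarrow>\<^sub>L 'h) \<Rightarrow> ('h \<Rightarrow>\<^sub>L 'h) \<Rightarrow> complex" where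
  "trace_pair x b = trace_op B (x o\<^sub>L transpose_op B b)"

lemma trace_bound_pair:
  assumes "x \<in> bounded_ops" "b \<in> trace_class B"
  shows "trace_bound (x o\<^sub>L transpose_op B b) (norm x * trace_norm B b)"
  by (intro trace_bound_compose_left trace_bound_transpose trace_bound_trace_norm assms trace_class_bounded)

lemma norm_trace_pair_le:
  assumes "x \<in> bounded_ops" "b \<in> trace_class B"
  shows "cmod (trace_pair x b) \<le> norm x * trace_norm B b"
  unfolding trace_pair_def by (rule norm_trace_op_le[OF trace_bound_pair[OF assms]])

lemma trace_pair_has_sum:
  assumes "x \<in> bounded_ops" "b \<in> trace_class B"
  shows "((\<lambda>e. cinner e (x \<cdot> (transpose_op B b \<cdot> e))) has_sum trace_pair x b) B"
  using has_sum_infsum[OF abs_summable_summable[OF trace_op_summable[OF trace_bound_pair[OF assms]]]]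
  by (simp add: trace_pair_def trace_op_def)

lemma trace_pair_add_left:
  assumes "x \<in> bounded_ops" "y \<in> bounded_ops" "b \<in> trace_class B"
  shows "trace_pair (x + y) b = trace_pair x b + trace_pair y b"
  using trace_pair_has_sum[OF bounded_ops_add[OF assms(1,2)] assms(3)]
    has_sum_add[OF trace_pair_has_sum[OF assms(1,3)] trace_pair_has_sum[OF assms(2,3)]]
  by (simp add: plus_blinfun.rep_eq cinner_add_right has_sum_unique)

lemma trace_pair_add_right:
  assumes "x \<in> bounded_ops" "b \<in> trace_class B" "b' \<in> trace_class B"
  shows "trace_pair x (b + b') = trace_pair x b + trace_pair x b'"
  using trace_pair_has_sum[OF assms(1) trace_class_add[OF assms(2,3)]]
    has_sum_add[OF trace_pair_has_sum[OF assms(1,2)] trace_pair_has_sum[OF assms(1,3)]] assms(2,3)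
  by (simp add: transpose_op_add trace_class_bounded plus_blinfun.rep_eq blinfun.add_right cinner_add_right has_sum_unique)

lemma trace_pair_scale:
  assumes "x \<in> bounded_ops" "b \<in> trace_class B"
  shows "trace_pair (c *\<^sub>C x) b = trace_pair x (c *\<^sub>C b)"
  using trace_pair_has_sum[OF assms(1) trace_class_scaleC[OF assms(2), of c]]
    trace_pair_has_sum[OF bounded_ops_scaleC[OF assms(1), of c] assms(2)] assms
  by (simp add: transpose_op_scaleC trace_class_bounded clinear_scaleC[OF bounded_opsD] has_sum_unique)

text \<open>The matrix coefficients of a Hilbert--Schmidt operator are square summable over all pairs of
  basis vectors; this is what allows to interchange the two summations below.\<close>

lemma hilbert_schmidt_summable:
  assumes b: "trace_bound b K" and bo: "b \<in> bounded_ops"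
  shows "(\<lambda>(g, e). (cmod (cinner e (b \<cdot> g)))\<^sup>2) summable_on B \<times> B"
proof (rule summable_on_SigmaI)
  show "((\<lambda>e. case (g, e) of (g, e) \<Rightarrow> (cmod (cinner e (b \<cdot> g)))\<^sup>2) has_sum (norm (b \<cdot> g))\<^sup>2) B" for g
    using parseval_norm by simp
  note tb = trace_bound_compose_left[OF b op_adjoint_bounded[OF bo]]
  have "(norm (b \<cdot> g))\<^sup>2 = cmod (cinner g ((op_adjoint b o\<^sub>L b) \<cdot> g))" for g
    by (simp add: cinner_adjoint_right[OF bo] cinner_self norm_power)
  then show "(\<lambda>g. (norm (b \<cdot> g))\<^sup>2) summable_on B"
    using trace_op_summable[OF tb] by simp
qed auto

text \<open>Cyclicity of the trace, $\mathrm{Tr}(x c d^*) = \mathrm{Tr}(d^* x c)$, with the right-hand side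
  written out in the basis.\<close>

lemma trace_sandwich:
  assumes x: "x \<in> bounded_ops" and c: "c \<in> bounded_ops" "trace_bound c K"
    and d: "d \<in> bounded_ops" "trace_bound d L"
  shows "((\<lambda>g. cinner (d \<cdot> g) (x \<cdot> (c \<cdot> g)))
    has_sum trace_op B (x o\<^sub>L c o\<^sub>L op_adjoint d)) B"
proof -
  let ?y = "x o\<^sub>L c"
  have y: "?y \<in> bounded_ops" by (rule bounded_ops_compose[OF x c(1)])
  define \<phi> where "\<phi> = (\<lambda>g e. cinner (d \<cdot> g) e * cinner e (?y \<cdot> g))"
  have summ: "(\<lambda>(g, e). \<phi> g e) summable_on B \<times> B"
  proof (rule abs_summable_summable, rule summable_on_comparison_test)
    show "(\<lambda>p. (\<lambda>(g, e). (cmod (cinner e (d \<cdot> g)))\<^sup>2) p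
          + (\<lambda>(g, e). (cmod (cinner e (?y \<cdot> g)))\<^sup>2) p) summable_on B \<times> B"
      by (intro summable_on_add hilbert_schmidt_summable[OF d(2,1)]
          hilbert_schmidt_summable[OF trace_bound_compose_left[OF c(2) x] y])
    fix p :: "'h \<times> 'h"
    obtain g e where p: "p = (g, e)" by fastforce
    have "cmod (\<phi> g e) = cmod (cinner e (d \<cdot> g)) * cmod (cinner e (?y \<cdot> g))"
      unfolding \<phi>_def norm_mult cinner_commute[of "d \<cdot> g"] by simp
    also have "\<dots> \<le> (cmod (cinner e (d \<cdot> g)))\<^sup>2 + (cmod (cinner e (?y \<cdot> g)))\<^sup>2"
    proof -
      have "a * b \<le> a\<^sup>2 + b\<^sup>2" if "0 \<le> a" "0 \<le> b" for a b :: real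
        using sum_squares_bound[of a b] mult_nonneg_nonneg[OF that] by linarith
      then show ?thesis by simp
    qed
    finally show "norm (case p of (g, e) \<Rightarrow> \<phi> g e)
        \<le> (\<lambda>(g, e). (cmod (cinner e (d \<cdot> g)))\<^sup>2) p
          + (\<lambda>(g, e). (cmod (cinner e (?y \<cdot> g)))\<^sup>2) p"
      by (simp add: p)
  qed simp
  have inner: "infsum (\<phi> g) B = cinner (d \<cdot> g) (?y \<cdot> g)" for g
    unfolding \<phi>_def by (rule infsumI[OF parseval])
  have outer: "infsum (\<lambda>g. \<phi> g e) B = cinner e ((?y o\<^sub>L op_adjoint d) \<cdot> e)" for e
  proof (rule infsumI)
    have "((\<lambda>g. cinner e (cinner g (op_adjoint d \<cdot> e) *\<^sub>C ?y \<cdot> g))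
        has_sum cinner e (?y \<cdot> (op_adjoint d \<cdot> e))) B"
      by (rule has_sum_bounded_linear[OF bounded_linear_cinner_right op_expansion[OF y]])
    then show "((\<lambda>g. \<phi> g e) has_sum cinner e ((?y o\<^sub>L op_adjoint d) \<cdot> e)) B"
      by (simp add: \<phi>_def cinner_scaleC_right cinner_adjoint_right[OF d(1)])
  qed
  have "(\<lambda>g. infsum (\<phi> g) B) summable_on B"
    by (rule summable_on_Sigma_banach[OF summ])
  moreover have "infsum (\<lambda>g. infsum (\<phi> g) B) B = trace_op B (?y o\<^sub>L op_adjoint d)"
    unfolding trace_op_def infsum_swap_banach[OF summ] outer ..
  ultimately show ?thesis
    unfolding inner using has_sum_infsum by fastforce
qed

text \<open>The identity that links the two notions of positivity: $(b^* b')^t$ factors as $b'^t (b^t)^*$, and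
  cyclicity moves $(b^t)^*$ to the other side.\<close>

lemma trace_pair_square:
  assumes x: "x \<in> bounded_ops" and b: "b \<in> trace_class B" "b' \<in> trace_class B"
  shows "((\<lambda>g. cinner (transpose_op B b \<cdot> g) (x \<cdot> (transpose_op B b' \<cdot> g)))
    has_sum trace_pair x (op_adjoint b o\<^sub>L b')) B"
proof -
  note bo = b[THEN trace_class_bounded]
  have "transpose_op B (op_adjoint b o\<^sub>L b') = transpose_op B b' o\<^sub>L op_adjoint (transpose_op B b)"
    by (simp add: transpose_op_compose op_adjoint_bounded bo transpose_op_adjoint)
  then have "x o\<^sub>L transpose_op B (op_adjoint b o\<^sub>L b') = x o\<^sub>L transpose_op B b' o\<^sub>L op_adjoint (transpose_op B b)"
    by (simp add: blinfun_eqI)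
  then show ?thesis
    unfolding trace_pair_def
    using trace_sandwich[OF x transpose_op_bounded[OF bo(2)] trace_bound_transpose[OF trace_bound_trace_norm[OF b(2)] bo(2)]
        transpose_op_bounded[OF bo(1)] trace_bound_transpose[OF trace_bound_trace_norm[OF b(1)] bo(1)]]
    by simp
qed

text \<open>For a fixed basis vector \<open>e\<close> and varying \<open>\<xi>\<close>, these operators isolate a single term in the sum of
  \<open>trace_pair_square\<close>.\<close>

lemma rank_one_transpose_exists:
  assumes e: "e \<in> B"
  obtains b where "b \<in> trace_class B"
    "\<And>\<eta>. transpose_op B b \<cdot> \<eta> = cinner e \<eta> *\<^sub>C \<xi>"
proof -
  let ?f = "\<lambda>\<eta>. cinner (conj_vec \<xi>) \<eta> *\<^sub>C e"
  have n: "norm e = 1"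
    using cinner_basis[OF e e] norm_sq_cinner[of e] norm_ge_zero[of e]
    by (simp add: power2_eq_1_iff)
  have clin: "clinear ?f"
    by (intro clinearI) (simp_all add: cinner_add_right cinner_scaleC_right scaleC_add_left scaleC_scaleC)
  have bd: "norm (?f \<eta>) \<le> norm \<xi> * norm \<eta>" for \<eta>
    using norm_cinner_le[of "conj_vec \<xi>" \<eta>] by (simp add: norm_scaleC n)
  define b where "b = Blinfun ?f"
  have bo: "b \<in> bounded_ops" and ba: "blinfun_apply b = ?f"
    unfolding b_def by (rule bounded_opsI[OF clin bd])+
  have "trace_bound b (norm \<xi>)"
    unfolding trace_bound_def
  proof (intro allI impI)
    fix I :: "'h set" and f g :: "'h \<Rightarrow> 'h" assume c: "contractive I f g"
    have "(\<Sum>i\<in>I. cinner (g i) (b \<cdot> (f i))) = cinner (conj_vec \<xi>) (\<Sum>i\<in>I. cinner (g i) e *\<^sub>C f i)"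
      by (simp add: ba cinner_sum_right cinner_scaleC_right mult.commute)
    also have "cmod \<dots> \<le> norm (conj_vec \<xi>) * norm (\<Sum>i\<in>I. cinner (g i) e *\<^sub>C f i)"
      by (rule norm_cinner_le)
    also have "\<dots> \<le> norm \<xi> * norm e"
      using c unfolding contractive_def norm_conj_vec by (intro mult_left_mono) auto
    finally show "cmod (\<Sum>i\<in>I. cinner (g i) (b \<cdot> (f i))) \<le> norm \<xi>" using n by simp
  qed
  from trace_class_if_trace_bound(1)[OF bo this] show ?thesis
  proof (rule that)
    fix \<eta>
    have "op_adjoint b \<cdot> (conj_vec \<eta>) = cinner e (conj_vec \<eta>) *\<^sub>C conj_vec \<xi>"
    proof (rule cinner_eqI)
      fix \<zeta>
      show "cinner \<zeta> (op_adjoint b \<cdot> (conj_vec \<eta>)) = cinner \<zeta> (cinner e (conj_vec \<eta>) *\<^sub>C conj_vec \<xi>)"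
        unfolding cinner_adjoint_right[OF bo] ba cinner_scaleC_left cinner_scaleC_right
        using cinner_commute[of "conj_vec \<xi>" \<zeta>] by (simp add: mult.commute)
    qed
    then show "transpose_op B b \<cdot> \<eta> = cinner e \<eta> *\<^sub>C \<xi>"
      by (simp add: transpose_op_apply[OF bo] conj_vec_scaleC cinner_basis_conj[OF e])
  qed
qed

end

section \<open>Elementary facts on C*-algebras\<close>

lemma star_0 [simp]: "star (0::'a::cstar_algebra) = 0"
  using star_scaleC[of 0 "0::'a"] by simp

lemma star_minus [simp]: "star (- a) = - star (a::'a::cstar_algebra)"
  using star_scaleC[of "- 1" a] by (simp add: scaleC_one)

lemma star_diff: "star (a - b) = star a - star (b::'a::cstar_algebra)"
  unfolding diff_conv_add_uminus star_add by simp

lemma star_scaleR [simp]: "star (r *\<^sub>R a) = r *\<^sub>R star (a::'a::cstar_algebra)"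
  by (simp add: scaleR_scaleC star_scaleC)

lemma norm_star [simp]: "norm (star a) = norm (a::'a::cstar_algebra)"
proof -
  have *: "norm a \<le> norm (star a)" for a :: 'a
  proof (cases "a = 0")
    case False
    have "norm a * norm a \<le> norm (star a) * norm a"
      using norm_star_mult_self[of a] norm_mult_ineq[of "star a" a] by (simp add: power2_eq_square)
    then show ?thesis using False by simp
  qed simp
  from *[of a] *[of "star a"] show ?thesis by (simp add: star_star)
qed


section \<open>The projective norm\<close>

context hilbert_basis
begin

lemma formal_sums_simps [simp]:
  "[] \<in> formal_sums B"
  "((a, b) # u) \<in> formal_sums B \<longleftrightarrow> b \<in> trace_class B \<and> u \<in> formal_sums B"
  "(u @ v) \<in> formal_sums B \<longleftrightarrow> u \<in> formal_sums B \<and> v \<in> formal_sums B"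
  by (auto simp: formal_sums_def)

lemma tensor_eq_formal_sums:
  "tensor_eq B u v \<Longrightarrow> u \<in> formal_sums B \<and> v \<in> formal_sums B"
  by (induction rule: tensor_eq.induct) (auto intro: trace_class_add trace_class_scaleC)

lemma tensor_eq_mset:
  assumes "u \<in> formal_sums B" "mset u = mset v"
  shows "tensor_eq B u v"
  using assms
proof (induction u arbitrary: v)
  case Nil
  then show ?case by (simp add: tensor_eq.refl)
next
  case (Cons x u)
  obtain a b where x: "x = (a, b)" by fastforce
  have "x \<in> set v" using Cons.prems(2) by (metis list.set_intros(1) set_mset_mset)
  then obtain v1 v2 where v: "v = v1 @ x # v2" by (auto dest: split_list)
  have "mset u = mset (v1 @ v2)" using Cons.prems(2) by (simp add: v)
  then have IH: "tensor_eq B u (v1 @ v2)" using Cons x by simp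
  have b: "b \<in> trace_class B" using Cons.prems(1) by (simp add: x)
  have v12: "v1 \<in> formal_sums B" "v2 \<in> formal_sums B" using tensor_eq_formal_sums[OF IH] by auto
  have "tensor_eq B ([x] @ u) ([x] @ (v1 @ v2))"
    using b by (intro tensor_eq.append IH tensor_eq.refl) (simp add: x)
  also have "tensor_eq B ([x] @ (v1 @ v2)) ((v1 @ [x]) @ v2)"
    unfolding append_assoc[symmetric] using b v12
    by (intro tensor_eq.append tensor_eq.refl tensor_eq.commute) (simp_all add: x)
  finally (tensor_eq.trans) show ?case by (simp add: v)
qed

text \<open>The universal property: a bilinear and balanced \<open>h\<close> induces a map on the algebraic tensor product.\<close>

lemma tensor_eq_bind:
  assumes uv: "tensor_eq B u v"
    and fs: "\<And>a b. b \<in> trace_class B \<Longrightarrow> h (a, b) \<in> formal_sums B"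
    and zero: "\<And>b. b \<in> trace_class B \<Longrightarrow> tensor_eq B (h (0, b)) []"
    and addl: "\<And>a a' b. b \<in> trace_class B \<Longrightarrow> tensor_eq B (h (a + a', b)) (h (a, b) @ h (a', b))"
    and addr: "\<And>a b b'. b \<in> trace_class B \<Longrightarrow> b' \<in> trace_class B \<Longrightarrow>
      tensor_eq B (h (a, b + b')) (h (a, b) @ h (a, b'))"
    and scale: "\<And>c a b. b \<in> trace_class B \<Longrightarrow> tensor_eq B (h (c *\<^sub>C a, b)) (h (a, c *\<^sub>C b))"
  shows "tensor_eq B (concat (map h u)) (concat (map h v))"
proof -
  have FS: "concat (map h w) \<in> formal_sums B" if "w \<in> formal_sums B" for w
    using that by (induction w) (auto simp: fs)
  from uv show ?thesis
  proof (induction rule: tensor_eq.induct)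
    case (refl u) then show ?case by (intro tensor_eq.refl FS)
  next
    case (sym u v) then show ?case by (blast intro: tensor_eq.sym)
  next
    case (trans u v w) then show ?case by (blast intro: tensor_eq.trans)
  next
    case (append u u' v v') then show ?case by (simp add: tensor_eq.append)
  next
    case (commute u v) then show ?case by (simp add: tensor_eq.commute FS)
  qed (simp_all add: zero addl addr scale)
qed

lemma formal_sums_map:
  "(\<And>p. p \<in> set w \<Longrightarrow> [f p] \<in> formal_sums B) \<Longrightarrow> map f w \<in> formal_sums B"
  by (induction w) (auto simp: formal_sums_def)

lemma tensor_eq_map_Nil:
  "(\<And>p. p \<in> set w \<Longrightarrow> tensor_eq B [f p] []) \<Longrightarrow> tensor_eq B (map f w) []"
proof (induction w)
  case (Cons p w)
  have "tensor_eq B ([f p] @ map f w) ([] @ [])" using Cons by (intro tensor_eq.append) auto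
  then show ?case by simp
qed (simp add: tensor_eq.refl)

lemma tensor_eq_map:
  "(\<And>p. p \<in> set w \<Longrightarrow> tensor_eq B [f p] [g p]) \<Longrightarrow> tensor_eq B (map f w) (map g w)"
proof (induction w)
  case (Cons p w)
  have "tensor_eq B ([f p] @ map f w) ([g p] @ map g w)" using Cons by (intro tensor_eq.append) auto
  then show ?case by simp
qed (simp add: tensor_eq.refl)

lemma tensor_eq_map_append:
  "(\<And>p. p \<in> set w \<Longrightarrow> tensor_eq B [f p] [g p, k p]) \<Longrightarrow> tensor_eq B (map f w) (map g w @ map k w)"
proof (induction w)
  case (Cons p w)
  have "tensor_eq B ([f p] @ map f w) ([g p, k p] @ (map g w @ map k w))"
    using Cons by (intro tensor_eq.append) auto
  moreover from this have "tensor_eq B ([g p, k p] @ (map g w @ map k w)) (map g (p # w) @ map k (p # w))"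
    by (intro tensor_eq_mset) (auto dest: tensor_eq_formal_sums)
  ultimately show ?case by (simp del: append_Cons add: tensor_eq.trans) (metis append_Cons append_Nil list.simps(9) tensor_eq.trans)
qed (simp add: tensor_eq.refl)

definition weight :: "('a::cstar_algebra, 'h) formal_sum \<Rightarrow> real" where
  "weight u = (\<Sum>(a, b)\<leftarrow>u. norm a * trace_norm B b)"

lemma weight_simps [simp]:
  "weight [] = 0" "weight ((a, b) # u) = norm a * trace_norm B b + weight u"
  "weight (u @ v) = weight u + weight v"
  by (simp_all add: weight_def)

lemma weight_nonneg: "u \<in> formal_sums B \<Longrightarrow> 0 \<le> weight u"
proof (induction u)
  case (Cons p u)
  then show ?case by (cases p) (auto intro!: add_nonneg_nonneg mult_nonneg_nonneg trace_norm_nonneg)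
qed simp

lemma proj_norm_weight: "proj_norm B u = Inf {weight v | v. tensor_eq B u v}"
  by (simp add: proj_norm_def weight_def)

lemma proj_norm_le_weight: "tensor_eq B u v \<Longrightarrow> proj_norm B u \<le> weight v"
  unfolding proj_norm_weight
  by (intro cInf_lower bdd_belowI[where m = 0]) (auto dest: tensor_eq_formal_sums intro: weight_nonneg)

lemma le_proj_norm:
  assumes u: "u \<in> formal_sums B" and C: "0 \<le> C"
    and le: "\<And>v. tensor_eq B u v \<Longrightarrow> x \<le> C * weight v"
  shows "x \<le> C * proj_norm B u"
proof (cases "C = 0")
  case True
  then show ?thesis using le[OF tensor_eq.refl[OF u]] by simp
next
  case False
  have "x / C \<le> proj_norm B u"
    unfolding proj_norm_weight
  proof (rule cInf_greatest)
    show "{weight v |v. tensor_eq B u v} \<noteq> {}" using tensor_eq.refl[OF u] by blast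
    show "x / C \<le> y" if "y \<in> {weight v |v. tensor_eq B u v}" for y
      using that le C False by (auto simp: divide_le_eq mult.commute)
  qed
  then show ?thesis using C False by (simp add: divide_le_eq mult.commute)
qed

lemma proj_norm_nonneg: "u \<in> formal_sums B \<Longrightarrow> 0 \<le> proj_norm B u"
  using le_proj_norm[of u 1 0] by (auto dest: tensor_eq_formal_sums intro: weight_nonneg)

lemma proj_norm_cong:
  assumes "tensor_eq B u v"
  shows "proj_norm B u = proj_norm B v"
proof -
  have "tensor_eq B u w \<longleftrightarrow> tensor_eq B v w" for w
    using assms tensor_eq.sym tensor_eq.trans by blast
  then show ?thesis by (simp add: proj_norm_weight)
qed

lemma proj_norm_Nil: "proj_norm B ([] :: ('a::cstar_algebra, 'h) formal_sum) = 0"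
proof -
  let ?n = "[] :: ('a, 'h) formal_sum"
  show ?thesis
    using proj_norm_le_weight[OF tensor_eq.refl, of ?n] proj_norm_nonneg[of ?n] by simp
qed

text \<open>A map of the algebraic tensor product is estimated on arbitrary representatives.\<close>

lemma proj_norm_map_le:
  assumes u: "u \<in> formal_sums B" and C: "0 \<le> C"
    and cong: "\<And>v. tensor_eq B u v \<Longrightarrow> tensor_eq B (f u) (f v)"
    and le: "\<And>v. v \<in> formal_sums B \<Longrightarrow> weight (f v) \<le> C * weight v"
  shows "proj_norm B (f u) \<le> C * proj_norm B u"
proof (rule le_proj_norm[OF u C])
  fix v assume v: "tensor_eq B u v"
  have "proj_norm B (f u) \<le> weight (f v)" by (intro proj_norm_le_weight cong v)
  also have "\<dots> \<le> C * weight v" using tensor_eq_formal_sums[OF v] by (intro le) simp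
  finally show "proj_norm B (f u) \<le> C * weight v" .
qed

lemma proj_norm_append_le:
  assumes "u \<in> formal_sums B" "v \<in> formal_sums B"
  shows "proj_norm B (u @ v) \<le> proj_norm B u + proj_norm B v"
proof -
  have "proj_norm B (u @ v) - proj_norm B v \<le> 1 * proj_norm B u"
  proof (rule le_proj_norm[OF assms(1)])
    fix u' assume u': "tensor_eq B u u'"
    have "proj_norm B (u @ v) - weight u' \<le> 1 * proj_norm B v"
    proof (rule le_proj_norm[OF assms(2)])
      fix v' assume "tensor_eq B v v'"
      then show "proj_norm B (u @ v) - weight u' \<le> 1 * weight v'"
        using proj_norm_le_weight[OF tensor_eq.append[OF u']] by force
    qed simp
    then show "proj_norm B (u @ v) - proj_norm B v \<le> 1 * weight u'" by simp
  qed simp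
  then show ?thesis by simp
qed

definition fs_minus :: "('a::cstar_algebra, 'h) formal_sum \<Rightarrow> ('a, 'h) formal_sum" where
  "fs_minus u = map (\<lambda>(a, b). (- a, b)) u"

lemma fs_diff_minus: "fs_diff u v = u @ fs_minus v"
  by (simp add: fs_diff_def fs_minus_def)

lemma fs_minus_simps [simp]:
  "fs_minus [] = []" "fs_minus ((a, b) # u) = (- a, b) # fs_minus u"
  "fs_minus (u @ v) = fs_minus u @ fs_minus v" "fs_minus (fs_minus u) = u"
  by (auto simp: fs_minus_def comp_def case_prod_beta)

lemma fs_minus_formal_sums [simp]: "fs_minus u \<in> formal_sums B \<longleftrightarrow> u \<in> formal_sums B"
  by (induction u) auto

lemma fs_diff_formal_sums [simp]:
  "u \<in> formal_sums B \<Longrightarrow> v \<in> formal_sums B \<Longrightarrow> fs_diff u v \<in> formal_sums B"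
  by (simp add: fs_diff_minus)

lemma concat_map_singleton_eq: "concat (map (\<lambda>p. [f p]) u) = map f u"
  by (induction u) auto

lemma tensor_eq_minus:
  assumes "tensor_eq B u v"
  shows "tensor_eq B (fs_minus u) (fs_minus v)"
proof -
  let ?h = "\<lambda>p. [(\<lambda>(a, b). (- a, b)) p]"
  have "tensor_eq B (concat (map ?h u)) (concat (map ?h v))"
  proof (rule tensor_eq_bind[OF assms])
    fix a a' :: 'a and b b' :: "'h \<Rightarrow>\<^sub>L 'h" and c :: complex
    assume b: "b \<in> trace_class B"
    show "?h (a, b) \<in> formal_sums B" "tensor_eq B (?h (0, b)) []" using b tensor_eq.zero by auto
    show "tensor_eq B (?h (a + a', b)) (?h (a, b) @ ?h (a', b))"
      using tensor_eq.add_left[OF b, of "- a" "- a'"] by simp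
    show "tensor_eq B (?h (c *\<^sub>C a, b)) (?h (a, c *\<^sub>C b))"
      using tensor_eq.scale[OF b, of c "- a"] by simp
    assume "b' \<in> trace_class B"
    then show "tensor_eq B (?h (a, b + b')) (?h (a, b) @ ?h (a, b'))"
      using tensor_eq.add_right[OF b, of b' "- a"] by simp
  qed
  then show ?thesis unfolding concat_map_singleton_eq fs_minus_def .
qed

lemma weight_minus [simp]: "weight (fs_minus u) = weight u"
  by (induction u) auto

lemma proj_norm_minus:
  assumes "u \<in> formal_sums B"
  shows "proj_norm B (fs_minus u) = proj_norm B u"
proof -
  have *: "proj_norm B (fs_minus u) \<le> proj_norm B u" if "u \<in> formal_sums B" for u :: "('a, 'h) formal_sum"
    using proj_norm_map_le[OF that, of 1 fs_minus] by (simp add: tensor_eq_minus)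
  from *[OF assms] *[of "fs_minus u"] assms show ?thesis by simp
qed

lemma tensor_eq_cancel: "u \<in> formal_sums B \<Longrightarrow> tensor_eq B (u @ fs_minus u) []"
proof (induction u)
  case (Cons p u)
  obtain a b where p: "p = (a, b)" by fastforce
  have b: "b \<in> trace_class B" and u: "u \<in> formal_sums B" using Cons.prems by (auto simp: p)
  have "tensor_eq B ((p # u) @ fs_minus (p # u)) ([(a, b), (- a, b)] @ (u @ fs_minus u))"
    by (rule tensor_eq_mset) (use b u in \<open>auto simp: p\<close>)
  also have "tensor_eq B ([(a, b), (- a, b)] @ (u @ fs_minus u)) ([] @ [])"
  proof (rule tensor_eq.append[OF _ Cons.IH[OF u]])
    show "tensor_eq B [(a, b), (- a, b)] []"
      using tensor_eq.sym[OF tensor_eq.add_left[OF b, of a "- a"]] tensor_eq.zero[OF b]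
      by (auto intro: tensor_eq.trans)
  qed
  finally (tensor_eq.trans) show ?case by simp
qed (simp add: tensor_eq.refl)

definition fs_dist :: "('a::cstar_algebra, 'h) formal_sum \<Rightarrow> ('a, 'h) formal_sum \<Rightarrow> real" where
  "fs_dist u v = proj_norm B (fs_diff u v)"

lemma fs_dist_nonneg: "u \<in> formal_sums B \<Longrightarrow> v \<in> formal_sums B \<Longrightarrow> 0 \<le> fs_dist u v"
  by (simp add: fs_dist_def proj_norm_nonneg)

lemma fs_dist_refl: "u \<in> formal_sums B \<Longrightarrow> fs_dist u u = 0"
  unfolding fs_dist_def fs_diff_minus using proj_norm_cong[OF tensor_eq_cancel] by (simp add: proj_norm_Nil)

lemma fs_dist_commute:
  assumes "u \<in> formal_sums B" "v \<in> formal_sums B"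
  shows "fs_dist u v = fs_dist v u"
proof -
  have "proj_norm B (fs_diff u v) = proj_norm B (fs_minus (fs_diff u v))"
    using assms by (simp add: proj_norm_minus)
  also have "\<dots> = proj_norm B (fs_diff v u)"
    by (intro proj_norm_cong tensor_eq_mset) (use assms in \<open>simp_all add: fs_diff_minus\<close>)
  finally show ?thesis by (simp add: fs_dist_def)
qed

lemma fs_dist_triangle:
  assumes "u \<in> formal_sums B" "v \<in> formal_sums B" "w \<in> formal_sums B"
  shows "fs_dist u w \<le> fs_dist u v + fs_dist v w"
proof -
  have "tensor_eq B (fs_diff u v @ fs_diff v w) (fs_diff u w @ (v @ fs_minus v))"
    by (rule tensor_eq_mset) (use assms in \<open>simp_all add: fs_diff_minus\<close>)
  also have "tensor_eq B (fs_diff u w @ (v @ fs_minus v)) (fs_diff u w @ [])"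
    using assms by (intro tensor_eq.append tensor_eq.refl tensor_eq_cancel) simp_all
  finally (tensor_eq.trans) have "proj_norm B (fs_diff u w) = proj_norm B (fs_diff u v @ fs_diff v w)"
    using proj_norm_cong by fastforce
  then show ?thesis using assms by (simp add: fs_dist_def proj_norm_append_le)
qed

lemma proj_norm_le_dist:
  assumes "u \<in> formal_sums B" "v \<in> formal_sums B"
  shows "proj_norm B u \<le> proj_norm B v + fs_dist u v"
proof -
  have "tensor_eq B (fs_diff u v @ v) (u @ (v @ fs_minus v))"
    by (rule tensor_eq_mset) (use assms in \<open>simp_all add: fs_diff_minus\<close>)
  also have "tensor_eq B (u @ (v @ fs_minus v)) (u @ [])"
    using assms by (intro tensor_eq.append tensor_eq.refl tensor_eq_cancel)
  finally (tensor_eq.trans) have "proj_norm B u = proj_norm B (fs_diff u v @ v)"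
    using proj_norm_cong by fastforce
  then show ?thesis using assms proj_norm_append_le[of "fs_diff u v" v] by (simp add: fs_dist_def)
qed

lemma proj_norm_dist_abs:
  assumes "u \<in> formal_sums B" "v \<in> formal_sums B"
  shows "\<bar>proj_norm B u - proj_norm B v\<bar> \<le> fs_dist u v"
  using proj_norm_le_dist[OF assms] proj_norm_le_dist[OF assms(2,1)] fs_dist_commute[OF assms] by linarith

lemma fs_dist_append:
  assumes "u \<in> formal_sums B" "v \<in> formal_sums B" "u' \<in> formal_sums B" "v' \<in> formal_sums B"
  shows "fs_dist (u @ v) (u' @ v') \<le> fs_dist u u' + fs_dist v v'"
proof -
  have "tensor_eq B (fs_diff (u @ v) (u' @ v')) (fs_diff u u' @ fs_diff v v')"
    by (rule tensor_eq_mset) (use assms in \<open>simp_all add: fs_diff_minus\<close>)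
  from proj_norm_cong[OF this] show ?thesis
    using assms by (simp add: fs_dist_def proj_norm_append_le)
qed

lemma fs_dist_diff:
  assumes "u \<in> formal_sums B" "v \<in> formal_sums B" "u' \<in> formal_sums B" "v' \<in> formal_sums B"
  shows "fs_dist (fs_diff u v) (fs_diff u' v') \<le> fs_dist u u' + fs_dist v v'"
proof -
  have "fs_dist (fs_minus v) (fs_minus v') = fs_dist v v'"
    using proj_norm_minus[of "fs_diff v v'"] assms by (simp add: fs_dist_def fs_diff_minus)
  then show ?thesis
    using fs_dist_append[of u "fs_minus v" u' "fs_minus v'"] assms by (simp add: fs_diff_minus)
qed

subsection \<open>Products and adjoints of formal sums\<close>

lemma fs_mult_simps:
  "fs_mult [] v = []"
  "fs_mult ((a, b) # u) v = map (\<lambda>(a', b'). (a * a', b o\<^sub>L b')) v @ fs_mult u v"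
  by (simp_all add: fs_mult_def case_prod_beta concat_map_singleton_eq)

lemma fs_mult_append_left: "fs_mult (u @ u') v = fs_mult u v @ fs_mult u' v"
  by (induction u) (auto simp: fs_mult_simps)

lemma mset_fs_mult_Cons:
  "mset (fs_mult u ((a', b') # v)) = mset (map (\<lambda>(a, b). (a * a', b o\<^sub>L b')) u) + mset (fs_mult u v)"
  by (induction u) (auto simp: fs_mult_simps)

lemma fs_mult_Nil_right: "fs_mult u [] = []"
  by (induction u) (auto simp: fs_mult_simps)

lemma mset_fs_mult_append_right: "mset (fs_mult u (v @ v')) = mset (fs_mult u v) + mset (fs_mult u v')"
  by (induction u) (auto simp: fs_mult_simps)

lemma fs_mult_formal_sums [simp]:
  "u \<in> formal_sums B \<Longrightarrow> v \<in> formal_sums B \<Longrightarrow> fs_mult u v \<in> formal_sums B"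
proof (induction u)
  case (Cons p u)
  obtain a b where p: "p = (a, b)" by fastforce
  have "map (\<lambda>(a', b'). (a * a', b o\<^sub>L b')) v \<in> formal_sums B"
    using Cons.prems by (intro formal_sums_map) (auto simp: p formal_sums_def trace_class_compose)
  then show ?case using Cons by (simp add: p fs_mult_simps)
qed (simp add: fs_mult_simps)

lemma fs_mult_minus_left: "fs_mult (fs_minus u) v = fs_minus (fs_mult u v)"
  by (induction u) (auto simp: fs_mult_simps fs_minus_def)

lemma fs_mult_minus_right: "fs_mult u (fs_minus v) = fs_minus (fs_mult u v)"
  by (induction u) (auto simp: fs_mult_simps fs_minus_def)

lemma compose_scaleC_left: "(c *\<^sub>C x) o\<^sub>L y = c *\<^sub>C (x o\<^sub>L y)"
  by (rule blinfun_eqI) simp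

lemma compose_scaleC_right: "x \<in> bounded_ops \<Longrightarrow> x o\<^sub>L (c *\<^sub>C y) = c *\<^sub>C (x o\<^sub>L y)"
  by (rule blinfun_eqI) (simp add: bounded_ops_iff)

lemma tensor_eq_mult_left:
  fixes u v w :: "('a::cstar_algebra, 'h) formal_sum"
  assumes uv: "tensor_eq B u v" and w: "w \<in> formal_sums B"
  shows "tensor_eq B (fs_mult u w) (fs_mult v w)"
proof -
  define h :: "'a \<times> ('h \<Rightarrow>\<^sub>L 'h) \<Rightarrow> ('a, 'h) formal_sum" where "h = (\<lambda>p. map (\<lambda>q. (fst p * fst q, snd p o\<^sub>L snd q)) w)"
  have eq: "fs_mult u w = concat (map h u)" for u
    by (induction u) (auto simp: fs_mult_simps h_def case_prod_beta)
  have tc: "snd q \<in> trace_class B" if "q \<in> set w" for q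
    using w that by (auto simp: formal_sums_def)
  show ?thesis
    unfolding eq
  proof (rule tensor_eq_bind[OF uv])
    fix a a' :: 'a and b b' :: "'h \<Rightarrow>\<^sub>L 'h" and c :: complex
    assume b: "b \<in> trace_class B"
    note bq = trace_class_compose(1)[OF b tc]
    show "h (a, b) \<in> formal_sums B"
      unfolding h_def by (intro formal_sums_map) (simp add: bq)
    show "tensor_eq B (h (0, b)) []"
      unfolding h_def by (intro tensor_eq_map_Nil) (simp add: tensor_eq.zero bq)
    show "tensor_eq B (h (a + a', b)) (h (a, b) @ h (a', b))"
      unfolding h_def by (intro tensor_eq_map_append) (simp add: distrib_right tensor_eq.add_left bq)
    show "tensor_eq B (h (c *\<^sub>C a, b)) (h (a, c *\<^sub>C b))"
      unfolding h_def
      by (intro tensor_eq_map) (simp add: mult_scaleC_left compose_scaleC_left tensor_eq.scale bq)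
    assume b': "b' \<in> trace_class B"
    have "(b + b') o\<^sub>L y = (b o\<^sub>L y) + (b' o\<^sub>L y)" for y :: "'h \<Rightarrow>\<^sub>L 'h"
      by (rule blinfun_eqI) (simp add: plus_blinfun.rep_eq)
    then show "tensor_eq B (h (a, b + b')) (h (a, b) @ h (a, b'))"
      unfolding h_def
      by (intro tensor_eq_map_append) (simp add: tensor_eq.add_right bq trace_class_compose(1)[OF b' tc])
  qed
qed

text \<open>Distributing over the right factor permutes the summands, so \<open>fs_mult w u\<close> is only up to order the
  value at \<open>u\<close> of a map in the scope of \<open>tensor_eq_bind\<close>.\<close>

lemma tensor_eq_mult_right:
  fixes u v w :: "('a::cstar_algebra, 'h) formal_sum"
  assumes uv: "tensor_eq B u v" and w: "w \<in> formal_sums B"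
  shows "tensor_eq B (fs_mult w u) (fs_mult w v)"
proof -
  define h :: "'a \<times> ('h \<Rightarrow>\<^sub>L 'h) \<Rightarrow> ('a, 'h) formal_sum" where "h = (\<lambda>p. map (\<lambda>q. (fst q * fst p, snd q o\<^sub>L snd p)) w)"
  have ms: "mset (fs_mult w u) = mset (concat (map h u))" for u
    by (induction u) (auto simp: mset_fs_mult_Cons fs_mult_Nil_right h_def case_prod_unfold)
  have tc: "snd q \<in> trace_class B" if "q \<in> set w" for q
    using w that by (auto simp: formal_sums_def)
  have "tensor_eq B (concat (map h u)) (concat (map h v))"
  proof (rule tensor_eq_bind[OF uv])
    fix a a' :: 'a and b b' :: "'h \<Rightarrow>\<^sub>L 'h" and c :: complex
    assume b: "b \<in> trace_class B"
    note bq = trace_class_compose(1)[OF tc b]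
    show "h (a, b) \<in> formal_sums B"
      unfolding h_def by (intro formal_sums_map) (simp add: bq)
    show "tensor_eq B (h (0, b)) []"
      unfolding h_def by (intro tensor_eq_map_Nil) (simp add: tensor_eq.zero bq)
    show "tensor_eq B (h (a + a', b)) (h (a, b) @ h (a', b))"
      unfolding h_def by (intro tensor_eq_map_append) (simp add: distrib_left tensor_eq.add_left bq)
    show "tensor_eq B (h (c *\<^sub>C a, b)) (h (a, c *\<^sub>C b))"
      unfolding h_def
      by (intro tensor_eq_map)
        (simp add: mult_scaleC_right compose_scaleC_right[OF trace_class_bounded[OF tc]] tensor_eq.scale bq)
    assume b': "b' \<in> trace_class B"
    have "y o\<^sub>L (b + b') = (y o\<^sub>L b) + (y o\<^sub>L b')" for y :: "'h \<Rightarrow>\<^sub>L 'h"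
      by (rule blinfun_eqI) (simp add: plus_blinfun.rep_eq blinfun.add_right)
    then show "tensor_eq B (h (a, b + b')) (h (a, b) @ h (a, b'))"
      unfolding h_def
      by (intro tensor_eq_map_append) (simp add: tensor_eq.add_right bq trace_class_compose(1)[OF tc b'])
  qed
  moreover have "tensor_eq B (fs_mult w u) (concat (map h u))" "tensor_eq B (fs_mult w v) (concat (map h v))"
    using uv w by (auto intro!: tensor_eq_mset ms dest: tensor_eq_formal_sums)
  ultimately show ?thesis by (metis tensor_eq.sym tensor_eq.trans)
qed

lemma weight_mult_le:
  assumes "u \<in> formal_sums B" "v \<in> formal_sums B"
  shows "weight (fs_mult u v) \<le> weight u * weight v"
  using assms(1)
proof (induction u)
  case (Cons p u)
  obtain a b where p: "p = (a, b)" by fastforce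
  have b: "b \<in> trace_class B" and u: "u \<in> formal_sums B" using Cons.prems by (auto simp: p)
  have "weight (map (\<lambda>(a', b'). (a * a', b o\<^sub>L b')) v) \<le> norm a * trace_norm B b * weight v"
    using assms(2)
  proof (induction v)
    case (Cons q v)
    obtain a' b' where q: "q = (a', b')" by fastforce
    have b': "b' \<in> trace_class B" and v: "v \<in> formal_sums B" using Cons.prems by (auto simp: q)
    have "norm (a * a') * trace_norm B (b o\<^sub>L b') \<le> (norm a * norm a') * (trace_norm B b * trace_norm B b')"
      by (intro mult_mono norm_mult_ineq trace_class_compose b b' trace_norm_nonneg) auto
    then show ?case using Cons.IH[OF v] by (simp add: q algebra_simps)
  qed simp
  then show ?case using Cons.IH[OF u] by (simp add: p fs_mult_simps algebra_simps)
qed (simp add: fs_mult_simps)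

lemma proj_norm_mult_le:
  assumes u: "u \<in> formal_sums B" and v: "v \<in> formal_sums B"
  shows "proj_norm B (fs_mult u v) \<le> proj_norm B u * proj_norm B v"
proof (rule le_proj_norm[OF v proj_norm_nonneg[OF u]])
  fix v' assume v': "tensor_eq B v v'"
  then have v'fs: "v' \<in> formal_sums B" by (simp add: tensor_eq_formal_sums)
  have "proj_norm B (fs_mult u v) = proj_norm B (fs_mult u v')"
    by (intro proj_norm_cong tensor_eq_mult_right v' u)
  also have "\<dots> \<le> weight v' * proj_norm B u"
    using weight_mult_le[OF _ v'fs]
    by (intro proj_norm_map_le[where f = "\<lambda>u. fs_mult u v'"] u weight_nonneg v'fs tensor_eq_mult_left)
      (simp_all add: mult.commute)
  finally show "proj_norm B (fs_mult u v) \<le> proj_norm B u * weight v'" by (simp add: mult.commute)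
qed

lemma fs_dist_mult_le:
  assumes "u \<in> formal_sums B" "v \<in> formal_sums B" "u' \<in> formal_sums B" "v' \<in> formal_sums B"
  shows "fs_dist (fs_mult u v) (fs_mult u' v') \<le> fs_dist u u' * proj_norm B v + proj_norm B u' * fs_dist v v'"
proof -
  have "fs_dist (fs_mult u v) (fs_mult u' v) = proj_norm B (fs_mult (fs_diff u u') v)"
    by (simp add: fs_dist_def fs_diff_minus fs_mult_append_left fs_mult_minus_left)
  moreover have "fs_dist (fs_mult u' v) (fs_mult u' v') = proj_norm B (fs_mult u' (fs_diff v v'))"
    unfolding fs_dist_def using assms
    by (intro proj_norm_cong tensor_eq_mset)
      (simp_all add: fs_diff_minus mset_fs_mult_append_right fs_mult_minus_right)
  moreover have "fs_dist (fs_mult u v) (fs_mult u' v')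
      \<le> fs_dist (fs_mult u v) (fs_mult u' v) + fs_dist (fs_mult u' v) (fs_mult u' v')"
    using assms by (intro fs_dist_triangle) simp_all
  moreover have "proj_norm B (fs_mult (fs_diff u u') v) \<le> fs_dist u u' * proj_norm B v"
    "proj_norm B (fs_mult u' (fs_diff v v')) \<le> proj_norm B u' * fs_dist v v'"
    unfolding fs_dist_def using assms by (intro proj_norm_mult_le; simp)+
  ultimately show ?thesis by linarith
qed

lemma fs_star_simps [simp]:
  "fs_star [] = []" "fs_star ((a, b) # u) = (star a, op_adjoint b) # fs_star u"
  "fs_star (u @ v) = fs_star u @ fs_star v"
  by (simp_all add: fs_star_def)

lemma fs_star_formal_sums [simp]: "u \<in> formal_sums B \<Longrightarrow> fs_star u \<in> formal_sums B"
  by (induction u) (auto simp: trace_class_adjoint)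

lemma fs_star_minus: "fs_star (fs_minus u) = fs_minus (fs_star u)"
  by (induction u) auto

lemma tensor_eq_star:
  assumes "tensor_eq B u v"
  shows "tensor_eq B (fs_star u) (fs_star v)"
proof -
  let ?h = "\<lambda>p. [(\<lambda>(a, b). (star a, op_adjoint b)) p]"
  have "tensor_eq B (concat (map ?h u)) (concat (map ?h v))"
  proof (rule tensor_eq_bind[OF assms])
    fix a a' :: 'a and b b' :: "'h \<Rightarrow>\<^sub>L 'h" and c :: complex
    assume b: "b \<in> trace_class B"
    note bs = trace_class_adjoint(1)[OF b]
    show "?h (a, b) \<in> formal_sums B" "tensor_eq B (?h (0, b)) []" using bs tensor_eq.zero by auto
    show "tensor_eq B (?h (a + a', b)) (?h (a, b) @ ?h (a', b))"
      using tensor_eq.add_left[OF bs, of "star a" "star a'"] by (simp add: star_add)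
    show "tensor_eq B (?h (c *\<^sub>C a, b)) (?h (a, c *\<^sub>C b))"
      using tensor_eq.scale[OF bs, of "cnj c" "star a"]
      by (simp add: star_scaleC op_adjoint_scaleC trace_class_bounded[OF b])
    assume b': "b' \<in> trace_class B"
    show "tensor_eq B (?h (a, b + b')) (?h (a, b) @ ?h (a, b'))"
      using tensor_eq.add_right[OF bs trace_class_adjoint(1)[OF b'], of "star a"]
      by (simp add: op_adjoint_add trace_class_bounded b b')
  qed
  then show ?thesis unfolding concat_map_singleton_eq fs_star_def .
qed

lemma weight_star_le: "u \<in> formal_sums B \<Longrightarrow> weight (fs_star u) \<le> weight u"
proof (induction u)
  case (Cons p u)
  then show ?case by (cases p) (auto intro!: add_mono mult_left_mono trace_class_adjoint)
qed simp

lemma fs_dist_star_le: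
  assumes "u \<in> formal_sums B" "v \<in> formal_sums B"
  shows "fs_dist (fs_star u) (fs_star v) \<le> fs_dist u v"
proof -
  have "proj_norm B (fs_star (fs_diff u v)) \<le> 1 * proj_norm B (fs_diff u v)"
    using assms by (intro proj_norm_map_le tensor_eq_star) (simp_all add: weight_star_le)
  then show ?thesis by (simp add: fs_dist_def fs_diff_minus fs_star_minus)
qed

end

section \<open>The completion and the functional of a map\<close>

context hilbert_basis
begin

lemma cauchy_seqs_iff:
  "X \<in> cauchy_seqs B \<longleftrightarrow> (\<forall>n. X n \<in> formal_sums B) \<and>
    (\<forall>\<epsilon>>0. \<exists>N. \<forall>m\<ge>N. \<forall>n\<ge>N. fs_dist (X m) (X n) < \<epsilon>)"
  by (simp add: cauchy_seqs_def fs_dist_def)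

lemma null_rel_iff:
  "(X, Y) \<in> null_rel B \<longleftrightarrow> X \<in> cauchy_seqs B \<and> Y \<in> cauchy_seqs B \<and> (\<lambda>n. fs_dist (X n) (Y n)) \<longlonglongrightarrow> 0"
  by (simp add: null_rel_def fs_dist_def)

lemma cauchy_seqs_formal_sums: "X \<in> cauchy_seqs B \<Longrightarrow> X n \<in> formal_sums B"
  by (simp add: cauchy_seqs_iff)

lemma cauchy_seqs_const: "u \<in> formal_sums B \<Longrightarrow> (\<lambda>n. u) \<in> cauchy_seqs B"
  by (simp add: cauchy_seqs_iff fs_dist_refl)

lemma cauchy_seqs_lipschitz:
  assumes X: "X \<in> cauchy_seqs B" and Y: "Y \<in> cauchy_seqs B"
    and Z: "\<And>n. Z n \<in> formal_sums B" and C: "0 \<le> C"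
    and le: "\<And>m n. fs_dist (Z m) (Z n) \<le> C * (fs_dist (X m) (X n) + fs_dist (Y m) (Y n))"
  shows "Z \<in> cauchy_seqs B"
  unfolding cauchy_seqs_iff
proof (intro conjI allI impI Z)
  fix \<epsilon> :: real assume \<epsilon>: "\<epsilon> > 0"
  define d where "d = \<epsilon> / (C + 1) / 2"
  have d: "d > 0" using \<epsilon> C by (simp add: d_def)
  obtain N1 where N1: "\<And>m n. m \<ge> N1 \<Longrightarrow> n \<ge> N1 \<Longrightarrow> fs_dist (X m) (X n) < d"
    using X d unfolding cauchy_seqs_iff by meson
  obtain N2 where N2: "\<And>m n. m \<ge> N2 \<Longrightarrow> n \<ge> N2 \<Longrightarrow> fs_dist (Y m) (Y n) < d"
    using Y d unfolding cauchy_seqs_iff by meson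
  show "\<exists>N. \<forall>m\<ge>N. \<forall>n\<ge>N. fs_dist (Z m) (Z n) < \<epsilon>"
  proof (intro exI[of _ "max N1 N2"] allI impI)
    fix m n assume mn: "max N1 N2 \<le> m" "max N1 N2 \<le> n"
    have "fs_dist (X m) (X n) < d" "fs_dist (Y m) (Y n) < d" using mn by (auto intro: N1 N2)
    then have "C * (fs_dist (X m) (X n) + fs_dist (Y m) (Y n)) \<le> C * (2 * d)"
      using C by (intro mult_left_mono) auto
    also have "\<dots> = \<epsilon> * (C / (C + 1))" using C by (simp add: d_def field_simps)
    also have "\<dots> < \<epsilon> * 1" using C \<epsilon> by (intro mult_strict_left_mono) auto
    finally show "fs_dist (Z m) (Z n) < \<epsilon>" using le[of m n] by simp
  qed
qed

lemma null_rel_lipschitz: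
  assumes X: "(X, X') \<in> null_rel B" and Y: "(Y, Y') \<in> null_rel B"
    and Z: "Z \<in> cauchy_seqs B" "Z' \<in> cauchy_seqs B"
    and le: "\<And>n. fs_dist (Z n) (Z' n) \<le> C * (fs_dist (X n) (X' n) + fs_dist (Y n) (Y' n))"
  shows "(Z, Z') \<in> null_rel B"
  unfolding null_rel_iff
proof (intro conjI Z)
  have "(\<lambda>n. C * (fs_dist (X n) (X' n) + fs_dist (Y n) (Y' n))) \<longlonglongrightarrow> C * (0 + 0)"
    using X Y unfolding null_rel_iff by (intro tendsto_intros) auto
  then have lim: "(\<lambda>n. C * (fs_dist (X n) (X' n) + fs_dist (Y n) (Y' n))) \<longlonglongrightarrow> 0" by simp
  have "norm (fs_dist (Z n) (Z' n)) \<le> C * (fs_dist (X n) (X' n) + fs_dist (Y n) (Y' n))" for n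
    using le[of n] fs_dist_nonneg[of "Z n" "Z' n"] Z by (simp add: cauchy_seqs_formal_sums)
  then show "(\<lambda>n. fs_dist (Z n) (Z' n)) \<longlonglongrightarrow> 0"
    by (intro Lim_null_comparison[OF _ lim] always_eventually) blast
qed

lemma null_rel_refl: "X \<in> cauchy_seqs B \<Longrightarrow> (X, X) \<in> null_rel B"
  by (simp add: null_rel_iff fs_dist_refl cauchy_seqs_formal_sums)

lemma null_rel_sym: "(X, Y) \<in> null_rel B \<Longrightarrow> (Y, X) \<in> null_rel B"
  by (rule null_rel_lipschitz[of X Y X X _ _ 1])
    (auto simp: null_rel_iff fs_dist_refl cauchy_seqs_formal_sums fs_dist_commute)

lemma null_rel_trans: "(X, Y) \<in> null_rel B \<Longrightarrow> (Y, Z) \<in> null_rel B \<Longrightarrow> (X, Z) \<in> null_rel B"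
  by (rule null_rel_lipschitz[of X Y Y Z _ _ 1])
    (auto simp: null_rel_iff fs_dist_triangle cauchy_seqs_formal_sums)

lemma pt_class_eqI:
  assumes "(X, Y) \<in> null_rel B"
  shows "pt_class B X = pt_class B Y"
  unfolding pt_class_def using null_rel_trans null_rel_sym assms by blast

text \<open>The operations are computed on chosen representatives; this shows that the choice changes a sequence
  only by a null sequence.\<close>

lemma pt_rep_class:
  assumes "X \<in> cauchy_seqs B"
  shows "(X, pt_rep (pt_class B X)) \<in> null_rel B"
proof -
  have "X \<in> pt_class B X" using null_rel_refl[OF assms] by (simp add: pt_class_def)
  then have "pt_rep (pt_class B X) \<in> pt_class B X" unfolding pt_rep_def by (rule someI[of "\<lambda>Y. Y \<in> pt_class B X"])
  then show ?thesis by (simp add: pt_class_def)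
qed

lemma pt_rep_cauchy: "X \<in> cauchy_seqs B \<Longrightarrow> pt_rep (pt_class B X) \<in> cauchy_seqs B"
  using pt_rep_class by (auto simp: null_rel_iff)

lemma pt_class_in_proj_tensor: "X \<in> cauchy_seqs B \<Longrightarrow> pt_class B X \<in> proj_tensor B"
  unfolding proj_tensor_def pt_class_def by (rule quotientI)

lemma proj_tensorE:
  assumes "z \<in> proj_tensor B"
  obtains X where "X \<in> cauchy_seqs B" "z = pt_class B X"
  using assms unfolding proj_tensor_def pt_class_def by (auto elim: quotientE)

lemma cauchy_append:
  assumes "X \<in> cauchy_seqs B" "Y \<in> cauchy_seqs B"
  shows "(\<lambda>n. X n @ Y n) \<in> cauchy_seqs B"
  by (rule cauchy_seqs_lipschitz[OF assms, where C = 1])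
    (use assms in \<open>simp_all add: cauchy_seqs_formal_sums fs_dist_append\<close>)

lemma cauchy_diff:
  assumes "X \<in> cauchy_seqs B" "Y \<in> cauchy_seqs B"
  shows "(\<lambda>n. fs_diff (X n) (Y n)) \<in> cauchy_seqs B"
  by (rule cauchy_seqs_lipschitz[OF assms, where C = 1])
    (use assms in \<open>simp_all add: cauchy_seqs_formal_sums fs_dist_diff\<close>)

lemma cauchy_star:
  assumes "X \<in> cauchy_seqs B"
  shows "(\<lambda>n. fs_star (X n)) \<in> cauchy_seqs B"
proof (rule cauchy_seqs_lipschitz[OF assms assms, where C = 1])
  fix m n
  note FS = cauchy_seqs_formal_sums[OF assms]
  show "fs_star (X n) \<in> formal_sums B" by (simp add: FS)
  show "fs_dist (fs_star (X m)) (fs_star (X n)) \<le> 1 * (fs_dist (X m) (X n) + fs_dist (X m) (X n))"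
    using fs_dist_star_le[OF FS FS, of m n] fs_dist_nonneg[OF FS FS, of m n] by simp
qed simp

lemma proj_norm_convergent:
  assumes "X \<in> cauchy_seqs B"
  shows "convergent (\<lambda>n. proj_norm B (X n))"
proof -
  have "Cauchy (\<lambda>n. proj_norm B (X n))"
    unfolding Cauchy_def
  proof (intro allI impI)
    fix e :: real assume "e > 0"
    then obtain N where "\<forall>m\<ge>N. \<forall>n\<ge>N. fs_dist (X m) (X n) < e"
      using assms unfolding cauchy_seqs_iff by meson
    then show "\<exists>M. \<forall>m\<ge>M. \<forall>n\<ge>M. dist (proj_norm B (X m)) (proj_norm B (X n)) < e"
      unfolding dist_real_def
      using proj_norm_dist_abs[OF cauchy_seqs_formal_sums[OF assms] cauchy_seqs_formal_sums[OF assms]]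
      by (meson le_less_trans)
  qed
  then show ?thesis by (rule Cauchy_convergent)
qed

lemma proj_norm_bounded:
  assumes "X \<in> cauchy_seqs B"
  obtains M where "\<And>n. proj_norm B (X n) \<le> M" "0 \<le> M"
proof -
  have "Bseq (\<lambda>n. proj_norm B (X n))" by (rule convergent_imp_Bseq[OF proj_norm_convergent[OF assms]])
  then obtain M where "\<forall>n. norm (proj_norm B (X n)) \<le> M" "M > 0" unfolding Bseq_def by blast
  then show ?thesis using that[of M] by (metis abs_le_D1 less_imp_le real_norm_def)
qed

text \<open>Multiplication is Lipschitz on bounded sets only; Cauchy sequences are bounded, which is why products
  pass to the completion.\<close>

lemma fs_dist_mult_bound:
  assumes "X n \<in> formal_sums B" "Y n \<in> formal_sums B" "X' m \<in> formal_sums B" "Y' m \<in> formal_sums B"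
    and "proj_norm B (Y n) \<le> M" "proj_norm B (X' m) \<le> M"
  shows "fs_dist (fs_mult (X n) (Y n)) (fs_mult (X' m) (Y' m)) \<le> M * (fs_dist (X n) (X' m) + fs_dist (Y n) (Y' m))"
proof -
  have "fs_dist (fs_mult (X n) (Y n)) (fs_mult (X' m) (Y' m))
      \<le> fs_dist (X n) (X' m) * proj_norm B (Y n) + proj_norm B (X' m) * fs_dist (Y n) (Y' m)"
    using assms by (intro fs_dist_mult_le)
  also have "\<dots> \<le> fs_dist (X n) (X' m) * M + M * fs_dist (Y n) (Y' m)"
    using assms by (intro add_mono mult_left_mono mult_right_mono fs_dist_nonneg)
  finally show ?thesis by (simp add: algebra_simps)
qed

lemma cauchy_mult:
  assumes "X \<in> cauchy_seqs B" "Y \<in> cauchy_seqs B"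
  shows "(\<lambda>n. fs_mult (X n) (Y n)) \<in> cauchy_seqs B"
proof -
  obtain M1 where M1: "\<And>n. proj_norm B (X n) \<le> M1" "0 \<le> M1" using proj_norm_bounded[OF assms(1)] by metis
  obtain M2 where M2: "\<And>n. proj_norm B (Y n) \<le> M2" "0 \<le> M2" using proj_norm_bounded[OF assms(2)] by metis
  note FS = assms[THEN cauchy_seqs_formal_sums]
  show ?thesis
  proof (rule cauchy_seqs_lipschitz[OF assms, where C = "max M1 M2"])
    fix m n
    show "fs_mult (X n) (Y n) \<in> formal_sums B" by (simp add: FS)
    show "fs_dist (fs_mult (X m) (Y m)) (fs_mult (X n) (Y n))
        \<le> max M1 M2 * (fs_dist (X m) (X n) + fs_dist (Y m) (Y n))"
      using M1(1)[of n] M2(1)[of m] by (intro fs_dist_mult_bound FS) auto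
  qed (use M1 in auto)
qed

lemma null_rel_mult:
  assumes X: "(X, X') \<in> null_rel B" and Y: "(Y, Y') \<in> null_rel B"
  shows "((\<lambda>n. fs_mult (X n) (Y n)), (\<lambda>n. fs_mult (X' n) (Y' n))) \<in> null_rel B"
proof -
  have c: "X \<in> cauchy_seqs B" "X' \<in> cauchy_seqs B" "Y \<in> cauchy_seqs B" "Y' \<in> cauchy_seqs B"
    using X Y by (auto simp: null_rel_iff)
  obtain M1 where M1: "\<And>n. proj_norm B (X' n) \<le> M1" using proj_norm_bounded[OF c(2)] by metis
  obtain M2 where M2: "\<And>n. proj_norm B (Y n) \<le> M2" using proj_norm_bounded[OF c(3)] by metis
  note FS = c[THEN cauchy_seqs_formal_sums]
  show ?thesis
  proof (rule null_rel_lipschitz[OF X Y, where C = "max M1 M2"])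
    fix n
    show "fs_dist (fs_mult (X n) (Y n)) (fs_mult (X' n) (Y' n))
        \<le> max M1 M2 * (fs_dist (X n) (X' n) + fs_dist (Y n) (Y' n))"
      using M1(1)[of n] M2(1)[of n] by (intro fs_dist_mult_bound FS) auto
  qed (intro cauchy_mult c)+
qed

lemma pt_add_class:
  assumes X: "X \<in> cauchy_seqs B" and Y: "Y \<in> cauchy_seqs B"
  shows "pt_add B (pt_class B X) (pt_class B Y) = pt_class B (\<lambda>n. X n @ Y n)"
  unfolding pt_add_def
proof (rule pt_class_eqI[symmetric], rule null_rel_lipschitz[OF pt_rep_class[OF X] pt_rep_class[OF Y], where C = 1])
qed (use X Y in \<open>simp_all add: cauchy_append pt_rep_cauchy fs_dist_append cauchy_seqs_formal_sums\<close>)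

lemma pt_diff_class:
  assumes X: "X \<in> cauchy_seqs B" and Y: "Y \<in> cauchy_seqs B"
  shows "pt_diff B (pt_class B X) (pt_class B Y) = pt_class B (\<lambda>n. fs_diff (X n) (Y n))"
  unfolding pt_diff_def
proof (rule pt_class_eqI[symmetric], rule null_rel_lipschitz[OF pt_rep_class[OF X] pt_rep_class[OF Y], where C = 1])
qed (use X Y in \<open>simp_all add: cauchy_diff pt_rep_cauchy fs_dist_diff cauchy_seqs_formal_sums\<close>)

lemma pt_mult_class:
  assumes X: "X \<in> cauchy_seqs B" and Y: "Y \<in> cauchy_seqs B"
  shows "pt_mult B (pt_class B X) (pt_class B Y) = pt_class B (\<lambda>n. fs_mult (X n) (Y n))"
  unfolding pt_mult_def
  by (rule pt_class_eqI[symmetric], rule null_rel_mult[OF pt_rep_class[OF X] pt_rep_class[OF Y]])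

lemma pt_star_class:
  assumes X: "X \<in> cauchy_seqs B"
  shows "pt_star B (pt_class B X) = pt_class B (\<lambda>n. fs_star (X n))"
  unfolding pt_star_def
proof (rule pt_class_eqI[symmetric], rule null_rel_lipschitz[OF pt_rep_class[OF X] pt_rep_class[OF X], where C = 1])
  fix n
  note FS = cauchy_seqs_formal_sums[OF X, of n] cauchy_seqs_formal_sums[OF pt_rep_cauchy[OF X], of n]
  show "fs_dist (fs_star (X n)) (fs_star (pt_rep (pt_class B X) n))
      \<le> 1 * (fs_dist (X n) (pt_rep (pt_class B X) n) + fs_dist (X n) (pt_rep (pt_class B X) n))"
    using fs_dist_star_le[OF FS] fs_dist_nonneg[OF FS] by (simp add: add_increasing)
qed (use X in \<open>simp_all add: cauchy_star pt_rep_cauchy\<close>)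

lemma pt_norm_class:
  assumes X: "X \<in> cauchy_seqs B"
  shows "(\<lambda>n. proj_norm B (X n)) \<longlonglongrightarrow> pt_norm B (pt_class B X)"
proof -
  let ?Y = "pt_rep (pt_class B X)"
  note Y = pt_rep_cauchy[OF X]
  have l: "(\<lambda>n. proj_norm B (?Y n)) \<longlonglongrightarrow> pt_norm B (pt_class B X)"
    unfolding pt_norm_def using proj_norm_convergent[OF Y] by (simp add: convergent_LIMSEQ_iff)
  have "(\<lambda>n. proj_norm B (X n) - proj_norm B (?Y n)) \<longlonglongrightarrow> 0"
  proof (rule Lim_null_comparison)
    show "\<forall>\<^sub>F n in sequentially. norm (proj_norm B (X n) - proj_norm B (?Y n)) \<le> fs_dist (X n) (?Y n)"
      using proj_norm_dist_abs[OF cauchy_seqs_formal_sums[OF X] cauchy_seqs_formal_sums[OF Y]] by simp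
    show "(\<lambda>n. fs_dist (X n) (?Y n)) \<longlonglongrightarrow> 0" using pt_rep_class[OF X] by (simp add: null_rel_iff)
  qed
  from tendsto_add[OF this l] show ?thesis by simp
qed

end

locale bounded_map = hilbert_basis B for B :: "'h::complex_hilbert set" +
  fixes T :: "'a::cstar_algebra \<Rightarrow> ('h \<Rightarrow>\<^sub>L 'h)"
  assumes T: "T \<in> bounded_maps"
begin

lemma T_clinear: "clinear T" and T_bounded_ops: "T a \<in> bounded_ops"
  using T by (auto simp: bounded_maps_def)

definition K :: real where "K = onorm T"

lemma K_nonneg: "0 \<le> K" and norm_T_le: "norm (T a) \<le> K * norm a"
  using T onorm_pos_le[of T] onorm[of T a] by (auto simp: bounded_maps_def K_def)

lemma fs_functional_simps [simp]:
  "fs_functional B T [] = 0"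
  "fs_functional B T ((a, b) # u) = trace_pair (T a) b + fs_functional B T u"
  "fs_functional B T (u @ v) = fs_functional B T u + fs_functional B T v"
  by (simp_all add: fs_functional_def trace_pair_def)

lemma trace_pair_zero: "b \<in> trace_class B \<Longrightarrow> trace_pair 0 b = 0"
  using trace_pair_add_left[OF bounded_ops_zero bounded_ops_zero, of b] by simp

lemma fs_functional_cong: "tensor_eq B u v \<Longrightarrow> fs_functional B T u = fs_functional B T v"
proof (induction rule: tensor_eq.induct)
  case (zero b)
  then show ?case using clinear_0[OF T_clinear] by (simp add: trace_pair_zero)
next
  case (add_left b a a')
  then show ?case by (simp add: clinear_add[OF T_clinear] trace_pair_add_left T_bounded_ops)
next
  case (add_right b b' a)
  then show ?case by (simp add: trace_pair_add_right T_bounded_ops)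
next
  case (scale b c a)
  then show ?case by (simp add: clinear_scaleC[OF T_clinear] trace_pair_scale T_bounded_ops)
qed auto

lemma fs_functional_minus:
  assumes "u \<in> formal_sums B"
  shows "fs_functional B T (fs_minus u) = - fs_functional B T u"
  using fs_functional_cong[OF tensor_eq_cancel[OF assms]] by (simp add: eq_neg_iff_add_eq_0 add.commute)

lemma fs_functional_diff:
  "v \<in> formal_sums B \<Longrightarrow> fs_functional B T (fs_diff u v) = fs_functional B T u - fs_functional B T v"
  by (simp add: fs_diff_minus fs_functional_minus)

lemma norm_fs_functional_le_weight:
  "u \<in> formal_sums B \<Longrightarrow> cmod (fs_functional B T u) \<le> K * weight u"
proof (induction u)
  case (Cons p u)
  obtain a b where p: "p = (a, b)" by fastforce
  have b: "b \<in> trace_class B" using Cons.prems by (simp add: p)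
  have "cmod (trace_pair (T a) b) \<le> norm (T a) * trace_norm B b"
    by (rule norm_trace_pair_le[OF T_bounded_ops b])
  also have "\<dots> \<le> K * norm a * trace_norm B b"
    by (intro mult_right_mono norm_T_le trace_norm_nonneg b)
  finally show ?case
    using Cons norm_triangle_ineq[of "trace_pair (T a) b" "fs_functional B T u"]
    by (simp add: p algebra_simps)
qed simp

lemma norm_fs_functional_le:
  assumes u: "u \<in> formal_sums B"
  shows "cmod (fs_functional B T u) \<le> K * proj_norm B u"
proof (rule le_proj_norm[OF u K_nonneg])
  fix v assume v: "tensor_eq B u v"
  then show "cmod (fs_functional B T u) \<le> K * weight v"
    using norm_fs_functional_le_weight[of v] fs_functional_cong[OF v] tensor_eq_formal_sums[OF v] by simp
qed

lemma fs_functional_dist: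
  assumes "u \<in> formal_sums B" "v \<in> formal_sums B"
  shows "cmod (fs_functional B T u - fs_functional B T v) \<le> K * fs_dist u v"
  using norm_fs_functional_le[of "fs_diff u v"] assms by (simp add: fs_dist_def fs_functional_diff)

lemma fs_functional_convergent:
  assumes X: "X \<in> cauchy_seqs B"
  shows "convergent (\<lambda>n. fs_functional B T (X n))"
proof -
  have "Cauchy (\<lambda>n. fs_functional B T (X n))"
    unfolding Cauchy_def
  proof (intro allI impI)
    fix e :: real assume e: "e > 0"
    then have "e / (K + 1) > 0" using K_nonneg by simp
    then obtain N where N: "\<forall>m\<ge>N. \<forall>n\<ge>N. fs_dist (X m) (X n) < e / (K + 1)"
      using X unfolding cauchy_seqs_iff by meson
    show "\<exists>M. \<forall>m\<ge>M. \<forall>n\<ge>M. dist (fs_functional B T (X m)) (fs_functional B T (X n)) < e"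
    proof (intro exI[of _ N] allI impI)
      fix m n assume "N \<le> m" "N \<le> n"
      then have *: "fs_dist (X m) (X n) < e / (K + 1)" using N by blast
      note FS = cauchy_seqs_formal_sums[OF X]
      have "dist (fs_functional B T (X m)) (fs_functional B T (X n)) \<le> K * fs_dist (X m) (X n)"
        unfolding dist_norm by (rule fs_functional_dist[OF FS FS])
      also have "\<dots> \<le> (K + 1) * fs_dist (X m) (X n)"
        by (intro mult_right_mono fs_dist_nonneg FS) simp
      also have "\<dots> < e" using * K_nonneg by (simp add: less_divide_eq mult.commute)
      finally show "dist (fs_functional B T (X m)) (fs_functional B T (X n)) < e" .
    qed
  qed
  then show ?thesis by (rule Cauchy_convergent)
qed

lemma tilde_class:
  assumes X: "X \<in> cauchy_seqs B"
  shows "(\<lambda>n. fs_functional B T (X n)) \<longlonglongrightarrow> tilde B T (pt_class B X)"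
proof -
  let ?Y = "pt_rep (pt_class B X)"
  note Y = pt_rep_cauchy[OF X]
  have l: "(\<lambda>n. fs_functional B T (?Y n)) \<longlonglongrightarrow> tilde B T (pt_class B X)"
    unfolding tilde_def using fs_functional_convergent[OF Y] by (simp add: convergent_LIMSEQ_iff)
  have "(\<lambda>n. fs_functional B T (X n) - fs_functional B T (?Y n)) \<longlonglongrightarrow> 0"
  proof (rule Lim_null_comparison)
    show "\<forall>\<^sub>F n in sequentially. norm (fs_functional B T (X n) - fs_functional B T (?Y n)) \<le> K * fs_dist (X n) (?Y n)"
      using fs_functional_dist[OF cauchy_seqs_formal_sums[OF X] cauchy_seqs_formal_sums[OF Y]] by simp
    have "(\<lambda>n. K * fs_dist (X n) (?Y n)) \<longlonglongrightarrow> K * 0"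
      using pt_rep_class[OF X] by (intro tendsto_intros) (simp add: null_rel_iff)
    then show "(\<lambda>n. K * fs_dist (X n) (?Y n)) \<longlonglongrightarrow> 0" by simp
  qed
  from tendsto_add[OF this l] show ?thesis by simp
qed

lemma tilde_add:
  assumes "z \<in> proj_tensor B" "w \<in> proj_tensor B"
  shows "pt_add B z w \<in> proj_tensor B" "tilde B T (pt_add B z w) = tilde B T z + tilde B T w"
proof -
  obtain X where X: "X \<in> cauchy_seqs B" "z = pt_class B X" using assms(1) by (rule proj_tensorE)
  obtain Y where Y: "Y \<in> cauchy_seqs B" "w = pt_class B Y" using assms(2) by (rule proj_tensorE)
  note XY = cauchy_append[OF X(1) Y(1)]
  note eq = pt_add_class[OF X(1) Y(1), folded X(2) Y(2)]
  show "pt_add B z w \<in> proj_tensor B" unfolding eq by (rule pt_class_in_proj_tensor[OF XY])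
  have "(\<lambda>n. fs_functional B T (X n @ Y n)) \<longlonglongrightarrow> tilde B T z + tilde B T w"
    unfolding fs_functional_simps X(2) Y(2) by (intro tendsto_add tilde_class X Y)
  then show "tilde B T (pt_add B z w) = tilde B T z + tilde B T w"
    using tilde_class[OF XY] LIMSEQ_unique unfolding eq by blast
qed

lemma norm_tilde_diff_le:
  assumes "z \<in> proj_tensor B" "w \<in> proj_tensor B"
  shows "cmod (tilde B T z - tilde B T w) \<le> K * pt_norm B (pt_diff B z w)"
proof -
  obtain X where X: "X \<in> cauchy_seqs B" "z = pt_class B X" using assms(1) by (rule proj_tensorE)
  obtain Y where Y: "Y \<in> cauchy_seqs B" "w = pt_class B Y" using assms(2) by (rule proj_tensorE)
  note FS = cauchy_seqs_formal_sums[OF X(1)] cauchy_seqs_formal_sums[OF Y(1)]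
  have "(\<lambda>n. proj_norm B (fs_diff (X n) (Y n))) \<longlonglongrightarrow> pt_norm B (pt_diff B z w)"
    unfolding X(2) Y(2) pt_diff_class[OF X(1) Y(1)] by (intro pt_norm_class cauchy_diff X Y)
  then have r: "(\<lambda>n. K * fs_dist (X n) (Y n)) \<longlonglongrightarrow> K * pt_norm B (pt_diff B z w)"
    unfolding fs_dist_def by (rule tendsto_mult_left)
  have l: "(\<lambda>n. cmod (fs_functional B T (X n) - fs_functional B T (Y n))) \<longlonglongrightarrow> cmod (tilde B T z - tilde B T w)"
    unfolding X(2) Y(2) by (intro tendsto_norm tendsto_diff tilde_class X Y)
  show ?thesis
    by (rule LIMSEQ_le[OF l r]) (use fs_functional_dist[OF FS] in auto)
qed

lemma tilde_zero: "pt_zero B \<in> (proj_tensor B :: ('a, 'h) tensor set)" "tilde B T (pt_zero B) = 0"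
proof -
  have c: "(\<lambda>n. [] :: ('a, 'h) formal_sum) \<in> cauchy_seqs B" by (rule cauchy_seqs_const) simp
  show "pt_zero B \<in> (proj_tensor B :: ('a, 'h) tensor set)"
    unfolding pt_zero_def by (rule pt_class_in_proj_tensor[OF c])
  show "tilde B T (pt_zero B) = 0"
    unfolding pt_zero_def using tilde_class[OF c] by (simp add: LIMSEQ_const_iff)
qed

lemma tilde_square:
  assumes X: "X \<in> cauchy_seqs B"
  shows "pt_mult B (pt_star B (pt_class B X)) (pt_class B X) \<in> proj_tensor B"
    "(\<lambda>n. fs_functional B T (fs_mult (fs_star (X n)) (X n)))
      \<longlonglongrightarrow> tilde B T (pt_mult B (pt_star B (pt_class B X)) (pt_class B X))"
  unfolding pt_star_class[OF X] pt_mult_class[OF cauchy_star[OF X] X]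
  by (intro pt_class_in_proj_tensor tilde_class cauchy_mult cauchy_star X)+

text \<open>For $u = \sum_i a_i \otimes b_i$ this writes $\tilde T(u^* u)$ as a sum, over the basis vectors $g$, of the
  quadratic forms of the matrices $T(a_i^* a_j)$ at the vectors $b_i^t g$.\<close>

lemma fs_functional_square_has_sum:
  assumes "u \<in> formal_sums B"
  shows "((\<lambda>g. \<Sum>(a, b)\<leftarrow>u. \<Sum>(a', b')\<leftarrow>u.
      cinner (transpose_op B b \<cdot> g)
        (T (star a * a') \<cdot> (transpose_op B b' \<cdot> g)))
    has_sum fs_functional B T (fs_mult (fs_star u) u)) B"
proof -
  have inner: "((\<lambda>g. \<Sum>(a', b')\<leftarrow>v.
      cinner (transpose_op B b \<cdot> g)
        (T (star a * a') \<cdot> (transpose_op B b' \<cdot> g)))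
    has_sum fs_functional B T (map (\<lambda>(a', b'). (star a * a', op_adjoint b o\<^sub>L b')) v)) B"
    if b: "b \<in> trace_class B" and v: "v \<in> formal_sums B" for a b and v :: "('a, 'h) formal_sum"
    using v
  proof (induction v)
    case (Cons q v)
    obtain a' b' where q: "q = (a', b')" by fastforce
    have "b' \<in> trace_class B" "v \<in> formal_sums B" using Cons.prems by (auto simp: q)
    with Cons.IH show ?case
      by (simp add: q) (intro has_sum_add trace_pair_square T_bounded_ops b)
  qed simp
  have "((\<lambda>g. \<Sum>(a, b)\<leftarrow>u. \<Sum>(a', b')\<leftarrow>v.
      cinner (transpose_op B b \<cdot> g)
        (T (star a * a') \<cdot> (transpose_op B b' \<cdot> g)))
    has_sum fs_functional B T (fs_mult (fs_star u) v)) B"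
    if v: "v \<in> formal_sums B" for v :: "('a, 'h) formal_sum"
    using assms
  proof (induction u)
    case (Cons p u)
    obtain a b where p: "p = (a, b)" by fastforce
    have "b \<in> trace_class B" "u \<in> formal_sums B" using Cons.prems by (auto simp: p)
    with Cons.IH inner[OF _ v] show ?case
      by (simp add: p fs_mult_simps) (intro has_sum_add)
  qed (simp add: fs_mult_simps)
  from this[OF assms] show ?thesis .
qed

end

section \<open>Completely positive maps are bounded\<close>

lemma bounded_linear_star: "bounded_linear (star :: 'a::cstar_algebra \<Rightarrow> 'a)"
  by (rule bounded_linear_intro[where K = 1]) (simp_all add: star_add)

definition left_mult :: "'a::cstar_algebra \<Rightarrow> 'a endo" where
  "left_mult a = Endo (Blinfun (\<lambda>x. a * x))"

lemma left_mult_apply [simp]: "endo_apply (left_mult a) x = a * x"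
  by (simp add: left_mult_def bounded_linear_Blinfun_apply bounded_linear_mult_right)

lemma left_mult_simps:
  "left_mult (a + b) = left_mult a + left_mult b"
  "left_mult (a - b) = left_mult a - left_mult b"
  "left_mult (r *\<^sub>R a) = r *\<^sub>R left_mult a"
  "left_mult (a * b) = left_mult a * left_mult b"
  "left_mult 0 = 0"
  by (rule endo_eqI; simp add: algebra_simps)+

lemma norm_left_mult [simp]: "norm (left_mult a) = norm a"
proof (rule antisym)
  show "norm (left_mult a) \<le> norm a"
    by (rule norm_endo_bound) (simp_all add: norm_mult_ineq)
  have "norm a * norm a = norm (endo_apply (left_mult a) (star a))"
    using norm_star_mult_self[of "star a"] by (simp add: star_star power2_eq_square)
  also have "\<dots> \<le> norm (left_mult a) * norm a" using norm_endo_apply[of "left_mult a" "star a"] by simp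
  finally show "norm a \<le> norm (left_mult a)" by (cases "norm a = 0") auto
qed

lemma bounded_linear_left_mult: "bounded_linear left_mult"
  by (rule bounded_linear_intro[where K = 1]) (simp_all add: left_mult_simps)

lemma left_mult_inject: "left_mult a = left_mult b \<longleftrightarrow> a = b"
  by (metis left_mult_simps(2) norm_left_mult right_minus_eq norm_eq_zero)

text \<open>Operators on the C*-algebra that are self-adjoint for the algebra-valued inner product $y^* z$.\<close>

definition star_hermitian :: "'a::cstar_algebra endo set" where
  "star_hermitian = {w. \<forall>y z. star (endo_apply w y) * z = star y * endo_apply w z}"

lemma star_hermitianD: "w \<in> star_hermitian \<Longrightarrow> star (endo_apply w y) * z = star y * endo_apply w z"
  by (simp add: star_hermitian_def)

lemma closed_star_hermitian: "closed star_hermitian"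
  unfolding star_hermitian_def
  by (intro closed_Collect_all closed_Collect_eq continuous_intros
      bounded_linear.continuous_on[OF bounded_linear_star])

lemma subspace_star_hermitian: "subspace star_hermitian"
  by (auto simp: subspace_def star_hermitian_def star_add distrib_left distrib_right)

lemma power_star_hermitian:
  assumes "w \<in> star_hermitian"
  shows "w ^ n \<in> star_hermitian"
proof (induction n)
  case (Suc n)
  have "endo_apply w (endo_apply (w ^ n) y) = endo_apply (w ^ n) (endo_apply w y)" for y
    by (metis endo_apply_simps(5) power_commutes)
  then show ?case using Suc assms by (simp add: star_hermitian_def)
qed (simp add: star_hermitian_def)

lemma one_star_hermitian: "1 \<in> star_hermitian"
  by (simp add: star_hermitian_def)

lemma left_mult_star_hermitian: "star a = a \<Longrightarrow> left_mult a \<in> star_hermitian"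
  by (simp add: star_hermitian_def star_mult mult.assoc)

lemma norm_square_star_hermitian:
  assumes w: "w \<in> star_hermitian"
  shows "norm (w * w) = (norm w)\<^sup>2"
proof (rule antisym)
  show "norm (w * w) \<le> (norm w)\<^sup>2" using norm_mult_ineq[of w w] by (simp add: power2_eq_square)
  have "norm w \<le> sqrt (norm (w * w))"
  proof (rule norm_endo_bound)
    fix y
    have "(norm (endo_apply w y))\<^sup>2 = norm (star y * endo_apply (w * w) y)"
      unfolding norm_star_mult_self[symmetric] star_hermitianD[OF w] by simp
    also have "\<dots> \<le> norm (star y) * norm (endo_apply (w * w) y)" by (rule norm_mult_ineq)
    also have "\<dots> \<le> norm (star y) * (norm (w * w) * norm y)" by (intro mult_left_mono norm_endo_apply) simp
    also have "\<dots> = (sqrt (norm (w * w)) * norm y)\<^sup>2" by (simp add: power2_eq_square)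
    finally show "norm (endo_apply w y) \<le> sqrt (norm (w * w)) * norm y"
      by (rule power2_le_imp_le) simp
  qed simp
  then have "(norm w)\<^sup>2 \<le> (sqrt (norm (w * w)))\<^sup>2" by (intro power_mono) auto
  then show "(norm w)\<^sup>2 \<le> norm (w * w)" by simp
qed

lemma norm_power_star_hermitian:
  assumes w: "w \<in> star_hermitian"
  shows "norm (w ^ (2 ^ m)) = norm w ^ (2 ^ m)"
proof (induction m)
  case (Suc m)
  have "w ^ (2 ^ Suc m) = w ^ (2 ^ m) * w ^ (2 ^ m)" by (simp add: mult_2 power_add)
  then show ?case
    using norm_square_star_hermitian[OF power_star_hermitian[OF w]] Suc
    by (simp add: power_even_eq mult_2 power_add power2_eq_square)
qed simp

text \<open>With $k = \sqrt{1 - w^2}$ the operators $w \pm i k$ preserve the norm, and $k$ is a multiple of their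
  difference; hence $k$ and $k^2$ are contractions.\<close>

lemma norm_one_minus_square:
  assumes w: "w \<in> star_hermitian" and n: "norm w \<le> 1"
  shows "norm (1 - w * w) \<le> 1"
proof -
  have ww: "norm (w * w) \<le> 1"
    using norm_mult_ineq[of w w] mult_mono[OF n n] by simp
  have ww_h: "w * w \<in> star_hermitian"
    using power_star_hermitian[OF w, of 2] by (simp add: power2_eq_square)
  define k where "k = sqrt_series (w * w)"
  have kk: "k * k = 1 - w * w" unfolding k_def by (rule sqrt_series_square[OF ww])
  have kw: "k * w = w * k" unfolding k_def by (rule sqrt_series_commutes[OF ww]) (simp add: mult.assoc)
  have kh: "k \<in> star_hermitian" unfolding k_def
    by (intro sqrt_series_mem ww closed_star_hermitian subspace_star_hermitian power_star_hermitian ww_h)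
  have kw': "endo_apply k (endo_apply w y) = endo_apply w (endo_apply k y)" for y
    using arg_cong[OF kw, of "\<lambda>x. endo_apply x y"] by simp
  have kk': "endo_apply k (endo_apply k y) = y - endo_apply w (endo_apply w y)" for y
    using arg_cong[OF kk, of "\<lambda>x. endo_apply x y"] by simp
  have unitary: "norm (endo_apply w y + c *\<^sub>C endo_apply k y) = norm y" if c: "cnj c = - c" "c * c = - 1" for c y
  proof -
    let ?u = "endo_apply w y + c *\<^sub>C endo_apply k y"
    have "star ?u * ?u = star y * y"
      using c
      by (simp add: star_add star_scaleC distrib_left distrib_right mult_scaleC_left mult_scaleC_right
          star_hermitianD[OF w] star_hermitianD[OF kh] kw' kk' scaleC_scaleC right_diff_distrib
          left_diff_distrib cv.scale_right_diff_distrib scaleC_one)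
    then have "(norm ?u)\<^sup>2 = (norm y)\<^sup>2" by (metis norm_star_mult_self)
    then show ?thesis by (simp add: power2_eq_iff_nonneg)
  qed
  have "norm k \<le> 1"
  proof (rule norm_endo_bound)
    fix y
    let ?p = "endo_apply w y + \<i> *\<^sub>C endo_apply k y" and ?m = "endo_apply w y + (- \<i>) *\<^sub>C endo_apply k y"
    have "?p - ?m = \<i> *\<^sub>C endo_apply k y - (- \<i>) *\<^sub>C endo_apply k y"
      by (simp only: add_diff_cancel_left)
    also have "\<dots> = (\<i> - - \<i>) *\<^sub>C endo_apply k y"
      by (rule cv.scale_left_diff_distrib[symmetric])
    finally have "2 * norm (endo_apply k y) = norm (?p - ?m)"
      by (simp only: norm_scaleC) (simp add: norm_mult flip: mult_2)
    also have "\<dots> \<le> norm ?p + norm ?m" by (rule norm_triangle_ineq4)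
    also have "\<dots> = 2 * norm y" using unitary[of "\<i>" y] unitary[of "- \<i>" y] by simp
    finally show "norm (endo_apply k y) \<le> 1 * norm y" by simp
  qed simp
  then show ?thesis
    unfolding kk[symmetric] using norm_mult_ineq[of k k] mult_mono[of "norm k" 1 "norm k" 1] by simp
qed

text \<open>The positive elements of norm at most two, described without reference to the spectrum.  That
  infinite convex combinations stay in this set is immediate from the description.\<close>

definition pos_unit :: "'a::cstar_algebra set" where
  "pos_unit = {x. star x = x \<and> norm (1 - left_mult x) \<le> 1}"

lemma norm_pos_unit: "x \<in> pos_unit \<Longrightarrow> norm x \<le> 2"
  using norm_triangle_ineq4[of 1 "1 - left_mult x"] norm_one_le[where 'a = "'a endo"]
  by (simp add: pos_unit_def)

lemma zero_pos_unit: "0 \<in> pos_unit"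
  by (simp add: pos_unit_def left_mult_simps norm_one_le)

lemma pos_unit_convex_series:
  fixes x :: "nat \<Rightarrow> 'a::cstar_algebra"
  assumes x: "\<And>n. x n \<in> pos_unit"
  shows "summable (\<lambda>n. (1/2) ^ Suc n *\<^sub>R x n)" "(\<Sum>n. (1/2) ^ Suc n *\<^sub>R x n) \<in> pos_unit"
proof -
  have half: "(\<lambda>n. (1/2 :: real) ^ Suc n) sums 1" by (rule power_half_series)
  show s: "summable (\<lambda>n. (1/2) ^ Suc n *\<^sub>R x n)"
  proof (rule summable_norm_cancel, rule summable_comparison_test')
    show "summable (\<lambda>n. (1/2 :: real) ^ Suc n * 2)" using half by (intro summable_mult2) (rule sums_summable)
    show "norm (norm ((1/2) ^ Suc n *\<^sub>R x n)) \<le> (1/2) ^ Suc n * 2" if "0 \<le> n" for n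
      using norm_pos_unit[OF x[of n]] by (simp add: mult_left_mono)
  qed
  let ?y = "\<Sum>n. (1/2) ^ Suc n *\<^sub>R x n"
  have y: "(\<lambda>n. (1/2) ^ Suc n *\<^sub>R x n) sums ?y" by (rule summable_sums[OF s])
  have "(\<lambda>n. star ((1/2) ^ Suc n *\<^sub>R x n)) sums star ?y"
    by (rule bounded_linear.sums[OF bounded_linear_star y])
  moreover have "star ((1/2) ^ Suc n *\<^sub>R x n) = (1/2) ^ Suc n *\<^sub>R x n" for n
    using x[of n] by (simp add: pos_unit_def)
  ultimately have sa: "star ?y = ?y" using y sums_unique2 by (metis (no_types, lifting) sums_cong)
  have "(\<lambda>n. (1/2) ^ Suc n *\<^sub>R (1 :: 'a endo)) sums (1 *\<^sub>R 1)"
    by (rule bounded_linear.sums[OF bounded_linear_scaleR_left half])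
  from sums_diff[OF this bounded_linear.sums[OF bounded_linear_left_mult y]]
  have d: "(\<lambda>n. (1/2) ^ Suc n *\<^sub>R (1 - left_mult (x n))) sums (1 - left_mult ?y)"
    by (simp add: left_mult_simps scaleR_diff_right)
  have le: "norm ((1/2) ^ Suc n *\<^sub>R (1 - left_mult (x n))) \<le> (1/2) ^ Suc n" for n
    using x[of n] by (simp add: pos_unit_def mult_left_le)
  have sn: "summable (\<lambda>n. norm ((1/2) ^ Suc n *\<^sub>R (1 - left_mult (x n))))"
    by (rule summable_comparison_test'[OF sums_summable[OF half]]) (use le in auto)
  have "norm (1 - left_mult ?y) \<le> (\<Sum>n. norm ((1/2) ^ Suc n *\<^sub>R (1 - left_mult (x n))))"
    using summable_norm[OF sn] d by (simp add: sums_iff)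
  also have "\<dots> \<le> (\<Sum>n. (1/2) ^ Suc n)" by (intro suminf_le le sn sums_summable[OF half])
  also have "\<dots> = 1" using half by (simp add: sums_iff)
  finally show "?y \<in> pos_unit" using sa by (simp add: pos_unit_def)
qed

lemma sqrt_series_one: "sqrt_series (1 :: 'a::banach endo) = 0"
proof -
  define c where "c = (\<Sum>n. sqrt_coeff n)"
  have "(\<lambda>n. sqrt_coeff n) sums c"
    unfolding c_def by (rule summable_sums, rule summable_norm_cancel) (simp add: summable_abs_sqrt_coeff)
  then have "(\<lambda>n. sqrt_coeff n *\<^sub>R (1 :: 'a endo)) sums (c *\<^sub>R 1)"
    by (rule bounded_linear.sums[OF bounded_linear_scaleR_left])
  then have eq: "sqrt_series (1 :: 'a endo) = c *\<^sub>R 1"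
    using sqrt_series_sums[OF norm_one_le, where 'a = "'a endo"] by (simp add: sums_unique2)
  have "(c *\<^sub>R (1 :: 'a endo)) * (c *\<^sub>R 1) = 0"
    unfolding eq[symmetric] sqrt_series_square[OF norm_one_le] by simp
  then show ?thesis unfolding eq by simp
qed

lemma left_mult_convergent:
  assumes "(\<lambda>n. left_mult (z n)) \<longlonglongrightarrow> w"
  obtains z' where "z \<longlonglongrightarrow> z'" "w = left_mult z'"
proof -
  have "Cauchy (\<lambda>n. left_mult (z n))" using assms by (rule LIMSEQ_imp_Cauchy)
  then have "Cauchy z" by (simp add: Cauchy_def dist_norm flip: left_mult_simps)
  then obtain z' where z': "z \<longlonglongrightarrow> z'" by (auto simp: Cauchy_convergent_iff convergent_def)
  then have "(\<lambda>n. left_mult (z n)) \<longlonglongrightarrow> left_mult z'"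
    by (rule bounded_linear.tendsto[OF bounded_linear_left_mult])
  with assms z' that show ?thesis using LIMSEQ_unique by blast
qed

text \<open>The square root of a positive element lies in the algebra itself, although the algebra need not
  have a unit: the constant terms of the series add up to zero.\<close>

lemma pos_unit_sqrt:
  assumes x: "x \<in> pos_unit"
  obtains z where "z \<in> pos_unit" "z * z = x" "\<And>a. a * x = x * a \<Longrightarrow> a * z = z * a"
proof -
  define k where "k = 1 - left_mult x"
  have k: "norm k \<le> 1" and sx: "star x = x" using x by (auto simp: pos_unit_def k_def)
  have "\<exists>c. k ^ n - 1 = left_mult c \<and> star c = c \<and> c * x = x * c" for n
  proof (induction n)
    case (Suc n)
    then obtain c where c: "k ^ n - 1 = left_mult c" "star c = c" "c * x = x * c" by blast
    have "k ^ Suc n - 1 = (k ^ n - 1) * k + (k - 1)" by (simp add: algebra_simps power_commutes)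
    also have "\<dots> = left_mult (c - c * x - x)"
      unfolding c(1) by (simp add: k_def left_mult_simps algebra_simps)
    finally have "k ^ Suc n - 1 = left_mult (c - c * x - x)" .
    moreover have "star (c - c * x - x) = c - c * x - x"
      by (simp add: star_diff star_mult c(2) sx) (simp add: c(3))
    moreover have "(c - c * x - x) * x = x * (c - c * x - x)"
      by (simp add: left_diff_distrib right_diff_distrib c(3) mult.assoc)
    ultimately show ?case by blast
  qed (auto intro!: exI[of _ 0] simp: left_mult_simps)
  then obtain c where c: "\<And>n. k ^ n - 1 = left_mult (c n)" "\<And>n. star (c n) = c n" by metis
  have "(\<lambda>n. sqrt_coeff n *\<^sub>R k ^ n - sqrt_coeff n *\<^sub>R 1 ^ n) sums (sqrt_series k - sqrt_series 1)"
    by (intro sums_diff sqrt_series_sums k norm_one_le)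
  then have "(\<lambda>n. left_mult (sqrt_coeff n *\<^sub>R c n)) sums sqrt_series k"
    unfolding sqrt_series_one by (simp add: left_mult_simps flip: c(1) scaleR_diff_right)
  then have "(\<lambda>N. left_mult (\<Sum>n<N. sqrt_coeff n *\<^sub>R c n)) \<longlonglongrightarrow> sqrt_series k"
    by (simp add: sums_def linear_sum[OF bounded_linear.linear[OF bounded_linear_left_mult]])
  then obtain z where z: "(\<lambda>N. \<Sum>n<N. sqrt_coeff n *\<^sub>R c n) \<longlonglongrightarrow> z" "sqrt_series k = left_mult z"
    by (rule left_mult_convergent)
  have "(\<lambda>N. star (\<Sum>n<N. sqrt_coeff n *\<^sub>R c n)) \<longlonglongrightarrow> star z"
    by (rule bounded_linear.tendsto[OF bounded_linear_star z(1)])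
  moreover have "star (\<Sum>n<N. sqrt_coeff n *\<^sub>R c n) = (\<Sum>n<N. sqrt_coeff n *\<^sub>R c n)" for N
    by (simp add: linear_sum[OF bounded_linear.linear[OF bounded_linear_star]] c(2))
  ultimately have sz: "star z = z" using z(1) LIMSEQ_unique by simp
  show ?thesis
  proof (rule that)
    show "z \<in> pos_unit"
      using norm_one_minus_sqrt_series[OF k] sz by (simp add: pos_unit_def z(2))
    have "left_mult (z * z) = left_mult x"
      unfolding left_mult_simps z(2)[symmetric] sqrt_series_square[OF k] by (simp add: k_def)
    then show "z * z = x" by (simp add: left_mult_inject)
    fix a assume a: "a * x = x * a"
    have "k * left_mult a = left_mult a * k"
      by (simp add: k_def left_diff_distrib right_diff_distrib a flip: left_mult_simps(4))
    from sqrt_series_commutes[OF k this] show "a * z = z * a"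
      unfolding z(2) left_mult_simps(4)[symmetric] left_mult_inject ..
  qed
qed

text \<open>The relation $q^2 = p q$ makes the powers of $1 - q$ grow at most linearly, and for a self-adjoint
  element this forces $\|1 - q\| \leq 1$.\<close>

lemma norm_one_minus_le_of_square:
  assumes q: "q \<in> star_hermitian" and p: "norm (1 - p) \<le> 1" and qq: "q * q = p * q"
  shows "norm (1 - q) \<le> 1"
proof (rule ccontr)
  define c where "c = norm (1 - q)"
  assume "\<not> norm (1 - q) \<le> 1"
  then have c: "c > 1" by (simp add: c_def)
  have "\<exists>s. (1 - q) ^ n = 1 - s * q \<and> norm s \<le> real n" for n
  proof (induction n)
    case (Suc n)
    then obtain s where s: "(1 - q) ^ n = 1 - s * q" "norm s \<le> real n" by blast
    have "(1 - q) ^ Suc n = (1 - s * q) * (1 - q)" by (simp add: s(1) power_Suc2 del: power_Suc)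
    also have "\<dots> = 1 - (1 + s * (1 - p)) * q"
      by (simp add: algebra_simps qq)
    finally have "(1 - q) ^ Suc n = 1 - (1 + s * (1 - p)) * q" .
    moreover have "norm (1 + s * (1 - p)) \<le> 1 + norm s * norm (1 - p)"
      using norm_triangle_ineq[of 1 "s * (1 - p)"] norm_mult_ineq[of s "1 - p"]
        norm_one_le[where 'a = "'a endo"] by linarith
    moreover have "norm s * norm (1 - p) \<le> real n * 1" using s p by (intro mult_mono) auto
    ultimately show ?case by (intro exI[of _ "1 + s * (1 - p)"]) auto
  qed (auto intro!: exI[of _ 0])
  then obtain s where s: "\<And>n. (1 - q) ^ n = 1 - s n * q" "\<And>n. norm (s n) \<le> real n" by metis
  have lin: "norm ((1 - q) ^ n) \<le> 1 + real n * norm q" for n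
  proof -
    have "norm ((1 - q) ^ n) \<le> norm (1 :: 'a endo) + norm (s n * q)" unfolding s by (rule norm_triangle_ineq4)
    also have "\<dots> \<le> 1 + norm (s n) * norm q" by (intro add_mono norm_one_le norm_mult_ineq)
    also have "\<dots> \<le> 1 + real n * norm q" using s(2) by (intro add_left_mono mult_right_mono) auto
    finally show ?thesis .
  qed
  have h: "1 - q \<in> star_hermitian" by (intro subspace_diff subspace_star_hermitian one_star_hermitian q)
  have bound: "real m * (c - 1)\<^sup>2 \<le> 1 + 2 * norm q" for m
  proof -
    define N where "N = (2::nat) ^ m"
    have N: "real N \<ge> 1" "real m \<le> real N" by (simp_all add: N_def less_imp_le)
    have "1 + real N * (c - 1) \<le> (1 + (c - 1)) ^ N" using c by (intro Bernoulli_inequality) simp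
    then have "real N * (c - 1) \<le> c ^ N" by simp
    then have "(real N * (c - 1))\<^sup>2 \<le> (c ^ N)\<^sup>2" using c N by (intro power_mono) auto
    also have "\<dots> = norm ((1 - q) ^ (2 ^ Suc m))"
      unfolding norm_power_star_hermitian[OF h] by (simp add: c_def N_def power_mult[symmetric] mult.commute)
    also have "\<dots> \<le> 1 + 2 * real N * norm q" using lin[of "2 ^ Suc m"] by (simp add: N_def)
    also have "\<dots> \<le> real N * (1 + 2 * norm q)" using N by (simp add: algebra_simps)
    finally have "real N * (real N * (c - 1)\<^sup>2) \<le> real N * (1 + 2 * norm q)"
      by (simp add: power2_eq_square mult_ac)
    then have "real N * (c - 1)\<^sup>2 \<le> 1 + 2 * norm q" using N by (subst (asm) mult_le_cancel_left_pos) auto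
    moreover have "real m * (c - 1)\<^sup>2 \<le> real N * (c - 1)\<^sup>2" using N by (intro mult_right_mono) auto
    ultimately show ?thesis by linarith
  qed
  obtain m :: nat where "(1 + 2 * norm q) / (c - 1)\<^sup>2 < real m" using reals_Archimedean2 by blast
  then have "1 + 2 * norm q < real m * (c - 1)\<^sup>2" using c by (simp add: divide_less_eq)
  with bound[of m] show False by simp
qed

text \<open>Here $p = |a|$, the square root of $a^2$, and $q = (|a| - a) / 2$.  The positivity of $q$ follows
  from $q^2 = p q$, without functional calculus.\<close>

lemma self_adjoint_decomposition:
  assumes sa: "star a = a" and n: "norm a \<le> 1"
  obtains p q where "p \<in> pos_unit" "q \<in> pos_unit" "a = p - 2 *\<^sub>R q"
proof -
  have "norm (1 - left_mult a * left_mult a) \<le> 1"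
    using n by (intro norm_one_minus_square left_mult_star_hermitian sa) simp
  then have "a * a \<in> pos_unit" by (simp add: pos_unit_def left_mult_simps star_mult sa)
  then obtain p where p: "p \<in> pos_unit" "p * p = a * a" and comm: "\<And>b. b * (a * a) = (a * a) * b \<Longrightarrow> b * p = p * b"
    by (rule pos_unit_sqrt) blast
  have ap: "a * p = p * a" by (rule comm) (simp add: mult.assoc)
  define q where "q = (1/2) *\<^sub>R (p - a)"
  have sq: "star q = q" using p(1) sa by (simp add: q_def star_diff pos_unit_def)
  have "q * q = (1/4) *\<^sub>R ((p - a) * (p - a))" by (simp add: q_def)
  also have "(p - a) * (p - a) = 2 *\<^sub>R (p * (p - a))"
    by (simp add: left_diff_distrib right_diff_distrib p(2) ap scaleR_2)
  also have "(1/4) *\<^sub>R 2 *\<^sub>R (p * (p - a)) = p * q" by (simp add: q_def)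
  finally have "q * q = p * q" .
  then have "left_mult q * left_mult q = left_mult p * left_mult q" by (simp flip: left_mult_simps)
  moreover have "norm (1 - left_mult p) \<le> 1" using p(1) by (simp add: pos_unit_def)
  ultimately have "norm (1 - left_mult q) \<le> 1"
    using norm_one_minus_le_of_square[OF left_mult_star_hermitian[OF sq]] by blast
  then have "q \<in> pos_unit" using sq by (simp add: pos_unit_def)
  with p(1) show ?thesis by (rule that) (simp add: q_def)
qed

lemma completely_positive_square:
  assumes T: "completely_positive T" and z: "star z = z"
  shows "positive_op (T (z * z))"
proof -
  have "positive_matrix 1 (\<lambda>i j. z * z)"
    unfolding positive_matrix_def by (intro exI[of _ "\<lambda>_ _. z"]) (simp add: z)
  then have "positive_op_matrix 1 (\<lambda>i j. T (z * z))"
    using T spec[of _ "\<lambda>i j. z * z"] unfolding completely_positive_def by fast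
  then have "cinner \<xi> (T (z * z) \<cdot> \<xi>) \<in> \<real>\<^sub>\<ge>\<^sub>0" for \<xi>
    unfolding positive_op_matrix_def by (auto dest: spec[of _ "\<lambda>_. \<xi>"])
  then show ?thesis using T by (auto simp: positive_op_def completely_positive_def)
qed

lemma completely_positive_pos_unit:
  assumes "completely_positive T" "x \<in> pos_unit"
  shows "positive_op (T x)"
proof -
  obtain z where "z \<in> pos_unit" "z * z = x" using pos_unit_sqrt[OF assms(2)] by blast
  then show ?thesis using completely_positive_square[OF assms(1), of z] by (simp add: pos_unit_def)
qed

lemma positive_op_norm_mono:
  assumes "positive_op x" "positive_op y"
  shows "norm x \<le> norm (x + y)"
proof (rule positive_op_norm_le[OF assms(1)])
  fix \<xi>
  have "Re (cinner \<xi> (x \<cdot> \<xi>)) \<le> Re (cinner \<xi> ((x + y) \<cdot> \<xi>))"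
    using positive_opD(2)[OF assms(2), of \<xi>] by (simp add: plus_blinfun.rep_eq cinner_add_right)
  also have "\<dots> \<le> norm (x + y) * (norm \<xi>)\<^sup>2" by (rule positive_op_form_le)
  finally show "Re (cinner \<xi> (x \<cdot> \<xi>)) \<le> norm (x + y) * (norm \<xi>)\<^sup>2" .
qed simp

text \<open>A gliding hump: if the values on positive elements \<open>x n\<close> grew fast, the value on
  $\sum_n 2^{-n-1} x_n$ would dominate all of them.\<close>

lemma completely_positive_bounded_on_pos_unit:
  fixes T :: "'a::cstar_algebra \<Rightarrow> ('h::complex_hilbert \<Rightarrow>\<^sub>L 'h)"
  assumes T: "completely_positive T"
  obtains C where "\<And>x. x \<in> pos_unit \<Longrightarrow> norm (T x) \<le> C"
proof -
  have lin: "clinear T" using T by (simp add: completely_positive_def)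
  have "\<exists>C. \<forall>x\<in>pos_unit. norm (T x) \<le> C"
  proof (rule ccontr)
    assume "\<not> ?thesis"
    then have "\<exists>x\<in>pos_unit. norm (T x) > 4 ^ n" for n :: nat by (meson not_le)
    then obtain x where x: "\<And>n. x n \<in> pos_unit" "\<And>n. norm (T (x n)) > 4 ^ n" by metis
    define h where "h = (\<Sum>n. (1/2) ^ Suc n *\<^sub>R x n)"
    have le: "2 ^ m \<le> 2 * norm (T h)" for m :: nat
    proof -
      \<comment> \<open>Removing one term keeps the series positive, so \<open>T h\<close> dominates the value at that term.\<close>
      define x' where "x' = x(m := 0)"
      have x': "x' n \<in> pos_unit" for n using x(1) by (simp add: x'_def zero_pos_unit)
      have d: "(1/2) ^ Suc n *\<^sub>R x n - (1/2) ^ Suc n *\<^sub>R x' n = (if n = m then (1/2) ^ Suc m *\<^sub>R x m else 0)" for n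
        by (simp add: x'_def)
      have "(\<lambda>n. (1/2) ^ Suc n *\<^sub>R x n - (1/2) ^ Suc n *\<^sub>R x' n) sums (h - (\<Sum>n. (1/2) ^ Suc n *\<^sub>R x' n))"
        unfolding h_def by (intro sums_diff summable_sums pos_unit_convex_series x x')
      then have "h - (\<Sum>n. (1/2) ^ Suc n *\<^sub>R x' n) = (1/2) ^ Suc m *\<^sub>R x m"
        unfolding d using sums_unique2 sums_single[of m "\<lambda>_. (1/2) ^ Suc m *\<^sub>R x m"] by fast
      then have h: "h = (1/2) ^ Suc m *\<^sub>R x m + (\<Sum>n. (1/2) ^ Suc n *\<^sub>R x' n)"
        by (simp add: algebra_simps)
      have pm: "positive_op ((1/2) ^ Suc m *\<^sub>R T (x m))"
      proof -
        note P = completely_positive_pos_unit[OF T x(1)[of m]]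
        show ?thesis
        proof (rule positive_opI)
          show "(1/2) ^ Suc m *\<^sub>R T (x m) \<in> bounded_ops"
            unfolding scaleR_scaleC by (intro bounded_ops_scaleC positive_opD[OF P])
        qed (use positive_opD(2,3)[OF P] in \<open>simp_all add: scaleR_blinfun.rep_eq\<close>)
      qed
      have "(1/2) ^ Suc m * norm (T (x m)) = norm ((1/2) ^ Suc m *\<^sub>R T (x m))" by simp
      also have "\<dots> \<le> norm ((1/2) ^ Suc m *\<^sub>R T (x m) + T (\<Sum>n. (1/2) ^ Suc n *\<^sub>R x' n))"
        by (intro positive_op_norm_mono pm completely_positive_pos_unit[OF T] pos_unit_convex_series x')
      also have "\<dots> = norm (T h)" unfolding h by (simp add: clinear_add[OF lin] clinear_scaleR[OF lin])
      finally have "norm (T (x m)) \<le> 2 ^ Suc m * norm (T h)" by (simp add: field_simps)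
      then have "(4::real) ^ m \<le> 2 ^ m * (2 * norm (T h))" using x(2)[of m] by simp
      moreover have "(4::real) ^ m = 2 ^ m * 2 ^ m" by (simp flip: power_mult_distrib)
      ultimately show ?thesis by simp
    qed
    obtain m :: nat where "2 * norm (T h) < real m" using reals_Archimedean2 by blast
    also have "real m < 2 ^ m" by simp
    finally show False using le[of m] by simp
  qed
  then show ?thesis using that by blast
qed

text \<open>Complete positivity is a purely algebraic condition, so continuity has to be derived.\<close>

lemma completely_positive_bounded:
  fixes T :: "'a::cstar_algebra \<Rightarrow> ('h::complex_hilbert \<Rightarrow>\<^sub>L 'h)"
  assumes T: "completely_positive T"
  shows "T \<in> bounded_maps"
proof -
  have lin: "clinear T" using T by (simp add: completely_positive_def)
  obtain C where C: "\<And>x. x \<in> pos_unit \<Longrightarrow> norm (T x) \<le> C"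
    using completely_positive_bounded_on_pos_unit[OF T] by blast
  have C0: "0 \<le> C" using C[OF zero_pos_unit] norm_ge_zero order_trans by blast
  have sa: "norm (T a) \<le> 3 * C * norm a" if a: "star a = a" for a
  proof (cases "a = 0")
    case False
    define b where "b = (1 / norm a) *\<^sub>R a"
    have "star b = b" "norm b \<le> 1" using a False by (simp_all add: b_def)
    then obtain p q where pq: "p \<in> pos_unit" "q \<in> pos_unit" "b = p - 2 *\<^sub>R q"
      by (rule self_adjoint_decomposition)
    have "norm (T b) \<le> norm (T p) + norm (2 *\<^sub>R T q)"
      unfolding pq(3) clinear_diff[OF lin] clinear_scaleR[OF lin] by (rule norm_triangle_ineq4)
    also have "\<dots> \<le> 3 * C" using C[OF pq(1)] C[OF pq(2)] by simp
    finally have "norm (T b) \<le> 3 * C" .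
    moreover have "T a = norm a *\<^sub>R T b" using False by (simp add: b_def clinear_scaleR[OF lin])
    ultimately show ?thesis by (simp add: mult.commute mult_left_mono)
  qed (simp add: clinear_0[OF lin])
  have "norm (T a) \<le> (6 * C) * norm a" for a
  proof -
    define b where "b = (1/2) *\<^sub>R (a + star a)"
    define c where "c = (- \<i> / 2) *\<^sub>C (a - star a)"
    have b: "star b = b" by (simp add: b_def star_add star_star add.commute)
    have c: "star c = c"
    proof -
      have "star c = (\<i> / 2) *\<^sub>C (star a - a)" by (simp add: c_def star_scaleC star_diff star_star)
      also have "\<dots> = (\<i> / 2) *\<^sub>C (- (a - star a))" by simp
      also have "\<dots> = c" unfolding cv.scale_minus_right by (simp add: c_def flip: cv.scale_minus_left)
      finally show ?thesis .
    qed
    have "\<i> *\<^sub>C c = (1/2) *\<^sub>R (a - star a)" by (simp add: c_def scaleC_scaleC scaleR_scaleC)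
    then have a: "a = b + \<i> *\<^sub>C c"
      by (simp add: b_def scaleR_right_diff_distrib scaleR_add_right flip: scaleR_left.add)
    have nb: "norm b \<le> norm a" using norm_triangle_ineq[of a "star a"] by (simp add: b_def)
    have nc: "norm c \<le> norm a" using norm_triangle_ineq4[of a "star a"] by (simp add: c_def norm_scaleC norm_divide)
    have "T a = T b + \<i> *\<^sub>C T c"
      by (subst a) (simp only: clinear_add[OF lin] clinear_scaleC[OF lin])
    then have "norm (T a) \<le> norm (T b) + norm (T c)"
      using norm_triangle_ineq[of "T b" "\<i> *\<^sub>C T c"] by (simp add: norm_scaleC)
    also have "\<dots> \<le> 3 * C * norm b + 3 * C * norm c" by (intro add_mono sa b c)
    also have "\<dots> \<le> 3 * C * norm a + 3 * C * norm a" using C0 by (intro add_mono mult_left_mono nb nc) auto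
    finally show ?thesis by simp
  qed
  then have "bounded_linear T" by (rule clinear_bounded_linear[OF lin])
  then show ?thesis using T by (simp add: bounded_maps_def completely_positive_def)
qed

section \<open>The positive cone and completely positive maps\<close>

lemma nonneg_Reals_sum:
  fixes f :: "'i \<Rightarrow> complex"
  shows "(\<And>i. i \<in> I \<Longrightarrow> f i \<in> \<real>\<^sub>\<ge>\<^sub>0) \<Longrightarrow> sum f I \<in> \<real>\<^sub>\<ge>\<^sub>0"
  by (simp add: complex_nonneg_Reals_iff sum_nonneg)

lemma nonneg_Reals_has_sum:
  fixes f :: "'i \<Rightarrow> complex"
  assumes "(f has_sum s) A" "\<And>i. i \<in> A \<Longrightarrow> f i \<in> \<real>\<^sub>\<ge>\<^sub>0"
  shows "s \<in> \<real>\<^sub>\<ge>\<^sub>0"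
proof -
  have "0 \<le> Re s"
    using has_sum_Re[OF assms(1)] assms(2) by (auto intro: has_sum_nonneg simp: complex_nonneg_Reals_iff)
  moreover have "((\<lambda>i. Im (f i)) has_sum 0) A"
    using assms(2) by (intro has_sum_0) (simp add: complex_nonneg_Reals_iff)
  then have "Im s = 0" using has_sum_Im[OF assms(1)] has_sum_unique by blast
  ultimately show ?thesis by (simp add: complex_nonneg_Reals_iff)
qed

text \<open>The matrix $a_i^* a_j$ is $Z^* Z$ for a $Z$ with a single nonzero row.\<close>

lemma completely_positive_form:
  fixes n :: nat
  assumes "completely_positive T"
  shows "(\<Sum>i<n. \<Sum>j<n. cinner (\<xi> i) (T (star (a i) * a j) \<cdot> (\<xi> j))) \<in> \<real>\<^sub>\<ge>\<^sub>0"
proof -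
  have "positive_matrix n (\<lambda>i j. star (a i) * a j)"
    unfolding positive_matrix_def
  proof (intro exI[of _ "\<lambda>k i. if k = 0 then a i else 0"] allI impI)
    fix i j assume "i < n" "j < n"
    have "(\<Sum>k<n. star (if k = 0 then a i else 0) * (if k = 0 then a j else 0))
        = (\<Sum>k<n. if k = 0 then star (a i) * a j else 0)"
      by (intro sum.cong) auto
    then show "star (a i) * a j = (\<Sum>k<n. star (if k = 0 then a i else 0) * (if k = 0 then a j else 0))"
      using \<open>i < n\<close> by simp
  qed
  then have "positive_op_matrix n (\<lambda>i j. T (star (a i) * a j))"
    using assms spec[of _ "\<lambda>i j. star (a i) * a j"] unfolding completely_positive_def by fast
  then show ?thesis by (simp add: positive_op_matrix_def)
qed

context bounded_map
begin

lemma fs_functional_square_nonneg: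
  assumes cp: "completely_positive T" and u: "u \<in> formal_sums B"
  shows "fs_functional B T (fs_mult (fs_star u) u) \<in> \<real>\<^sub>\<ge>\<^sub>0"
proof (rule nonneg_Reals_has_sum[OF fs_functional_square_has_sum[OF u]])
  fix g
  define a where "a = (\<lambda>i. fst (u ! i))"
  define \<xi> where "\<xi> = (\<lambda>i. transpose_op B (snd (u ! i)) \<cdot> g)"
  have "(\<Sum>(a, b)\<leftarrow>u. \<Sum>(a', b')\<leftarrow>u. cinner (transpose_op B b \<cdot> g)
        (T (star a * a') \<cdot> (transpose_op B b' \<cdot> g)))
      = (\<Sum>i<length u. \<Sum>j<length u. cinner (\<xi> i) (T (star (a i) * a j) \<cdot> (\<xi> j)))"
    by (simp add: sum_list_sum_nth case_prod_beta a_def \<xi>_def atLeast0LessThan)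
  also have "\<dots> \<in> \<real>\<^sub>\<ge>\<^sub>0" by (rule completely_positive_form[OF cp])
  finally show "(\<Sum>(a, b)\<leftarrow>u. \<Sum>(a', b')\<leftarrow>u. cinner (transpose_op B b \<cdot> g)
        (T (star a * a') \<cdot> (transpose_op B b' \<cdot> g))) \<in> \<real>\<^sub>\<ge>\<^sub>0" .
qed

lemma tilde_sums_of_squares_nonneg:
  assumes cp: "completely_positive T" and s: "s \<in> sums_of_squares B"
  shows "s \<in> proj_tensor B" "tilde B T s \<in> \<real>\<^sub>\<ge>\<^sub>0"
proof -
  obtain zs where zs: "set zs \<subseteq> proj_tensor B"
    and s_eq: "s = foldr (pt_add B) (map (\<lambda>z. pt_mult B (pt_star B z) z) zs) (pt_zero B)"
    using s by (auto simp: sums_of_squares_def)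
  have "s \<in> proj_tensor B \<and> tilde B T s \<in> \<real>\<^sub>\<ge>\<^sub>0"
    unfolding s_eq using zs
  proof (induction zs)
    case Nil
    then show ?case by (simp add: tilde_zero)
  next
    case (Cons z zs)
    then have "z \<in> proj_tensor B" by simp
    then obtain X where X: "X \<in> cauchy_seqs B" "z = pt_class B X" by (rule proj_tensorE)
    have "tilde B T (pt_mult B (pt_star B z) z) \<in> \<real>\<^sub>\<ge>\<^sub>0"
    proof (rule closed_sequentially)
      show "closed (\<real>\<^sub>\<ge>\<^sub>0 :: complex set)" by (rule closed_nonneg_Reals_complex)
      show "(\<lambda>n. fs_functional B T (fs_mult (fs_star (X n)) (X n))) \<longlonglongrightarrow> tilde B T (pt_mult B (pt_star B z) z)"
        unfolding X(2) by (rule tilde_square[OF X(1)])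
      show "fs_functional B T (fs_mult (fs_star (X n)) (X n)) \<in> \<real>\<^sub>\<ge>\<^sub>0" for n
        by (intro fs_functional_square_nonneg cp cauchy_seqs_formal_sums X)
    qed
    moreover have "pt_mult B (pt_star B z) z \<in> proj_tensor B"
      unfolding X(2) by (rule tilde_square[OF X(1)])
    ultimately show ?case using Cons by (simp add: tilde_add)
  qed
  then show "s \<in> proj_tensor B" "tilde B T s \<in> \<real>\<^sub>\<ge>\<^sub>0" by simp_all
qed

lemma tilde_C_cp_nonneg:
  assumes cp: "completely_positive T" and z: "z \<in> C_cp B"
  shows "tilde B T z \<in> \<real>\<^sub>\<ge>\<^sub>0"
proof -
  have "tilde B T z \<in> closure \<real>\<^sub>\<ge>\<^sub>0"
    unfolding closure_approachable
  proof (intro allI impI)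
    fix e :: real assume e: "0 < e"
    then have "0 < e / (K + 1)" using K_nonneg by simp
    then obtain s where s: "s \<in> sums_of_squares B" "pt_norm B (pt_diff B z s) < e / (K + 1)"
      using z unfolding C_cp_def by blast
    have n: "cmod (tilde B T z - tilde B T s) \<le> K * pt_norm B (pt_diff B z s)"
      using z by (intro norm_tilde_diff_le tilde_sums_of_squares_nonneg[OF cp s(1)]) (simp add: C_cp_def)
    also have "\<dots> \<le> K * (e / (K + 1))" using K_nonneg s(2) by (intro mult_left_mono) auto
    also have "\<dots> < e" using K_nonneg e by (simp add: divide_less_eq)
    finally show "\<exists>y\<in>\<real>\<^sub>\<ge>\<^sub>0. dist y (tilde B T z) < e"
      using tilde_sums_of_squares_nonneg[OF cp s(1)] by (auto simp: dist_norm norm_minus_commute)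
  qed
  then show ?thesis by (simp add: closure_closed)
qed

lemma square_in_C_cp:
  fixes X :: "nat \<Rightarrow> ('a, 'h) formal_sum"
  assumes X: "X \<in> cauchy_seqs B"
  shows "pt_add B (pt_mult B (pt_star B (pt_class B X)) (pt_class B X)) (pt_zero B) \<in> C_cp B"
proof -
  let ?z = "pt_class B X :: ('a, 'h) tensor"
  let ?s = "pt_add B (pt_mult B (pt_star B ?z) ?z) (pt_zero B)"
  have sq: "?s \<in> sums_of_squares B"
    unfolding sums_of_squares_def using pt_class_in_proj_tensor[OF X]
    by (intro CollectI exI[of _ "[?z]"]) simp
  have pt: "?s \<in> proj_tensor B" by (intro tilde_add tilde_square X tilde_zero)
  then obtain Y where Y: "Y \<in> cauchy_seqs B" "?s = pt_class B Y" by (rule proj_tensorE)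
  have "(\<lambda>n. proj_norm B (fs_diff (Y n) (Y n))) \<longlonglongrightarrow> pt_norm B (pt_diff B ?s ?s)"
    unfolding Y(2) pt_diff_class[OF Y(1) Y(1)] by (intro pt_norm_class cauchy_diff Y)
  then have "pt_norm B (pt_diff B ?s ?s) = 0"
    using fs_dist_refl[OF cauchy_seqs_formal_sums[OF Y(1)]] unfolding fs_dist_def by (simp add: LIMSEQ_const_iff)
  then show ?thesis using pt sq unfolding C_cp_def by force
qed

text \<open>With $b_i^t = \xi_i \langle e, \cdot\rangle$ for a basis vector $e$, only $g = e$ contributes to
  \<open>fs_functional_square_has_sum\<close>, and it contributes the form in question.  So this form is the value
  of \<open>tilde B T\<close> at a square.\<close>

lemma form_nonneg_of_P_cp:
  fixes n :: nat
  assumes P: "T \<in> P_cp B"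
  shows "(\<Sum>i<n. \<Sum>j<n. cinner (\<xi> i) (T (star (a i) * a j) \<cdot> (\<xi> j))) \<in> \<real>\<^sub>\<ge>\<^sub>0"
proof (cases "B = {}")
  case True
  \<comment> \<open>The Hilbert space is zero.\<close>
  then have "\<xi> i = 0" for i by (intro vector_eqI) simp
  then show ?thesis by simp
next
  case False
  then obtain e where e: "e \<in> B" by blast
  have "\<exists>b. b \<in> trace_class B \<and> (\<forall>\<eta>. transpose_op B b \<cdot> \<eta> = cinner e \<eta> *\<^sub>C \<xi> i)" for i
    using rank_one_transpose_exists[OF e, of "\<xi> i"] by metis
  then obtain b where b: "\<And>i. b i \<in> trace_class B"
    "\<And>i \<eta>. transpose_op B (b i) \<cdot> \<eta> = cinner e \<eta> *\<^sub>C \<xi> i" by metis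
  define u where "u = map (\<lambda>i. (a i, b i)) [0..<n]"
  have u: "u \<in> formal_sums B" unfolding u_def by (intro formal_sums_map) (simp add: b)
  let ?S = "\<Sum>i<n. \<Sum>j<n. cinner (\<xi> i) (T (star (a i) * a j) \<cdot> (\<xi> j))"
  let ?X = "\<lambda>n::nat. u"
  have X: "?X \<in> cauchy_seqs B" by (rule cauchy_seqs_const[OF u])
  have term_eq: "(\<Sum>(a, b)\<leftarrow>u. \<Sum>(a', b')\<leftarrow>u. cinner (transpose_op B b \<cdot> g)
        (T (star a * a') \<cdot> (transpose_op B b' \<cdot> g)))
      = (if g = e then ?S else 0)" if "g \<in> B" for g
    unfolding u_def
    by (simp add: comp_def sum_list_sum_nth atLeast0LessThan b clinear_scaleC[OF bounded_opsD[OF T_bounded_ops]]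
        cinner_scaleC_left cinner_scaleC_right cinner_basis[OF e that])
  have "((\<lambda>g. if g = e then ?S else 0) has_sum fs_functional B T (fs_mult (fs_star u) u)) B"
    using fs_functional_square_has_sum[OF u] by (subst (asm) has_sum_cong[OF term_eq]) auto
  moreover have "((\<lambda>g. if g = e then ?S else 0) has_sum ?S) B \<longleftrightarrow> ((\<lambda>g. ?S) has_sum ?S) {e}"
    using e by (intro has_sum_cong_neutral) auto
  then have "((\<lambda>g. if g = e then ?S else 0) has_sum ?S) B"
    by (simp add: has_sum_finiteI)
  ultimately have eq: "fs_functional B T (fs_mult (fs_star u) u) = ?S" by (rule has_sum_unique)
  let ?z = "pt_class B ?X :: ('a, 'h) tensor"
  have "tilde B T (pt_mult B (pt_star B ?z) ?z) = ?S"
    using tilde_square(2)[OF X] unfolding eq by (simp add: LIMSEQ_const_iff)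
  moreover have "tilde B T (pt_add B (pt_mult B (pt_star B ?z) ?z) (pt_zero B)) = tilde B T (pt_mult B (pt_star B ?z) ?z)"
    using tilde_add(2)[OF tilde_square(1)[OF X] tilde_zero(1)] by (simp add: tilde_zero(2))
  ultimately show ?thesis using P square_in_C_cp[OF X] by (auto simp: P_cp_def)
qed

text \<open>A matrix $Z^* Z$ is the sum over the rows of $Z$ of matrices of the form $a_i^* a_j$.\<close>

lemma completely_positive_of_P_cp:
  assumes P: "T \<in> P_cp B"
  shows "completely_positive T"
  unfolding completely_positive_def
proof (intro conjI allI impI)
  show "clinear T" by (rule T_clinear)
  show "range T \<subseteq> bounded_ops" using T_bounded_ops by blast
  fix n and X :: "nat \<Rightarrow> nat \<Rightarrow> 'a" assume "positive_matrix n X"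
  then obtain Z where Z: "\<And>i j. i < n \<Longrightarrow> j < n \<Longrightarrow> X i j = (\<Sum>k<n. star (Z k i) * Z k j)"
    unfolding positive_matrix_def by blast
  show "positive_op_matrix n (\<lambda>i j. T (X i j))"
    unfolding positive_op_matrix_def
  proof
    fix \<xi>
    have "(\<Sum>i<n. \<Sum>j<n. cinner (\<xi> i) (T (X i j) \<cdot> (\<xi> j)))
        = (\<Sum>i<n. \<Sum>j<n. \<Sum>k<n. cinner (\<xi> i) (T (star (Z k i) * Z k j) \<cdot> (\<xi> j)))"
      by (intro sum.cong HOL.refl) (simp add: Z clinear_sum[OF T_clinear] blinfun.sum_left cinner_sum_right)
    also have "\<dots> = (\<Sum>i<n. \<Sum>k<n. \<Sum>j<n. cinner (\<xi> i) (T (star (Z k i) * Z k j) \<cdot> (\<xi> j)))"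
      by (intro sum.cong HOL.refl sum.swap)
    also have "\<dots> = (\<Sum>k<n. \<Sum>i<n. \<Sum>j<n. cinner (\<xi> i) (T (star (Z k i) * Z k j) \<cdot> (\<xi> j)))"
      by (rule sum.swap)
    also have "\<dots> \<in> \<real>\<^sub>\<ge>\<^sub>0" by (intro nonneg_Reals_sum form_nonneg_of_P_cp P)
    finally show "(\<Sum>i<n. \<Sum>j<n. cinner (\<xi> i) (T (X i j) \<cdot> (\<xi> j))) \<in> \<real>\<^sub>\<ge>\<^sub>0" .
  qed
qed

end

theorem mainTheorem1:
  fixes B :: "'h::complex_hilbert set"
  assumes "orthonormal_basis B"
  shows "P_cp B = {T :: 'a::cstar_algebra \<Rightarrow> ('h \<Rightarrow>\<^sub>L 'h). completely_positive T}"
proof (rule set_eqI)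
  fix T :: "'a \<Rightarrow> ('h \<Rightarrow>\<^sub>L 'h)"
  interpret hilbert_basis B by unfold_locales (rule assms)
  show "T \<in> P_cp B \<longleftrightarrow> T \<in> {T. completely_positive T}"
  proof
    assume P: "T \<in> P_cp B"
    then interpret bounded_map B T by unfold_locales (simp add: P_cp_def)
    show "T \<in> {T. completely_positive T}" using completely_positive_of_P_cp[OF P] by simp
  next
    assume "T \<in> {T. completely_positive T}"
    then have cp: "completely_positive T" by simp
    interpret bounded_map B T by unfold_locales (rule completely_positive_bounded[OF cp])
    show "T \<in> P_cp B" using tilde_C_cp_nonneg[OF cp] completely_positive_bounded[OF cp] by (simp add: P_cp_def)
  qed
qed

end
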